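(* Let $F\subset\mathrm{Sym}^2(\mathbb{R}^n)$ be a cone subequation with finite Riesz characteristic $p\ge2$ such that $-P_e\notin F$ for every unit vector $e$. Suppose that for every ball $B$ centered at the origin, the Riesz kernel $K_p$ is the only function $h\in C(\overline B\setminus\{0\})$ which is $F$-harmonic on $B\setminus\{0\}$, equals $K_p$ on $\partial B$, and has density $\Theta(h,0)=1$. Let $\Omega\subset\mathbb{R}^n$ be a bounded domain with smooth strictly $F$-convex boundary and $\varphi\in C(\partial\Omega)$. Then for any distinct $x_1,\dots,x_k\in\Omega$ and $\Theta_1,\dots,\Theta_k>0$ there is at most one $H\in C(\overline\Omega\setminus\{x_1,\dots,x_k\})$ which is $F$-harmonic on $\Omega\setminus\{x_1,\dots,x_k\}$, satisfies $H|_{\partial\Omega}=\varphi$, and has density $\Theta(H,x_j)=\Theta_j$ for each $j$.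
   Context: A cone subequation is a closed $F\subset\mathrm{Sym}^2(\mathbb{R}^n)$ with $A\in F,P\ge0\Rightarrow A+P\in F$ and $tF=F$ for $t>0$; $\tilde F=\{A:-A\notin\mathrm{Int}F\}$. $F$-subharmonic: upper semicontinuous $[-\infty,\infty)$-valued with $D^2\phi(x_1)\in F$ for every $C^2$ test function $\phi$ ($u\le\phi$ near $x_1$, equality at $x_1$); $F$-harmonic: finite, continuous, $F$-subharmonic with $-u$ $\tilde F$-subharmonic. $F$ has finite Riesz characteristic $p$ if $P_{e^\perp}-(p-1)P_e\in\partial F$ for all unit $e$ ($P_e,P_{e^\perp}$ orthogonal projections onto $\mathbb{R}e$, $e^\perp$). Riesz kernel: $K_p(x)=-\frac{1}{p-2}|x|^{2-p}$ ($p\ne2$), $K_2(x)=\log|x|$; $K_p(r)$ is its value at $|x|=r$. Density (for $p\ge2$): $\Theta(u,x_0)=\lim_{r\to0}\frac{\sup_{B_r(x_0)}u}{K_p(r)}$. Smooth boundary strictly $F$-convex: for each $x\in\partial\Omega$ and local defining function $\rho$, $D^2\rho(x)+tP_\nu\in\mathrm{Int}F$ for all large $t$, $\nu$ the unit normal. *)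

theory Defs
  imports "HOL-Analysis.Analysis" "HOL-Library.Extended_Real"
begin

definition sym_mat :: "real^'n^'n \<Rightarrow> bool" where
  "sym_mat A \<longleftrightarrow> transpose A = A"

definition psd :: "real^'n^'n \<Rightarrow> bool" where
  "psd P \<longleftrightarrow> sym_mat P \<and> (\<forall>v. 0 \<le> v \<bullet> (P *v v))"

definition sym_interior :: "(real^'n^'n) set \<Rightarrow> (real^'n^'n) set" where
  "sym_interior F = {A. sym_mat A \<and> (\<exists>e>0. \<forall>B. sym_mat B \<and> dist B A < e \<longrightarrow> B \<in> F)}"

definition sym_boundary :: "(real^'n^'n) set \<Rightarrow> (real^'n^'n) set" where
  "sym_boundary F = {A. sym_mat A \<and> (\<forall>e>0. (\<exists>B. sym_mat B \<and> dist B A < e \<and> B \<in> F)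
                                      \<and> (\<exists>B. sym_mat B \<and> dist B A < e \<and> B \<notin> F))}"

definition cone_subequation :: "(real^'n^'n) set \<Rightarrow> bool" where
  "cone_subequation F \<longleftrightarrow> F \<subseteq> {A. sym_mat A} \<and> closed F
     \<and> (\<forall>A\<in>F. \<forall>P. psd P \<longrightarrow> A + P \<in> F)
     \<and> (\<forall>t>0. (\<lambda>A. t *\<^sub>R A) ` F = F)"

definition dual_subeq :: "(real^'n^'n) set \<Rightarrow> (real^'n^'n) set" where
  "dual_subeq F = {A. sym_mat A \<and> - A \<notin> sym_interior F}"

definition proj_line :: "real^'n \<Rightarrow> real^'n^'n" where
  "proj_line e = (\<chi> i j. e$i * e$j)"

definition riesz_characteristic :: "(real^'n^'n) set \<Rightarrow> real \<Rightarrow> bool" where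
  "riesz_characteristic F p \<longleftrightarrow>
     (\<forall>e::real^'n. norm e = 1 \<longrightarrow>
        (mat 1 - proj_line e) - (p - 1) *\<^sub>R proj_line e \<in> sym_boundary F)"

definition partial_deriv :: "'n \<Rightarrow> (real^'n \<Rightarrow> real) \<Rightarrow> real^'n \<Rightarrow> real" where
  "partial_deriv i f y = frechet_derivative f (at y) (axis i 1)"

fun C_k_on :: "nat \<Rightarrow> (real^'n) set \<Rightarrow> (real^'n \<Rightarrow> real) \<Rightarrow> bool" where
  "C_k_on 0 U f = continuous_on U f"
| "C_k_on (Suc k) U f = (continuous_on U f \<and> (\<forall>y\<in>U. f differentiable (at y))
      \<and> (\<forall>i. C_k_on k U (partial_deriv i f)))"

definition smooth_on :: "(real^'n) set \<Rightarrow> (real^'n \<Rightarrow> real) \<Rightarrow> bool" where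
  "smooth_on U f \<longleftrightarrow> (\<forall>k. C_k_on k U f)"

definition gradient :: "(real^'n \<Rightarrow> real) \<Rightarrow> real^'n \<Rightarrow> real^'n" where
  "gradient f x = (\<chi> i. partial_deriv i f x)"

definition hessian :: "(real^'n \<Rightarrow> real) \<Rightarrow> real^'n \<Rightarrow> real^'n^'n" where
  "hessian f x = (\<chi> i j. partial_deriv j (partial_deriv i f) x)"

definition usc_on :: "(real^'n) set \<Rightarrow> (real^'n \<Rightarrow> ereal) \<Rightarrow> bool" where
  "usc_on X u \<longleftrightarrow> (\<forall>x\<in>X. \<forall>c. u x < c \<longrightarrow> (\<forall>\<^sub>F y in at x within X. u y < c))"

definition F_subharmonic :: "(real^'n^'n) set \<Rightarrow> (real^'n) set \<Rightarrow> (real^'n \<Rightarrow> ereal) \<Rightarrow> bool" where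
  "F_subharmonic F X u \<longleftrightarrow> usc_on X u \<and> (\<forall>x\<in>X. u x \<noteq> \<infinity>) \<and>
     (\<forall>x1\<in>X. \<forall>\<phi> U. open U \<and> x1 \<in> U \<and> C_k_on 2 U \<phi>
        \<and> (\<exists>r>0. \<forall>y\<in>X \<inter> ball x1 r. u y \<le> ereal (\<phi> y))
        \<and> u x1 = ereal (\<phi> x1)
        \<longrightarrow> hessian \<phi> x1 \<in> F)"

definition F_harmonic :: "(real^'n^'n) set \<Rightarrow> (real^'n) set \<Rightarrow> (real^'n \<Rightarrow> real) \<Rightarrow> bool" where
  "F_harmonic F X u \<longleftrightarrow> continuous_on X u
     \<and> F_subharmonic F X (\<lambda>x. ereal (u x))
     \<and> F_subharmonic (dual_subeq F) X (\<lambda>x. ereal (- u x))"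

definition riesz_K :: "real \<Rightarrow> real \<Rightarrow> real" where
  "riesz_K p r = (if p = 2 then ln r else - (1 / (p - 2)) * r powr (2 - p))"

definition has_density :: "real \<Rightarrow> (real^'n \<Rightarrow> real) \<Rightarrow> real^'n \<Rightarrow> real \<Rightarrow> bool" where
  "has_density p u x0 \<Theta> \<longleftrightarrow>
     ((\<lambda>r. (SUP y\<in>ball x0 r - {x0}. ereal (u y)) / ereal (riesz_K p r)) \<longlongrightarrow> ereal \<Theta>) (at_right 0)"

definition local_defining_function :: "(real^'n) set \<Rightarrow> real^'n \<Rightarrow> (real^'n \<Rightarrow> real) \<Rightarrow> bool" where
  "local_defining_function \<Omega> x \<rho> \<longleftrightarrow> (\<exists>U. open U \<and> x \<in> U \<and> smooth_on U \<rho>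
      \<and> \<Omega> \<inter> U = {y\<in>U. \<rho> y < 0} \<and> (\<forall>y\<in>U. gradient \<rho> y \<noteq> 0))"

definition smooth_boundary :: "(real^'n) set \<Rightarrow> bool" where
  "smooth_boundary \<Omega> \<longleftrightarrow> (\<forall>x\<in>frontier \<Omega>. \<exists>\<rho>. local_defining_function \<Omega> x \<rho>)"

definition strictly_F_convex_boundary :: "(real^'n^'n) set \<Rightarrow> (real^'n) set \<Rightarrow> bool" where
  "strictly_F_convex_boundary F \<Omega> \<longleftrightarrow> smooth_boundary \<Omega> \<and>
     (\<forall>x\<in>frontier \<Omega>. \<forall>\<rho>. local_defining_function \<Omega> x \<rho> \<longrightarrow>
        (\<exists>T. \<forall>t\<ge>T. hessian \<rho> x + t *\<^sub>R proj_line (gradient \<rho> x /\<^sub>R norm (gradient \<rho> x))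
                     \<in> sym_interior F))"

end

theory Submission
  imports Defs "HOL-Complex_Analysis.Great_Picard"
begin

text \<open>
  Near a pole \<open>a\<close> a solution \<open>H\<close> of density \<open>\<theta>\<close> stays within bounded distance of
  \<open>\<theta> K\<^sub>p(x - a)\<close>: after normalisation, Perron's method between \<open>H - c\<close> and \<open>H + c\<close>, with barriers
  that force the boundary values \<open>K\<^sub>p\<close> on a small sphere, yields a harmonic function of density 1,
  which is \<open>K\<^sub>p\<close> by the uniqueness hypothesis. So two solutions differ by a bounded amount at the
  poles, where both tend to minus infinity; hence \<open>(1 + \<eta>) H1 - H2\<close> does so too, and comparison on
  the punctured domain followed by \<open>\<eta> \<rightarrow> 0\<close> gives \<open>H1 \<le> H2\<close>.

  Comparison is proved by sup-convolution and Jensen's contact set. Alexandrov's theorem is replaced by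
  a blow-up argument: as the contact set is not porous, some blow-up limit of the semiconvex function
  is \<open>C\<^sup>1\<^sup>,\<^sup>1\<close> on the whole space; a limit whose second difference is maximal in some direction is
  quadratic along that direction, up to an invariant remainder, and iterating over the dimension
  produces a quadratic limit.
\<close>

section \<open>Convex functions and second differences\<close>

text \<open>The equation is nonlinear, so the difference of two solutions solves no equation. What
  survives is a maximum principle for \<open>u + v\<close> with \<open>u\<close> subharmonic for
  \<open>F\<close> and \<open>v\<close> for \<open>dual_subeq F\<close>: by \<open>dual_gap\<close>,
  no \<open>A\<close> in \<open>F\<close> and \<open>B\<close> in \<open>dual_subeq F\<close> have a
  negative definite sum. A strictly convex quadratic added to \<open>u + v\<close> leaves a fixed
  gap in the matrix inequality, so second-order information with a prescribed error suffices. This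
  is why an approximate quadratic at one contact point and one small scale can stand in for a
  pointwise second derivative. The factor \<open>1 + \<eta>\<close> is admissible because
  \<open>F\<close> is a cone. It is used twice: once at the end, and once inside Perron's method.
  There the envelope \<open>h\<close> and the upper semicontinuous hull \<open>g\<close> of
  \<open>- h\<close> satisfy \<open>h + g \<ge> 0\<close> by construction; the comparison of
  \<open>(1 + \<eta>) h\<close> with \<open>g\<close> gives the reverse inequality, and only then is
  \<open>h\<close> known to be continuous. Uniqueness of the kernel is applied on a ball around one
  pole that avoids all others, after translation to the origin and division by the density.\<close>

definition second_diff :: "('a::real_vector \<Rightarrow> real) \<Rightarrow> 'a \<Rightarrow> 'a \<Rightarrow> real" where
  "second_diff f y h = f (y + h) + f (y - h) - 2 * f y"

lemma second_diff_add: "second_diff (\<lambda>x. f x + g x) y h = second_diff f y h + second_diff g y h"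
  by (simp add: second_diff_def)

lemma second_diff_quadratic:
  fixes T :: "'a::real_inner \<Rightarrow> 'a"
  assumes "linear T"
  shows "second_diff (\<lambda>x. x \<bullet> T x) y h = 2 * (h \<bullet> T h)"
  by (simp add: second_diff_def linear_add[OF assms] linear_diff[OF assms] inner_add inner_diff
      algebra_simps)

lemma second_diff_norm_sq:
  fixes y h :: "'a::real_inner"
  shows "second_diff (\<lambda>x. c * (norm x)\<^sup>2) y h = 2 * c * (norm h)\<^sup>2"
  by (simp add: second_diff_def power2_norm_eq_inner inner_add inner_diff algebra_simps)

text \<open>On a segment the excess \<open>\<psi>\<close> over the chord inherits the midpoint
  inequality and vanishes at both ends. A positive maximum would have a leftmost point, and the
  midpoint inequality there produces a maximum further left.\<close>

lemma midpoint_convex_imp_convex: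
  fixes f :: "'a::real_normed_vector \<Rightarrow> real"
  assumes cont: "continuous_on UNIV f" and sd: "\<And>y h. second_diff f y h \<ge> 0"
  shows "convex_on UNIV f"
proof (rule convex_onI)
  fix t :: real and x y :: 'a
  assume t: "0 < t" "t < 1"
  define \<psi> where "\<psi> s = f ((1 - s) *\<^sub>R x + s *\<^sub>R y) - ((1 - s) * f x + s * f y)" for s :: real
  have c\<psi>: "continuous_on {0..1} \<psi>"
    unfolding \<psi>_def
    by (intro continuous_intros continuous_on_compose2[OF cont]) auto
  obtain s0 where s0: "s0 \<in> {0..1}" "\<And>s. s \<in> {0..1} \<Longrightarrow> \<psi> s \<le> \<psi> s0"
    using continuous_attains_sup[of "{0..1::real}" \<psi>] c\<psi> by auto
  have mid: "2 * \<psi> s \<le> \<psi> (s + d) + \<psi> (s - d)" for s d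
  proof -
    have "f ((1 - s) *\<^sub>R x + s *\<^sub>R y + d *\<^sub>R (y - x)) + f ((1 - s) *\<^sub>R x + s *\<^sub>R y - d *\<^sub>R (y - x))
        - 2 * f ((1 - s) *\<^sub>R x + s *\<^sub>R y) \<ge> 0"
      using sd[of "(1 - s) *\<^sub>R x + s *\<^sub>R y" "d *\<^sub>R (y - x)"] by (simp add: second_diff_def)
    moreover have "(1 - s) *\<^sub>R x + s *\<^sub>R y + d *\<^sub>R (y - x) = (1 - (s + d)) *\<^sub>R x + (s + d) *\<^sub>R y"
      "(1 - s) *\<^sub>R x + s *\<^sub>R y - d *\<^sub>R (y - x) = (1 - (s - d)) *\<^sub>R x + (s - d) *\<^sub>R y"
      by (simp_all add: algebra_simps)
    ultimately show ?thesis by (simp add: \<psi>_def algebra_simps)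
  qed
  have "\<psi> s0 \<le> 0"
  proof (rule ccontr)
    assume "\<not> \<psi> s0 \<le> 0"
    define S where "S = {s \<in> {0..1}. \<psi> s = \<psi> s0}"
    have clS: "closed S"
      unfolding S_def using continuous_closed_preimage_constant[OF c\<psi>] by simp
    have neS: "S \<noteq> {}" and bS: "bdd_below S"
      using s0 by (auto simp: S_def intro: bdd_belowI[of _ 0])
    define a where "a = Inf S"
    have aS: "a \<in> S"
      unfolding a_def by (rule closed_contains_Inf[OF neS bS clS])
    have e: "\<psi> 0 = 0" "\<psi> 1 = 0" by (simp_all add: \<psi>_def)
    have a01: "0 < a" "a < 1" "\<psi> a = \<psi> s0"
      using aS e \<open>\<not> \<psi> s0 \<le> 0\<close> unfolding S_def by (auto simp: less_le)
    define d where "d = min a (1 - a)"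
    have d: "0 < d" "d \<le> a" "d \<le> 1 - a" using a01 by (auto simp: d_def)
    have "2 * \<psi> s0 \<le> \<psi> (a + d) + \<psi> (a - d)" using mid[of a d] a01 by simp
    moreover have "\<psi> (a + d) \<le> \<psi> s0" "\<psi> (a - d) \<le> \<psi> s0" using s0(2) d a01 by auto
    ultimately have "\<psi> (a - d) = \<psi> s0" by linarith
    then have "a - d \<in> S" using d a01 by (auto simp: S_def)
    then have "a \<le> a - d" unfolding a_def using bS by (intro cInf_lower)
    with d show False by linarith
  qed
  then have "\<psi> t \<le> 0" using s0(2)[of t] t by simp
  then show "f ((1 - t) *\<^sub>R x + t *\<^sub>R y) \<le> (1 - t) * f x + t * f y"
    by (simp add: \<psi>_def)
qed simp

text \<open>Prolonging the segment from \<open>x\<close> to \<open>y\<close> by the length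
  \<open>R\<close> stays in the ball of radius \<open>2 * R\<close>. Along it the slope of a convex
  function is at most its oscillation \<open>2 * B\<close> divided by \<open>R\<close>.\<close>

lemma convex_bounded_Lipschitz:
  fixes f :: "'a::real_normed_vector \<Rightarrow> real"
  assumes conv: "convex_on UNIV f" and R: "R > 0"
    and B: "\<And>x. norm x \<le> 2 * R \<Longrightarrow> \<bar>f x\<bar> \<le> B"
    and xy: "norm x \<le> R" "norm y \<le> R"
  shows "\<bar>f x - f y\<bar> \<le> 2 * B / R * norm (x - y)"
proof -
  have "f y - f x \<le> 2 * B / R * norm (x - y)" if xy: "norm x \<le> R" "norm y \<le> R" for x y
  proof (cases "x = y")
    case False
    define d where "d = norm (y - x)"
    have d: "d > 0" using False by (simp add: d_def)
    define z where "z = y + (R / d) *\<^sub>R (y - x)"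
    have nz: "norm z \<le> 2 * R"
    proof -
      have "norm z \<le> norm y + norm ((R / d) *\<^sub>R (y - x))" unfolding z_def by (rule norm_triangle_ineq)
      also have "norm ((R / d) *\<^sub>R (y - x)) = R" using d R by (simp add: d_def)
      finally show ?thesis using xy by simp
    qed
    define l where "l = d / (d + R)"
    have l: "0 \<le> l" "l \<le> 1" "l \<le> d / R" using d R by (auto simp: l_def field_simps)
    have "(1 - l) *\<^sub>R x + l *\<^sub>R z = x + (l + l * R / d) *\<^sub>R (y - x)"
      by (simp add: z_def algebra_simps)
    also have "l + l * R / d = 1" using d R by (simp add: l_def divide_simps)
    finally have y: "(1 - l) *\<^sub>R x + l *\<^sub>R z = y" by simp
    have "f y \<le> (1 - l) * f x + l * f z"
      using convex_onD[OF conv, of l x z] l y by simp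
    then have "f y - f x \<le> l * (f z - f x)" by (simp add: algebra_simps)
    also have "\<dots> \<le> l * (2 * B)"
      using B[OF nz] B[of x] xy R l by (intro mult_left_mono) auto
    also have "\<dots> \<le> d / R * (2 * B)"
      using l B[of 0] R by (intro mult_right_mono) auto
    finally show ?thesis by (simp add: d_def norm_minus_commute mult.commute)
  qed simp
  from this[of x y] this[of y x] xy show ?thesis by (simp add: abs_le_iff norm_minus_commute)
qed

text \<open>The point \<open>x + t e\<close> is the limit of convex combinations of \<open>x\<close>
  and of points far out on the line, whose weight tends to 0 while \<open>W\<close> stays equal to
  \<open>W 0\<close> there.\<close>

lemma convex_const_on_line:
  fixes W :: "'a::real_normed_vector \<Rightarrow> real"
  assumes conv: "convex_on UNIV W" and cont: "continuous_on UNIV W"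
    and line: "\<And>t. W (t *\<^sub>R e) = W 0"
  shows "W (x + t *\<^sub>R e) = W x"
proof -
  have le: "W (x + t *\<^sub>R e) \<le> W x" for x t
  proof -
    define l where "l n = inverse (real (Suc n))" for n
    have l0: "l \<longlonglongrightarrow> 0" unfolding l_def by (rule LIMSEQ_inverse_real_of_nat)
    have l01: "0 < l n" "l n \<le> 1" for n by (simp_all add: l_def field_simps)
    have "W ((1 - l n) *\<^sub>R x + t *\<^sub>R e) \<le> (1 - l n) * W x + l n * W 0" for n
      using convex_onD[OF conv, of "l n" x "(t / l n) *\<^sub>R e"] l01[of n] line[of "t / l n"]
      by (simp add: less_imp_le)
    moreover have "(\<lambda>n. W ((1 - l n) *\<^sub>R x + t *\<^sub>R e)) \<longlonglongrightarrow> W ((1 - 0) *\<^sub>R x + t *\<^sub>R e)"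
      by (rule continuous_on_tendsto_compose[OF cont]) (intro tendsto_intros l0, auto)
    moreover have "(\<lambda>n. (1 - l n) * W x + l n * W 0) \<longlonglongrightarrow> (1 - 0) * W x + 0 * W 0"
      by (intro tendsto_intros l0)
    ultimately show ?thesis by (auto intro: LIMSEQ_le)
  qed
  from le[of x t] le[of "x + t *\<^sub>R e" "- t"] show ?thesis by simp
qed

text \<open>Vanishing second differences make \<open>W - W 0\<close> odd along the line, which turns
  the chord inequalities of convexity into equalities. Once the slope is subtracted,
  \<open>convex_const_on_line\<close> carries the result to all parallel lines.\<close>

lemma convex_affine_on_line:
  fixes W :: "'a::euclidean_space \<Rightarrow> real"
  assumes conv: "convex_on UNIV W" and cont: "continuous_on UNIV W"
    and e: "norm e = 1" and line: "\<And>t. second_diff W 0 (t *\<^sub>R e) = 0"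
  shows "\<exists>c. \<forall>x t. W (x + t *\<^sub>R e) = W x + t * c"
proof -
  define c where "c = W e - W 0"
  have odd: "W (t *\<^sub>R e) + W (- t *\<^sub>R e) = 2 * W 0" for t
    using line[of t] by (simp add: second_diff_def)
  have up: "W (t *\<^sub>R e) \<le> W 0 + t * c" if "0 \<le> t" "t \<le> 1" for t
    using convex_onD[OF conv, of t 0 e] that by (simp add: c_def algebra_simps)
  have up2: "W (t *\<^sub>R e) \<le> W 0 + t * c" if "-1 \<le> t" "t \<le> 0" for t
  proof -
    have "W (- e) = 2 * W 0 - W e" using odd[of 1] by simp
    then have "t * W (- e) = 2 * (t * W 0) - t * W e" by (metis right_diff_distrib mult.left_commute)
    moreover have "W (t *\<^sub>R e) + t * W (- e) \<le> W 0 + t * W 0"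
      using convex_onD[OF conv, of "-t" 0 "-e"] that by (simp add: algebra_simps)
    ultimately show ?thesis by (simp add: c_def right_diff_distrib)
  qed
  have small: "W (t *\<^sub>R e) = W 0 + t * c" if "\<bar>t\<bar> \<le> 1" for t
    using up[of t] up2[of t] up[of "-t"] up2[of "-t"] odd[of t] that
    by (cases "0 \<le> t") (auto simp: abs_if)
  \<comment> \<open>Outside the unit segment, the chord from \<open>0\<close> to \<open>t e\<close>
    is compared with \<open>W\<close> at a point inside the segment, where \<open>W\<close> is
    already known.\<close>
  have ge: "W (t *\<^sub>R e) \<ge> W 0 + t * c" for t
  proof (cases "\<bar>t\<bar> \<le> 1")
    case False
    define l where "l = 1 / \<bar>t\<bar>"
    have l: "0 < l" "l \<le> 1" "\<bar>l * t\<bar> \<le> 1" using False by (auto simp: l_def abs_mult)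
    have "W ((l * t) *\<^sub>R e) \<le> (1 - l) * W 0 + l * W (t *\<^sub>R e)"
      using convex_onD[OF conv, of l 0 "t *\<^sub>R e"] l by simp
    then have "l * (W 0 + t * c) \<le> l * W (t *\<^sub>R e)"
      using small[OF l(3)] by (simp add: algebra_simps)
    then show ?thesis using l by simp
  qed (simp add: small)
  have eq: "W (t *\<^sub>R e) = W 0 + t * c" for t
    using ge[of t] ge[of "-t"] odd[of t] by simp
  define V where "V x = W x + (- c) * (x \<bullet> e)" for x
  have ee: "e \<bullet> e = 1" using e by (simp add: dot_square_norm)
  have "convex_on UNIV (\<lambda>x. (- c) * (x \<bullet> e))"
    by (intro convex_onI) (auto simp: inner_add algebra_simps)
  then have cV: "convex_on UNIV V" unfolding V_def by (intro convex_on_add conv)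
  have contV: "continuous_on UNIV V" unfolding V_def by (intro continuous_intros cont)
  have "V (x + t *\<^sub>R e) = V x" for x t
    by (rule convex_const_on_line[OF cV contV]) (simp add: V_def eq ee)
  then have "\<forall>x t. W (x + t *\<^sub>R e) = W x + t * c"
    by (simp add: V_def inner_add ee algebra_simps)
  then show ?thesis by blast
qed

lemma tendsto_compose_loc_uniform:
  fixes f :: "'a::real_normed_vector \<Rightarrow> real"
  assumes unif: "\<And>R. uniform_limit (cball 0 R) A f sequentially" and cont: "continuous_on UNIV f"
    and Y: "Y \<longlonglongrightarrow> y"
  shows "(\<lambda>k. A k (Y k)) \<longlonglongrightarrow> f y"
proof -
  obtain R where R: "\<And>k. norm (Y k) \<le> R"
    using convergent_imp_Bseq[of Y] Y by (auto simp: convergent_def Bseq_def)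
  have "(\<lambda>k. A k (Y k) - f (Y k)) \<longlonglongrightarrow> 0"
  proof (rule tendstoI)
    fix \<epsilon> :: real assume "\<epsilon> > 0"
    from uniform_limitD[OF unif[of R] this]
    show "\<forall>\<^sub>F k in sequentially. dist (A k (Y k) - f (Y k)) 0 < \<epsilon>"
      by eventually_elim (use R in \<open>auto simp: dist_real_def\<close>)
  qed
  moreover have "(\<lambda>k. f (Y k)) \<longlonglongrightarrow> f y"
    by (rule continuous_on_tendsto_compose[OF cont Y]) auto
  ultimately show ?thesis using tendsto_add by fastforce
qed

section \<open>Directions along which a function is quadratic\<close>

definition quad_residual :: "('a::real_inner \<Rightarrow> 'a) \<Rightarrow> ('a \<Rightarrow> real) \<Rightarrow> 'a \<Rightarrow> real" where
  "quad_residual T f x = f x - (x \<bullet> T x) / 2"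

text \<open>Since the slope \<open>c\<close> may not depend on the base point, these directions form
  a subspace. When it is the whole space, the residual is affine and \<open>f\<close> is a quadratic
  polynomial.\<close>

definition inv_dirs :: "('a::real_inner \<Rightarrow> 'a) \<Rightarrow> ('a \<Rightarrow> real) \<Rightarrow> 'a set" where
  "inv_dirs T f = {h. \<exists>c. \<forall>x t. quad_residual T f (x + t *\<^sub>R h) - quad_residual T f x = t * c}"

definition self_adjoint :: "('a::real_inner \<Rightarrow> 'a) \<Rightarrow> bool" where
  "self_adjoint T \<longleftrightarrow> linear T \<and> (\<forall>x y. T x \<bullet> y = x \<bullet> T y)"

text \<open>Expressing the slope by values of the residual removes the existential quantifier, so
  that the condition passes to pointwise limits.\<close>

lemma inv_dirs_iff:
  "h \<in> inv_dirs T f \<longleftrightarrow> (\<forall>x t. quad_residual T f (x + t *\<^sub>R h) - quad_residual T f x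
      = t * (quad_residual T f h - quad_residual T f 0))"
proof
  assume "h \<in> inv_dirs T f"
  then obtain c where c: "\<And>x t. quad_residual T f (x + t *\<^sub>R h) - quad_residual T f x = t * c"
    by (auto simp: inv_dirs_def)
  from c[of 0 1] c show "\<forall>x t. quad_residual T f (x + t *\<^sub>R h) - quad_residual T f x
      = t * (quad_residual T f h - quad_residual T f 0)" by simp
qed (auto simp: inv_dirs_def)

lemma subspace_inv_dirs: "subspace (inv_dirs T f)"
  unfolding subspace_def
proof (intro conjI ballI allI)
  show "0 \<in> inv_dirs T f" by (auto simp: inv_dirs_def intro: exI[of _ 0])
next
  fix x y assume "x \<in> inv_dirs T f" "y \<in> inv_dirs T f"
  then obtain c d where
    c: "\<And>z t. quad_residual T f (z + t *\<^sub>R x) - quad_residual T f z = t * c" and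
    d: "\<And>z t. quad_residual T f (z + t *\<^sub>R y) - quad_residual T f z = t * d"
    by (auto simp: inv_dirs_def)
  have "quad_residual T f (z + t *\<^sub>R (x + y)) - quad_residual T f z = t * (c + d)" for z t
    using c[of z t] d[of "z + t *\<^sub>R x" t] by (simp add: algebra_simps)
  then show "x + y \<in> inv_dirs T f" by (auto simp: inv_dirs_def)
next
  fix s x assume "x \<in> inv_dirs T f"
  then obtain c where
    c: "\<And>z t. quad_residual T f (z + t *\<^sub>R x) - quad_residual T f z = t * c"
    by (auto simp: inv_dirs_def)
  have "quad_residual T f (z + t *\<^sub>R (s *\<^sub>R x)) - quad_residual T f z = t * (s * c)" for z t
    using c[of z "t * s"] by (simp add: algebra_simps)
  then show "s *\<^sub>R x \<in> inv_dirs T f" by (auto simp: inv_dirs_def)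
qed

text \<open>The extra terms are affine in \<open>z\<close>; this is why blow-ups keep invariance
  directions.\<close>

lemma quad_residual_rescale:
  assumes T: "self_adjoint T" and s: "s > 0"
  shows "quad_residual T (\<lambda>z. f (y + s *\<^sub>R z) / s\<^sup>2) z
    = quad_residual T f (y + s *\<^sub>R z) / s\<^sup>2 + (y \<bullet> T y) / (2 * s\<^sup>2) + (z \<bullet> T y) / s"
proof -
  have lin: "linear T" and sa: "\<And>x y. T x \<bullet> y = x \<bullet> T y" using T by (auto simp: self_adjoint_def)
  have "(y + s *\<^sub>R z) \<bullet> T (y + s *\<^sub>R z) = y \<bullet> T y + 2 * s * (z \<bullet> T y) + s\<^sup>2 * (z \<bullet> T z)"
    using sa[of y z] by (simp add: linear_add[OF lin] linear_cmul[OF lin] inner_add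
        inner_commute power2_eq_square algebra_simps)
  then show ?thesis using s by (simp add: quad_residual_def field_simps power2_eq_square)
qed

lemma inv_dirs_rescale:
  assumes T: "self_adjoint T" and s: "s > 0" and h: "h \<in> inv_dirs T f"
  shows "h \<in> inv_dirs T (\<lambda>z. f (y + s *\<^sub>R z) / s\<^sup>2)"
proof -
  obtain c where
    c: "\<And>z t. quad_residual T f (z + t *\<^sub>R h) - quad_residual T f z = t * c"
    using h by (auto simp: inv_dirs_def)
  have "quad_residual T (\<lambda>z. f (y + s *\<^sub>R z) / s\<^sup>2) (x + t *\<^sub>R h)
      - quad_residual T (\<lambda>z. f (y + s *\<^sub>R z) / s\<^sup>2) x = t * (c / s + (h \<bullet> T y) / s)" for x t
  proof -
    have "quad_residual T f (y + s *\<^sub>R (x + t *\<^sub>R h)) = quad_residual T f (y + s *\<^sub>R x) + s * t * c"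
      using c[of "y + s *\<^sub>R x" "s * t"] by (simp add: algebra_simps)
    moreover have "s * t * c / s\<^sup>2 = t * (c / s)" using s by (simp add: power2_eq_square)
    ultimately show ?thesis
      by (simp only: quad_residual_rescale[OF T s] add_divide_distrib inner_add_left inner_scaleR_left
          distrib_left) simp
  qed
  then show ?thesis unfolding inv_dirs_def by blast
qed

text \<open>The affine corrections change the slope along \<open>h\<close> by
  \<open>q k \<bullet> h\<close>, whatever the base point, so invariance survives convergence modulo
  affine functions.\<close>

lemma inv_dirs_limit:
  fixes F :: "nat \<Rightarrow> 'a::real_inner \<Rightarrow> real"
  assumes lim: "\<And>y. (\<lambda>k. F k y - c k - q k \<bullet> y) \<longlonglongrightarrow> f y"
    and h: "\<And>k. h \<in> inv_dirs T (F k)"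
  shows "h \<in> inv_dirs T f"
  unfolding inv_dirs_iff
proof (intro allI)
  fix x t
  define G where "G k y = quad_residual T (F k) y - c k - q k \<bullet> y" for k y
  have G: "(\<lambda>k. G k y) \<longlonglongrightarrow> quad_residual T f y" for y
  proof -
    have "(\<lambda>k. F k y - c k - q k \<bullet> y - (y \<bullet> T y) / 2) \<longlonglongrightarrow> f y - (y \<bullet> T y) / 2"
      by (intro tendsto_intros lim)
    then show ?thesis by (simp add: G_def quad_residual_def algebra_simps)
  qed
  have "G k (x + t *\<^sub>R h) - G k x = t * (G k h - G k 0)" for k
    using h[of k, unfolded inv_dirs_iff, rule_format, of x t]
    by (simp add: G_def inner_add algebra_simps)
  moreover have "(\<lambda>k. G k (x + t *\<^sub>R h) - G k x) \<longlonglongrightarrow> quad_residual T f (x + t *\<^sub>R h) - quad_residual T f x"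
    by (intro tendsto_intros G)
  moreover have "(\<lambda>k. t * (G k h - G k 0)) \<longlonglongrightarrow> t * (quad_residual T f h - quad_residual T f 0)"
    by (intro tendsto_intros G)
  ultimately show "quad_residual T f (x + t *\<^sub>R h) - quad_residual T f x
      = t * (quad_residual T f h - quad_residual T f 0)"
    using LIMSEQ_unique by simp
qed

lemma second_diff_tendsto:
  assumes "\<And>y. (\<lambda>k. F k y - c k - q k \<bullet> y) \<longlonglongrightarrow> f y"
  shows "(\<lambda>k. second_diff (F k) y h) \<longlonglongrightarrow> second_diff f y h"
proof -
  have "(\<lambda>k. (F k (y + h) - c k - q k \<bullet> (y + h)) + (F k (y - h) - c k - q k \<bullet> (y - h))
      - 2 * (F k y - c k - q k \<bullet> y)) \<longlonglongrightarrow> f (y + h) + f (y - h) - 2 * f y"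
    by (intro tendsto_intros assms)
  then show ?thesis by (simp add: second_diff_def inner_add inner_diff algebra_simps)
qed

lemma second_diff_residual:
  assumes "self_adjoint T"
  shows "second_diff (quad_residual T f) y h = second_diff f y h - h \<bullet> T h"
  using second_diff_quadratic[of T y h] assms
  by (simp add: second_diff_def quad_residual_def self_adjoint_def field_simps)

lemma second_diff_rescale:
  "second_diff (\<lambda>z. f (y + s *\<^sub>R z) / s\<^sup>2) z h = second_diff f (y + s *\<^sub>R z) (s *\<^sub>R h) / s\<^sup>2"
  by (simp add: second_diff_def algebra_simps diff_divide_distrib add_divide_distrib)

text \<open>A maximal second difference in the directions transversal to the known invariance directions
  becomes, after a further blow-up, a new invariance direction.\<close>

lemma inv_dirs_extend:
  fixes \<T> :: "('a::euclidean_space \<Rightarrow> real) set"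
  assumes sd: "\<And>f y h. f \<in> \<T> \<Longrightarrow> \<bar>second_diff f y h\<bar> \<le> L * (norm h)\<^sup>2"
    and cont: "\<And>f. f \<in> \<T> \<Longrightarrow> continuous_on UNIV f"
    and scal: "\<And>f y s. f \<in> \<T> \<Longrightarrow> s > 0 \<Longrightarrow> (\<lambda>z. f (y + s *\<^sub>R z) / s\<^sup>2) \<in> \<T>"
    and comp: "\<And>F. (\<And>k. F k \<in> \<T>) \<Longrightarrow> \<exists>f\<in>\<T>. \<exists>\<sigma> c q. strict_mono (\<sigma>::nat\<Rightarrow>nat) \<and>
       (\<forall>R. uniform_limit (cball 0 R) (\<lambda>k y. F (\<sigma> k) y - c k - q k \<bullet> y) f sequentially)"
    and f0: "f0 \<in> \<T>" and T: "self_adjoint T" and ne: "inv_dirs T f0 \<noteq> UNIV"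
  shows "\<exists>f\<in>\<T>. \<exists>T'. self_adjoint T' \<and> dim (inv_dirs T f0) < dim (inv_dirs T' f)"
proof -
  define S where "S = inv_dirs T f0"
  have subS: "subspace S" unfolding S_def by (rule subspace_inv_dirs)
  obtain B where B: "B \<subseteq> S" "pairwise orthogonal B" "\<And>x. x \<in> B \<Longrightarrow> norm x = 1" "independent B"
    "card B = dim S" "span B = S"
    using orthonormal_basis_subspace[OF subS] by metis
  have finB: "finite B" using B(4) independent_bound by blast
  \<comment> \<open>The orthogonal projection onto the complement of \<open>S\<close>. Maximising
    only over unit vectors in its range, the set \<open>D\<close> below, guarantees that the
    direction found is new.\<close>
  define \<pi> where "\<pi> x = x - (\<Sum>b\<in>B. (x \<bullet> b) *\<^sub>R b)" for x
  have lin\<pi>: "linear \<pi>"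
    by (rule linearI) (simp_all add: \<pi>_def inner_add sum.distrib scaleR_add_left
        scaleR_right.sum scaleR_diff_right)
  have sa\<pi>: "\<pi> x \<bullet> y = x \<bullet> \<pi> y" for x y
    by (simp add: \<pi>_def inner_diff inner_sum_left inner_sum_right inner_commute mult.commute)
  have bb: "b \<bullet> b' = (if b = b' then 1 else 0)" if "b \<in> B" "b' \<in> B" for b b'
    using B(2,3) that by (auto simp: pairwise_def orthogonal_def dot_square_norm)
  have \<pi>b: "\<pi> b = 0" if "b \<in> B" for b
  proof -
    have "(\<Sum>b'\<in>B. (b \<bullet> b') *\<^sub>R b') = (\<Sum>b'\<in>B. if b = b' then b' else 0)"
      using that by (intro sum.cong) (auto simp: bb)
    also have "\<dots> = b" using that finB by simp
    finally show ?thesis by (simp add: \<pi>_def)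
  qed
  have \<pi>S: "\<pi> h = 0" if "h \<in> S" for h
    using linear_eq_0_on_span[OF lin\<pi>, of B h] \<pi>b that B(6) by auto
  have S\<pi>: "x - \<pi> x \<in> S" for x
  proof -
    have "x - \<pi> x = (\<Sum>b\<in>B. (x \<bullet> b) *\<^sub>R b)" by (simp add: \<pi>_def)
    also have "\<dots> \<in> S" using B(1) by (intro subspace_sum subspace_scale subS) auto
    finally show ?thesis .
  qed
  have \<pi>\<pi>: "\<pi> (\<pi> x) = \<pi> x" for x
    using \<pi>S[OF S\<pi>[of x]] by (simp add: linear_diff[OF lin\<pi>])
  have cont\<pi>: "continuous_on UNIV \<pi>" using lin\<pi> by (simp add: linear_continuous_on linear_conv_bounded_linear)
  define D where "D = {e. norm e = 1 \<and> \<pi> e = e}"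
  have normalized: "\<pi> v = 0 \<or> (inverse (norm (\<pi> v))) *\<^sub>R \<pi> v \<in> D" for v
    by (cases "\<pi> v = 0") (auto simp: D_def linear_cmul[OF lin\<pi>] \<pi>\<pi>)
  have "D \<noteq> {}"
  proof -
    obtain v where "v \<notin> S" using ne by (auto simp: S_def)
    then have "\<pi> v \<noteq> 0" using S\<pi>[of v] by auto
    then show ?thesis using normalized[of v] by blast
  qed
  then obtain d0 where d0: "d0 \<in> D" by blast
  have compD: "compact D"
  proof -
    have "D = sphere 0 1 \<inter> {e. \<pi> e = e}" by (auto simp: D_def)
    moreover have "closed {e. \<pi> e = e}"
      by (rule closed_Collect_eq) (auto intro: cont\<pi>)
    ultimately show ?thesis by (auto intro: compact_Int_closed)
  qed
  \<comment> \<open>Restricting to functions that keep all of \<open>S\<close> makes the old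
    directions survive; the class is still closed under rescaling and under limits modulo affine
    functions.\<close>
  define \<F> where "\<F> = {f \<in> \<T>. S \<subseteq> inv_dirs T f}"
  have f0F: "f0 \<in> \<F>" using f0 by (simp add: \<F>_def S_def)
  \<comment> \<open>Because the class is closed under moving the base point and rescaling, a bound
    for the unit second difference at 0 bounds the second differences at all points and of all
    sizes.\<close>
  define v where "v f e = second_diff f 0 e - e \<bullet> T e" for f e
  define M where "M = Sup {v f e | f e. f \<in> \<F> \<and> e \<in> D}"
  have linT: "linear T" using T by (simp add: self_adjoint_def)
  have contT: "continuous_on UNIV T" using linT by (simp add: linear_continuous_on linear_conv_bounded_linear)
  have bdd: "bdd_above {v f e | f e. f \<in> \<F> \<and> e \<in> D}"
  proof -
    obtain C where C: "\<And>e. e \<in> D \<Longrightarrow> \<bar>e \<bullet> T e\<bar> \<le> C"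
    proof -
      have "compact ((\<lambda>e. e \<bullet> T e) ` D)"
        by (intro compact_continuous_image compD continuous_intros continuous_on_subset[OF contT]) auto
      from compact_imp_bounded[OF this] obtain C where "\<forall>x\<in>(\<lambda>e. e \<bullet> T e) ` D. norm x \<le> C"
        unfolding bounded_iff by blast
      then show ?thesis by (intro that) auto
    qed
    have "v f e \<le> L + C" if "f \<in> \<F>" "e \<in> D" for f e
      using sd[of f 0 e] C[of e] that by (auto simp: v_def \<F>_def D_def abs_le_iff)
    then show ?thesis by (auto intro!: bdd_aboveI)
  qed
  have vM: "v f e \<le> M" if "f \<in> \<F>" "e \<in> D" for f e
    unfolding M_def by (rule cSup_upper[OF _ bdd]) (use that in auto)
  have compF: "\<exists>f\<in>\<F>. \<exists>\<sigma> c q. strict_mono (\<sigma>::nat\<Rightarrow>nat) \<and>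
       (\<forall>R. uniform_limit (cball 0 R) (\<lambda>k y. F (\<sigma> k) y - c k - q k \<bullet> y) f sequentially)"
    if F: "\<And>k. F k \<in> \<F>" for F
  proof -
    have FT: "F k \<in> \<T>" for k using F by (simp add: \<F>_def)
    have "\<exists>f\<in>\<T>. \<exists>\<sigma> c q. strict_mono (\<sigma>::nat\<Rightarrow>nat) \<and>
       (\<forall>R. uniform_limit (cball 0 R) (\<lambda>k y. F (\<sigma> k) y - c k - q k \<bullet> y) f sequentially)"
      by (rule comp) (rule FT)
    then obtain f \<sigma> c q where f: "f \<in> \<T>" "strict_mono (\<sigma>::nat\<Rightarrow>nat)"
      "\<And>R. uniform_limit (cball 0 R) (\<lambda>k y. F (\<sigma> k) y - c k - q k \<bullet> y) f sequentially"
      by blast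
    have "(\<lambda>k. F (\<sigma> k) y - c k - q k \<bullet> y) \<longlonglongrightarrow> f y" for y
      by (rule tendsto_uniform_limitI[OF f(3)[of "norm y"]]) simp
    then have "S \<subseteq> inv_dirs T f"
      using inv_dirs_limit[where F = "\<lambda>k. F (\<sigma> k)"] F by (fastforce simp: \<F>_def)
    with f show ?thesis unfolding \<F>_def by blast
  qed
  have scalF: "(\<lambda>z. f (y + s *\<^sub>R z) / s\<^sup>2) \<in> \<F>" if "f \<in> \<F>" "s > 0" for f y s
    using that scal inv_dirs_rescale[OF T] by (auto simp: \<F>_def)

  \<comment> \<open>The supremum is attained: along a maximising sequence both the functions, modulo
    affine ones, and the directions converge, and affine terms cancel in second differences.\<close>
  obtain f1 e where f1: "f1 \<in> \<F>" and eD: "e \<in> D" and f1e: "v f1 e = M"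
  proof -
    have "\<exists>f e. f \<in> \<F> \<and> e \<in> D \<and> M - inverse (real (Suc k)) < v f e" for k
    proof -
      have lt: "M - inverse (real (Suc k)) < Sup {v f e | f e. f \<in> \<F> \<and> e \<in> D}"
        by (simp add: M_def[symmetric])
      have ne: "{v f e | f e. f \<in> \<F> \<and> e \<in> D} \<noteq> {}" using f0F d0 by blast
      obtain x where "x \<in> {v f e | f e. f \<in> \<F> \<and> e \<in> D}" "M - inverse (real (Suc k)) < x"
        using less_cSupD[OF ne lt] by blast
      then show ?thesis by blast
    qed
    then obtain F E where FE: "\<And>k. F k \<in> \<F>" "\<And>k. E k \<in> D"
      "\<And>k. M - inverse (real (Suc k)) < v (F k) (E k)" by metis
    obtain e r where e: "e \<in> D" "strict_mono (r::nat\<Rightarrow>nat)" "(E \<circ> r) \<longlonglongrightarrow> e"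
      using compD FE(2) unfolding compact_def by blast
    obtain f \<sigma> c q where f: "f \<in> \<F>" "strict_mono (\<sigma>::nat\<Rightarrow>nat)"
      "\<And>R. uniform_limit (cball 0 R) (\<lambda>k y. F (r (\<sigma> k)) y - c k - q k \<bullet> y) f sequentially"
      using compF[of "\<lambda>k. F (r k)"] FE(1) by blast
    have cf: "continuous_on UNIV f" using cont f by (auto simp: \<F>_def)
    define E' where "E' k = E (r (\<sigma> k))" for k
    have E': "E' \<longlonglongrightarrow> e" using LIMSEQ_subseq_LIMSEQ[OF e(3) f(2)] by (simp add: E'_def[abs_def] o_def)
    define G where "G k y = F (r (\<sigma> k)) y - c k - q k \<bullet> y" for k y
    have lim: "(\<lambda>k. G k (X k)) \<longlonglongrightarrow> f X0" if "X \<longlonglongrightarrow> X0" for X X0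
      unfolding G_def by (rule tendsto_compose_loc_uniform[OF f(3) cf that])
    have "(\<lambda>k. G k (E' k) + G k (- E' k) - 2 * G k 0 - E' k \<bullet> T (E' k)) \<longlonglongrightarrow> f e + f (- e) - 2 * f 0 - e \<bullet> T e"
      by (intro tendsto_intros lim E' continuous_on_tendsto_compose[OF contT]) auto
    moreover have "G k (E' k) + G k (- E' k) - 2 * G k 0 - E' k \<bullet> T (E' k) = v (F (r (\<sigma> k))) (E' k)" for k
      by (simp add: v_def second_diff_def G_def)
    ultimately have lv: "(\<lambda>k. v (F (r (\<sigma> k))) (E' k)) \<longlonglongrightarrow> v f e"
      by (simp add: v_def second_diff_def)
    have "(\<lambda>k. M - inverse (real (Suc k))) \<longlonglongrightarrow> M - 0"
      by (intro tendsto_intros LIMSEQ_inverse_real_of_nat)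
    moreover have "M - inverse (real (Suc k)) \<le> v (F (r (\<sigma> k))) (E' k)" for k
    proof -
      have "k \<le> r (\<sigma> k)" using seq_suble[OF e(2)] seq_suble[OF f(2)] order_trans by blast
      then have "inverse (real (Suc (r (\<sigma> k)))) \<le> inverse (real (Suc k))" by (simp add: field_simps)
      then show ?thesis using FE(3)[of "r (\<sigma> k)"] unfolding E'_def by linarith
    qed
    ultimately have "M \<le> v f e" using LIMSEQ_le[OF _ lv] by auto
    then show ?thesis using that f(1) e(1) vM by force
  qed
  \<comment> \<open>Adding the extremal value \<open>M\<close> in all transversal directions makes
    the second differences of the residual nonpositive on the whole class, so its negative
    \<open>W\<close> is convex; equality holds for \<open>f1\<close> in the direction
    \<open>e\<close>.\<close>
  define T' where "T' x = T x + M *\<^sub>R \<pi> x" for x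
  have T': "self_adjoint T'"
    using T lin\<pi> sa\<pi> unfolding self_adjoint_def T'_def
    by (auto intro!: linear_compose_add linear_compose_scale_right simp: inner_add)
  define W where "W f x = - quad_residual T' f x" for f x
  have \<pi>x: "x \<bullet> \<pi> x = (norm (\<pi> x))\<^sup>2" for x
    using sa\<pi>[of "\<pi> x" x] \<pi>\<pi>[of x] by (simp add: power2_norm_eq_inner inner_commute)
  have Wsd: "second_diff (W f) y h = M * (norm (\<pi> h))\<^sup>2 - (second_diff f y h - h \<bullet> T h)" for f y h
  proof -
    have "second_diff (W f) y h = - second_diff (quad_residual T' f) y h"
      by (simp add: second_diff_def W_def)
    also have "\<dots> = h \<bullet> T' h - second_diff f y h" by (simp add: second_diff_residual[OF T'])
    finally show ?thesis by (simp add: T'_def inner_add \<pi>x)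
  qed
  have Wpos: "second_diff (W f) y h \<ge> 0" if f: "f \<in> \<F>" for f y h
  proof -
    have "h - \<pi> h \<in> inv_dirs T f" using f S\<pi> by (auto simp: \<F>_def)
    then obtain c where c: "\<And>x t. quad_residual T f (x + t *\<^sub>R (h - \<pi> h)) - quad_residual T f x = t * c"
      by (auto simp: inv_dirs_def)
    \<comment> \<open>The component of \<open>h\<close> in \<open>S\<close> is an invariance
      direction, along which the residual is affine, so only the transversal component
      contributes.\<close>
    have "second_diff (quad_residual T f) y h = second_diff (quad_residual T f) y (\<pi> h)"
      using c[of "y + \<pi> h" 1] c[of "y - \<pi> h" "-1"] by (simp add: second_diff_def algebra_simps)
    then have eq: "second_diff f y h - h \<bullet> T h = second_diff f y (\<pi> h) - \<pi> h \<bullet> T (\<pi> h)"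
      by (simp add: second_diff_residual[OF T])
    have "second_diff f y (\<pi> h) - \<pi> h \<bullet> T (\<pi> h) \<le> M * (norm (\<pi> h))\<^sup>2"
    proof (cases "\<pi> h = 0")
      case False
      define s where "s = norm (\<pi> h)"
      define e' where "e' = inverse s *\<^sub>R \<pi> h"
      have s: "s > 0" and e': "e' \<in> D" "\<pi> h = s *\<^sub>R e'"
        using False normalized[of h] by (auto simp: s_def e'_def)
      have "v (\<lambda>z. f (y + s *\<^sub>R z) / s\<^sup>2) e' \<le> M" by (intro vM scalF f s e')
      then have "second_diff f y (s *\<^sub>R e') / s\<^sup>2 - e' \<bullet> T e' \<le> M"
        by (simp add: v_def second_diff_rescale)
      then have "second_diff f y (s *\<^sub>R e') - s\<^sup>2 * (e' \<bullet> T e') \<le> M * s\<^sup>2"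
        using s by (simp add: field_simps)
      then show ?thesis
        unfolding e'(2) by (simp add: linear_cmul[OF linT] power2_eq_square s_def[symmetric])
          (use s e'(1) in \<open>simp add: D_def mult.assoc\<close>)
    qed (simp add: linear_0[OF linT] second_diff_def)
    then show ?thesis by (simp add: Wsd eq)
  qed
  have Wcont: "continuous_on UNIV (W f)" if "f \<in> \<F>" for f
  proof -
    have "continuous_on UNIV f" using cont that by (simp add: \<F>_def)
    then show ?thesis unfolding W_def quad_residual_def T'_def
      by (intro continuous_intros contT cont\<pi>) auto
  qed
  have Wconv: "convex_on UNIV (W f)" if "f \<in> \<F>" for f
    by (rule midpoint_convex_imp_convex) (use Wcont Wpos that in auto)
  have e1: "norm e = 1" "\<pi> e = e" using eD by (auto simp: D_def)
  \<comment> \<open>Convexity bounds the second difference for a shorter step by a fraction of the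
    one for the unit step, which is zero; \<open>Wpos\<close> gives the other sign.\<close>
  have W1: "second_diff (W f1) 0 (t *\<^sub>R e) = 0" if "\<bar>t\<bar> \<le> 1" for t
  proof -
    have p: "W f1 (t *\<^sub>R e) + W f1 (- t *\<^sub>R e) \<le> 2 * W f1 0" if t: "0 \<le> t" "t \<le> 1" for t
    proof -
      have "W f1 (t *\<^sub>R e) \<le> (1 - t) * W f1 0 + t * W f1 e"
        using convex_onD[OF Wconv[OF f1], of t 0 e] t by simp
      moreover have "W f1 (- t *\<^sub>R e) \<le> (1 - t) * W f1 0 + t * W f1 (- e)"
        using convex_onD[OF Wconv[OF f1], of t 0 "-e"] t by simp
      moreover have "W f1 e + W f1 (- e) = 2 * W f1 0"
        using Wsd[of f1 0 e] f1e e1 by (simp add: v_def second_diff_def)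
      then have "t * W f1 e + t * W f1 (- e) = t * (2 * W f1 0)" by (metis distrib_left)
      ultimately show ?thesis by (simp add: left_diff_distrib)
    qed
    show ?thesis using p[of t] p[of "-t"] that Wpos[OF f1, of 0 "t *\<^sub>R e"]
      by (cases "t \<ge> 0") (auto simp: second_diff_def)
  qed
  \<comment> \<open>So far equality is known only for steps of length at most 1. Rescaling about 0
    extends it to length \<open>Suc k\<close>, and a limit has it along the whole line.\<close>
  define F where "F k z = f1 (0 + inverse (real (Suc k)) *\<^sub>R z) / (inverse (real (Suc k)))\<^sup>2" for k z
  have FF: "F k \<in> \<F>" for k unfolding F_def by (rule scalF[OF f1]) simp
  obtain f2 \<sigma> c q where f2: "f2 \<in> \<F>" "strict_mono (\<sigma>::nat\<Rightarrow>nat)"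
      "\<And>R. uniform_limit (cball 0 R) (\<lambda>k y. F (\<sigma> k) y - c k - q k \<bullet> y) f2 sequentially"
    using compF[of F, OF FF] by blast
  have lim: "(\<lambda>k. F (\<sigma> k) y - c k - q k \<bullet> y) \<longlonglongrightarrow> f2 y" for y
    by (rule tendsto_uniform_limitI[OF f2(3)[of "norm y"]]) simp
  have W2: "second_diff (W f2) 0 (t *\<^sub>R e) = 0" for t
  proof -
    have "(\<lambda>k. second_diff (W (F (\<sigma> k))) 0 (t *\<^sub>R e)) \<longlonglongrightarrow> second_diff (W f2) 0 (t *\<^sub>R e)"
      unfolding Wsd by (intro tendsto_intros second_diff_tendsto[OF lim])
    moreover have "\<forall>\<^sub>F k in sequentially. second_diff (W (F (\<sigma> k))) 0 (t *\<^sub>R e) = 0"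
    proof -
      obtain N where N: "\<bar>t\<bar> \<le> real N" using real_arch_simple by blast
      show ?thesis
        unfolding eventually_sequentially
      proof (intro exI allI impI)
        fix k assume "N \<le> k"
        then have k: "\<bar>t\<bar> \<le> real (Suc (\<sigma> k))" using N seq_suble[OF f2(2), of k] by linarith
        define s where "s = inverse (real (Suc (\<sigma> k)))"
        have s: "s > 0" "\<bar>s * t\<bar> \<le> 1" using k by (auto simp: s_def abs_mult field_simps)
        have "M * (norm (\<pi> ((s * t) *\<^sub>R e)))\<^sup>2 = second_diff f1 0 ((s * t) *\<^sub>R e) - ((s * t) *\<^sub>R e) \<bullet> T ((s * t) *\<^sub>R e)"
          using W1[OF s(2)] unfolding Wsd by simp
        then have "second_diff f1 0 ((s * t) *\<^sub>R e) = s\<^sup>2 * (t\<^sup>2 * (M + e \<bullet> T e))"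
          by (simp add: linear_cmul[OF linT] linear_cmul[OF lin\<pi>] e1 power2_eq_square algebra_simps)
        then have "second_diff (F (\<sigma> k)) 0 (t *\<^sub>R e) = t\<^sup>2 * (M + e \<bullet> T e)"
          unfolding F_def second_diff_rescale s_def[symmetric] using s by simp
        then show "second_diff (W (F (\<sigma> k))) 0 (t *\<^sub>R e) = 0"
          by (simp add: Wsd linear_cmul[OF linT] linear_cmul[OF lin\<pi>] e1 power2_eq_square algebra_simps)
      qed
    qed
    ultimately show ?thesis
      using tendsto_eventually tendsto_unique trivial_limit_sequentially by metis
  qed
  obtain c2 where c2: "\<And>x t. W f2 (x + t *\<^sub>R e) = W f2 x + t * c2"
    using convex_affine_on_line[OF Wconv[OF f2(1)] Wcont[OF f2(1)] e1(1) W2] by blast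
  have einv: "e \<in> inv_dirs T' f2"
    unfolding inv_dirs_def using c2 by (auto simp: W_def intro!: exI[of _ "-c2"] simp: algebra_simps)
  have Sinv: "S \<subseteq> inv_dirs T' f2"
  proof
    fix h assume h: "h \<in> S"
    then have "h \<in> inv_dirs T f2" using f2(1) by (auto simp: \<F>_def)
    moreover have "quad_residual T' f2 x = quad_residual T f2 x - M * (norm (\<pi> x))\<^sup>2 / 2" for x
      by (simp add: quad_residual_def T'_def inner_add \<pi>x field_simps)
    \<comment> \<open>The term by which \<open>T'\<close> differs from \<open>T\<close> sees only
      \<open>\<pi> x\<close>, which is constant along directions of \<open>S\<close>; hence these
      stay invariant for \<open>T'\<close>.\<close>
    moreover have "\<pi> (x + t *\<^sub>R h) = \<pi> x" for x t
      by (simp add: linear_add[OF lin\<pi>] linear_cmul[OF lin\<pi>] \<pi>S[OF h])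
    ultimately show "h \<in> inv_dirs T' f2" by (simp add: inv_dirs_def)
  qed
  have "e \<notin> S" using \<pi>S[of e] e1 by auto
  then have "S \<subset> inv_dirs T' f2" using einv Sinv by blast
  then have "dim S < dim (inv_dirs T' f2)"
    using dim_psubset subS subspace_inv_dirs by (metis span_eq_iff)
  then show ?thesis using f2(1) T' unfolding \<F>_def S_def by blast
qed

text \<open>Starting from the zero form, \<open>inv_dirs_extend\<close> raises the dimension of the
  invariance space until it is everything. The residual is then affine, since its increments are
  additive and homogeneous.\<close>

lemma quadratic_blowup:
  fixes \<T> :: "('a::euclidean_space \<Rightarrow> real) set"
  assumes sd: "\<And>f y h. f \<in> \<T> \<Longrightarrow> \<bar>second_diff f y h\<bar> \<le> L * (norm h)\<^sup>2"
    and cont: "\<And>f. f \<in> \<T> \<Longrightarrow> continuous_on UNIV f"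
    and scal: "\<And>f y s. f \<in> \<T> \<Longrightarrow> s > 0 \<Longrightarrow> (\<lambda>z. f (y + s *\<^sub>R z) / s\<^sup>2) \<in> \<T>"
    and comp: "\<And>F. (\<And>k. F k \<in> \<T>) \<Longrightarrow> \<exists>f\<in>\<T>. \<exists>\<sigma> c q. strict_mono (\<sigma>::nat\<Rightarrow>nat) \<and>
       (\<forall>R. uniform_limit (cball 0 R) (\<lambda>k y. F (\<sigma> k) y - c k - q k \<bullet> y) f sequentially)"
    and ne: "\<T> \<noteq> {}"
  shows "\<exists>f\<in>\<T>. \<exists>T c q. self_adjoint T \<and> (\<forall>x. f x = c + q \<bullet> x + (x \<bullet> T x) / 2)"
proof -
  have step: "\<exists>f\<in>\<T>. \<exists>T. self_adjoint T \<and> inv_dirs T f = UNIV"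
    if "f \<in> \<T>" "self_adjoint T" "n = DIM('a) - dim (inv_dirs T f)" for f T n
    using that
  proof (induction n arbitrary: f T rule: less_induct)
    case (less n)
    show ?case
    proof (cases "inv_dirs T f = UNIV")
      case False
      from inv_dirs_extend[OF sd cont scal comp less.prems(1,2) False]
      obtain f' T' where f': "f' \<in> \<T>" "self_adjoint T'" "dim (inv_dirs T f) < dim (inv_dirs T' f')"
        by blast
      have "dim (inv_dirs T' f') \<le> DIM('a)" by (rule dim_subset_UNIV)
      then show ?thesis using less.IH[OF _ f'(1,2) refl] f'(3) less.prems(3) by linarith
    qed (use less.prems in blast)
  qed
  obtain f0 where "f0 \<in> \<T>" using ne by blast
  moreover have "self_adjoint (\<lambda>x::'a. 0)" by (simp add: self_adjoint_def linear_zero)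
  ultimately obtain f T where f: "f \<in> \<T>" and T: "self_adjoint T" and inv: "inv_dirs T f = UNIV"
    using step by blast
  define g where "g = quad_residual T f"
  have g: "g (x + t *\<^sub>R h) = g x + t * (g h - g 0)" for x t h
    using inv inv_dirs_iff[of h T f] unfolding g_def by (metis UNIV_I add.commute diff_add_cancel)
  have lin: "linear (\<lambda>h. g h - g 0)"
  proof (rule linearI)
    show "g (x + y) - g 0 = (g x - g 0) + (g y - g 0)" for x y using g[of x 1 y] by simp
    show "g (r *\<^sub>R x) - g 0 = r *\<^sub>R (g x - g 0)" for r x using g[of 0 r x] by simp
  qed
  define q where "q = (\<Sum>b\<in>Basis. (g b - g 0) *\<^sub>R b)"
  have "g x - g 0 = q \<bullet> x" for x
  proof -
    have "g x - g 0 = (\<lambda>h. g h - g 0) (\<Sum>b\<in>Basis. (x \<bullet> b) *\<^sub>R b)" by (simp add: euclidean_representation)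
    also have "\<dots> = (\<Sum>b\<in>Basis. (x \<bullet> b) * (g b - g 0))"
      using linear_sum[OF lin, of "\<lambda>b. (x \<bullet> b) *\<^sub>R b" Basis] linear_cmul[OF lin] by simp
    also have "\<dots> = q \<bullet> x" by (simp add: q_def inner_sum_left mult.commute inner_commute[of x])
    finally show ?thesis .
  qed
  then have "f x = g 0 + q \<bullet> x + (x \<bullet> T x) / 2" for x
    by (metis add.commute diff_add_cancel g_def quad_residual_def)
  then show ?thesis using f T by blast
qed

section \<open>Blow-ups at contact points\<close>

text \<open>An Arzela-Ascoli argument. Adding \<open>L / 2\<close> times the squared norm makes the
  functions convex, so the bounds yield Lipschitz constants independent of \<open>k\<close> on every
  ball once \<open>k\<close> is large; a diagonal subsequence converges on a countable dense set and
  hence locally uniformly.\<close>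

lemma semiconvex_seq_compact:
  fixes G :: "nat \<Rightarrow> 'a::euclidean_space \<Rightarrow> real"
  assumes L: "L \<ge> 0" and cont: "\<And>k. continuous_on UNIV (G k)"
    and semi: "\<And>k y h. second_diff (G k) y h \<ge> - L * (norm h)\<^sup>2"
    and bound: "\<And>k y. norm y \<le> real k \<Longrightarrow> \<bar>G k y\<bar> \<le> L * (norm y)\<^sup>2"
  obtains \<sigma> g where "strict_mono (\<sigma>::nat\<Rightarrow>nat)"
    "\<And>R. uniform_limit (cball 0 R) (\<lambda>k. G (\<sigma> k)) g sequentially"
proof -
  \<comment> \<open>Of the constant 13, the convex function \<open>P\<close> contributes 12: on the
    doubled ball it is bounded by \<open>L * (2 * R)\<^sup>2 + L / 2 * (2 * R)\<^sup>2 = 6 * L *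
    R\<^sup>2\<close>. The subtracted quadratic contributes 1.\<close>
  have Lip: "\<bar>G k x - G k y\<bar> \<le> (13 * L * R) * norm (x - y)"
    if R: "R > 0" "2 * R \<le> real k" "norm x \<le> R" "norm y \<le> R" for R k x y
  proof -
    define P where "P x = G k x + L / 2 * (norm x)\<^sup>2" for x
    have sdP: "second_diff P y h \<ge> 0" for y h
      using semi[of h k y] unfolding P_def second_diff_add second_diff_norm_sq by simp
    have "continuous_on UNIV P" unfolding P_def by (intro continuous_intros cont)
    then have "convex_on UNIV P" using sdP by (rule midpoint_convex_imp_convex)
    moreover have "\<bar>P x\<bar> \<le> 6 * L * R\<^sup>2" if "norm x \<le> 2 * R" for x
    proof -
      have "(norm x)\<^sup>2 \<le> (2 * R)\<^sup>2" using that by (intro power_mono) auto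
      then have le: "L * (norm x)\<^sup>2 \<le> L * (2 * R)\<^sup>2" using L by (intro mult_left_mono)
      have "\<bar>P x\<bar> \<le> \<bar>G k x\<bar> + L / 2 * (norm x)\<^sup>2" using L abs_triangle_ineq[of "G k x" "L / 2 * (norm x)\<^sup>2"]
        by (simp add: P_def abs_mult)
      also have "\<dots> \<le> L * (norm x)\<^sup>2 + L / 2 * (norm x)\<^sup>2" using bound[of x k] that R by simp
      also have "\<dots> \<le> 6 * L * R\<^sup>2" using le by (simp add: power2_eq_square)
      finally show ?thesis .
    qed
    ultimately have "\<bar>P x - P y\<bar> \<le> 2 * (6 * L * R\<^sup>2) / R * norm (x - y)"
      using convex_bounded_Lipschitz[of P R "6 * L * R\<^sup>2" x y] R by blast
    then have 1: "\<bar>P x - P y\<bar> \<le> 12 * L * R * norm (x - y)" using R by (simp add: power2_eq_square)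
    have "\<bar>(norm x)\<^sup>2 - (norm y)\<^sup>2\<bar> = \<bar>norm x - norm y\<bar> * \<bar>norm x + norm y\<bar>"
      unfolding abs_mult[symmetric] by (simp add: power2_eq_square algebra_simps)
    also have "\<dots> \<le> norm (x - y) * (2 * R)"
      using R norm_triangle_ineq3[of x y] by (intro mult_mono) auto
    finally have *: "L / 2 * \<bar>(norm x)\<^sup>2 - (norm y)\<^sup>2\<bar> \<le> L / 2 * (norm (x - y) * (2 * R))"
      using L by (intro mult_left_mono) auto
    then have 2: "\<bar>L / 2 * (norm x)\<^sup>2 - L / 2 * (norm y)\<^sup>2\<bar> \<le> L * R * norm (x - y)"
    proof -
      have "\<bar>L / 2 * (norm x)\<^sup>2 - L / 2 * (norm y)\<^sup>2\<bar> = L / 2 * \<bar>(norm x)\<^sup>2 - (norm y)\<^sup>2\<bar>"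
        using L by (simp only: right_diff_distrib[symmetric] abs_mult)
      also note *
      finally show ?thesis by (simp add: mult_ac)
    qed
    have "\<bar>G k x - G k y\<bar> = \<bar>(P x - P y) - (L / 2 * (norm x)\<^sup>2 - L / 2 * (norm y)\<^sup>2)\<bar>"
      by (simp add: P_def)
    also have "\<dots> \<le> 12 * L * R * norm (x - y) + L * R * norm (x - y)"
      by (rule order_trans[OF abs_triangle_ineq4 add_mono[OF 1 2]])
    also have "\<dots> = (13 * L * R) * norm (x - y)" by simp
    finally show ?thesis .
  qed
  obtain D :: "'a set" where D: "countable D" "UNIV \<subseteq> closure D"
    by (rule separable[of "UNIV :: 'a set"])
  \<comment> \<open>Normalised to be bounded by 1 at every point, with default 0 where
    \<open>k\<close> is too small for the hypothesis to give a bound; for fixed \<open>y\<close>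
    this affects finitely many \<open>k\<close>.\<close>
  define F where "F k y = (if norm y \<le> real k then G k y / (L * (norm y)\<^sup>2 + 1) else 0)" for k y
  have "norm (F k y) \<le> 1" for k y
  proof (cases "norm y \<le> real k")
    case True
    have pos: "L * (norm y)\<^sup>2 + 1 > 0" using L by (smt (verit) mult_nonneg_nonneg zero_le_power2)
    then have "\<bar>G k y / (L * (norm y)\<^sup>2 + 1)\<bar> = \<bar>G k y\<bar> / (L * (norm y)\<^sup>2 + 1)" by (simp add: abs_divide)
    also have "\<dots> \<le> 1" using bound[OF True] pos by simp
    finally show ?thesis using True by (simp add: F_def)
  qed (simp add: F_def)
  then obtain \<sigma> where \<sigma>: "strict_mono (\<sigma>::nat\<Rightarrow>nat)" and
    \<sigma>F: "\<And>x. x \<in> D \<Longrightarrow> \<exists>l. (\<lambda>n. F (\<sigma> n) x) \<longlonglongrightarrow> l"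
    using function_convergent_subsequence[OF D(1), of F 1] by metis
  have big: "\<exists>N. \<forall>n\<ge>N. r \<le> real (\<sigma> n)" for r
  proof -
    obtain N where "r \<le> real N" using real_arch_simple by blast
    then have "\<forall>n\<ge>N. r \<le> real (\<sigma> n)" using seq_suble[OF \<sigma>]
      by (meson of_nat_mono order_trans)
    then show ?thesis by blast
  qed
  have DC: "Cauchy (\<lambda>n. G (\<sigma> n) x)" if xD: "x \<in> D" for x
  proof -
    obtain l where l: "(\<lambda>n. F (\<sigma> n) x) \<longlonglongrightarrow> l" using \<sigma>F[OF xD] by blast
    have pos: "L * (norm x)\<^sup>2 + 1 \<noteq> 0" using L by (smt (verit) mult_nonneg_nonneg zero_le_power2)
    obtain N where N: "\<forall>n\<ge>N. norm x \<le> real (\<sigma> n)" using big by blast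
    have "(\<lambda>n. F (\<sigma> n) x * (L * (norm x)\<^sup>2 + 1)) \<longlonglongrightarrow> l * (L * (norm x)\<^sup>2 + 1)"
      by (intro tendsto_intros l)
    moreover have "\<forall>\<^sub>F n in sequentially. F (\<sigma> n) x * (L * (norm x)\<^sup>2 + 1) = G (\<sigma> n) x"
      unfolding eventually_sequentially using N pos by (auto simp: F_def)
    ultimately have "(\<lambda>n. G (\<sigma> n) x) \<longlonglongrightarrow> l * (L * (norm x)\<^sup>2 + 1)"
      by (rule Lim_transform_eventually)
    then show ?thesis by (rule LIMSEQ_imp_Cauchy)
  qed
  have UC: "uniformly_Cauchy_on (cball 0 R) (\<lambda>k. G (\<sigma> k))" for R
    unfolding uniformly_Cauchy_on_def
  proof (intro allI impI)
    fix e :: real assume e: "e > 0"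
    define R' where "R' = \<bar>R\<bar> + 1"
    define C where "C = 13 * L * R'"
    \<comment> \<open>This gives \<open>C * d < e / 3\<close>, the \<open>+ 3\<close> covering
      \<open>C = 0\<close>, and \<open>d \<le> 1\<close> keeps the relevant centres of the cover
      within radius \<open>R'\<close>.\<close>
    define d where "d = min 1 (e / (3 * C + 3))"
    have R': "R' > 0" "R \<le> R' - 1" and C: "C \<ge> 0" using L by (auto simp: R'_def C_def)
    have d: "0 < d" "d \<le> 1" using e C by (auto simp: d_def)
    have Cd: "C * d < e / 3"
    proof -
      have "C * d \<le> C * (e / (3 * C + 3))" using C by (intro mult_left_mono) (auto simp: d_def)
      also have "\<dots> < e / 3" using C e by (simp add: field_simps)
      finally show ?thesis .
    qed
    have cover: "cball 0 R \<subseteq> (\<Union>c\<in>D. ball c d)"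
    proof
      fix x :: 'a
      have "x \<in> closure D" using D by blast
      then show "x \<in> (\<Union>c\<in>D. ball c d)"
        using d(1) by (auto simp: closure_approachable)
    qed
    obtain S where S: "S \<subseteq> D" "finite S" "cball 0 R \<subseteq> (\<Union>c\<in>S. ball c d)"
      using compactE_image[OF compact_cball[of 0 R], of D "\<lambda>c. ball c d"] cover by auto
    have "\<exists>N. \<forall>m\<ge>N. \<forall>n\<ge>N. dist (G (\<sigma> m) c) (G (\<sigma> n) c) < e / 3" if "c \<in> S" for c
      using DC[of c] that S(1) half_gt_zero[of "2 * (e / 3)"] e unfolding Cauchy_def by (meson divide_pos_pos subsetD zero_less_numeral)
    then obtain N where N: "\<And>c m n. c \<in> S \<Longrightarrow> N c \<le> m \<Longrightarrow> N c \<le> n \<Longrightarrow> dist (G (\<sigma> m) c) (G (\<sigma> n) c) < e / 3"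
      by metis
    obtain N0 where N0: "\<forall>n\<ge>N0. 2 * R' \<le> real (\<sigma> n)" using big by blast
    define N1 where "N1 = N0 + Max (insert 0 (N ` S))"
    have N1: "N0 \<le> N1" "\<And>c. c \<in> S \<Longrightarrow> N c \<le> N1"
      using S(2) by (auto simp: N1_def intro!: trans_le_add2)
    show "\<exists>M. \<forall>x\<in>cball 0 R. \<forall>m\<ge>M. \<forall>n\<ge>M. dist (G (\<sigma> m) x) (G (\<sigma> n) x) < e"
    proof (intro exI ballI allI impI)
      fix x :: 'a and m n assume x: "x \<in> cball 0 R" and mn: "N1 \<le> m" "N1 \<le> n"
      obtain c where c: "c \<in> S" "dist c x < d" using S(3) x by auto
      have nx: "norm x \<le> R'" using x R' by simp
      have nc: "norm c \<le> R'" using c(2) x d(2) R'(2) norm_triangle_ineq2[of c x] by (simp add: dist_norm)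
      have LL: "\<bar>G (\<sigma> j) x - G (\<sigma> j) c\<bar> < e / 3" if "N1 \<le> j" for j
      proof -
        have "2 * R' \<le> real (\<sigma> j)" using N0 N1 that by auto
        then have "\<bar>G (\<sigma> j) x - G (\<sigma> j) c\<bar> \<le> C * norm (x - c)"
          using Lip[OF R'(1) _ nx nc] by (simp add: C_def)
        also have "\<dots> \<le> C * d" using c(2) C by (intro mult_left_mono) (auto simp: dist_norm norm_minus_commute)
        finally show ?thesis using Cd by linarith
      qed
      have "\<bar>G (\<sigma> m) c - G (\<sigma> n) c\<bar> < e / 3"
        using N[OF c(1), of m n] N1(2)[OF c(1)] mn by (simp add: dist_real_def)
      with LL[OF mn(1)] LL[OF mn(2)] show "dist (G (\<sigma> m) x) (G (\<sigma> n) x) < e"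
        unfolding dist_real_def by linarith
    qed
  qed
  have "uniform_limit (cball 0 R) (\<lambda>k. G (\<sigma> k)) (\<lambda>x. lim (\<lambda>k. G (\<sigma> k) x)) sequentially" for R
    using Cauchy_uniformly_convergent[OF UC] by (simp add: uniformly_convergent_uniform_limit_iff)
  with \<sigma> that show ?thesis by blast
qed

text \<open>This is what the contact set of a sup-convolution offers: semiconvexity everywhere, but
  two-sided quadratic control only at points of \<open>K\<close>. The last assumption, a failure of
  porosity at some points and scales, is what lets blow-up limits inherit that control at every
  point.\<close>

locale second_order_contact =
  fixes U :: "'a::euclidean_space \<Rightarrow> real" and K :: "'a set" and L \<tau> :: real
  assumes L0: "L \<ge> 0" and \<tau>0: "\<tau> > 0" and contU: "continuous_on UNIV U"
    and semi: "\<And>y h. second_diff U y h \<ge> - L * (norm h)\<^sup>2"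
    and jet: "\<And>x. x \<in> K \<Longrightarrow> \<exists>q. \<forall>h. norm h < \<tau> \<longrightarrow> \<bar>U (x + h) - U x - q \<bullet> h\<bar> \<le> L * (norm h)\<^sup>2"
    and nonporous: "\<And>\<eta>. \<eta> > 0 \<Longrightarrow>
        \<exists>x\<in>K. \<exists>r. 0 < r \<and> r < \<eta> \<and> (\<forall>y\<in>cball x r. \<exists>z\<in>K. dist y z \<le> \<eta> * r)"
begin

text \<open>The square makes the true radius \<open>r * Suc N\<close> of the window smaller than
  \<open>1 / Suc N\<close>, so for large \<open>N\<close> the window fits into the radius
  \<open>\<tau>\<close> of the jets.\<close>

definition good :: "nat \<Rightarrow> 'a \<Rightarrow> real \<Rightarrow> bool" where
  "good N x r \<longleftrightarrow> x \<in> K \<and> 0 < r \<and> r * (real (Suc N))\<^sup>2 < 1 \<and>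
     (\<forall>y\<in>cball 0 (real (Suc N)). \<exists>z\<in>K. dist (x + r *\<^sub>R y) z \<le> r / real (Suc N))"

definition blowup :: "'a \<Rightarrow> real \<Rightarrow> real \<Rightarrow> 'a \<Rightarrow> 'a \<Rightarrow> real" where
  "blowup x r c q y = U (x + r *\<^sub>R y) / r\<^sup>2 - c - q \<bullet> y"

text \<open>The coefficients \<open>c\<close> and \<open>q\<close> are free because only
  second-order behaviour matters. Asking for an approximation at each \<open>N\<close>, instead of
  one convergent sequence, keeps the diagonal arguments short.\<close>

definition limits :: "('a \<Rightarrow> real) set" where
  "limits = {f. \<forall>N. \<exists>x r c q. good N x r \<and>
     (\<forall>y\<in>cball 0 (real (Suc N)). \<bar>blowup x r c q y - f y\<bar> \<le> 1 / real (Suc N))}"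

lemma good_mono: "good N x r \<Longrightarrow> N' \<le> N \<Longrightarrow> good N' x r"
proof -
  assume g: "good N x r" and N: "N' \<le> N"
  have r: "0 < r" using g by (simp add: good_def)
  have "(real (Suc N'))\<^sup>2 \<le> (real (Suc N))\<^sup>2" using N by (intro power_mono) auto
  then have "r * (real (Suc N'))\<^sup>2 \<le> r * (real (Suc N))\<^sup>2" using r by (intro mult_left_mono) auto
  moreover have "r / real (Suc N) \<le> r / real (Suc N')" using N r by (intro divide_left_mono) auto
  moreover have "cball 0 (real (Suc N')) \<subseteq> (cball 0 (real (Suc N)) :: 'a set)" using N by auto
  ultimately show ?thesis using g unfolding good_def by (meson order_trans le_less_trans subsetD)
qed

text \<open>A ball of radius \<open>r\<close> filled by \<open>K\<close> up to
  \<open>r / M\<^sup>2\<close>, measured in the unit \<open>r / M\<close>, is a window of radius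
  \<open>M\<close> filled up to \<open>1 / M\<close>.\<close>

lemma good_exists: "\<exists>x r. good N x r"
proof -
  define M where "M = real (Suc N)"
  have M: "M \<ge> 1" by (simp add: M_def)
  obtain x r where xr: "x \<in> K" "0 < r" "r < 1 / M\<^sup>2" "\<And>y. y \<in> cball x r \<Longrightarrow> \<exists>z\<in>K. dist y z \<le> 1 / M\<^sup>2 * r"
    using nonporous[of "1 / M\<^sup>2"] M by auto
  have "r / M * M\<^sup>2 < 1"
  proof -
    have "r / M * M\<^sup>2 = r * M" using M by (simp add: power2_eq_square)
    also have "\<dots> < 1 / M\<^sup>2 * M" using xr M by (intro mult_strict_right_mono) auto
    also have "\<dots> \<le> 1" using M by (simp add: power2_eq_square)
    finally show ?thesis .
  qed
  moreover have "\<exists>z\<in>K. dist (x + (r / M) *\<^sub>R y) z \<le> (r / M) / M" if "y \<in> cball 0 M" for y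
  proof -
    have "x + (r / M) *\<^sub>R y \<in> cball x r"
      using that M xr(2) by (simp add: dist_norm field_simps)
    from xr(4)[OF this] show ?thesis by (simp add: power2_eq_square)
  qed
  ultimately have "good N x (r / M)" unfolding good_def M_def[symmetric] using xr M by auto
  then show ?thesis by blast
qed

lemma good_r: "good N x r \<Longrightarrow> r * real (Suc N) < 1 / real (Suc N)"
  by (simp add: good_def power2_eq_square field_simps)

lemma cont_blowup: "continuous_on UNIV (blowup x r c q)"
  unfolding blowup_def divide_inverse
  by (intro continuous_intros continuous_on_compose2[OF contU]) auto

lemma second_diff_blowup:
  "second_diff (blowup x r c q) y h = second_diff U (x + r *\<^sub>R y) (r *\<^sub>R h) / r\<^sup>2"
  by (simp add: second_diff_def blowup_def algebra_simps diff_divide_distrib add_divide_distrib)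

lemma second_diff_blowup_ge:
  assumes "r > 0" shows "second_diff (blowup x r c q) y h \<ge> - L * (norm h)\<^sup>2"
  using semi[of "r *\<^sub>R h" "x + r *\<^sub>R y"] assms
  by (simp add: second_diff_blowup field_simps)

text \<open>With \<open>c\<close> and \<open>q\<close> taken from the jet at the centre, the
  two-sided bound at the contact point is invariant under the quadratic rescaling, and so gives a
  bound independent of \<open>k\<close>.\<close>

lemma blowup_compact:
  assumes good: "\<And>k. good k (X k) (r k)"
  obtains \<sigma> g c q where "strict_mono (\<sigma>::nat\<Rightarrow>nat)" "g \<in> limits"
    "\<And>R. uniform_limit (cball 0 R) (\<lambda>k. blowup (X (\<sigma> k)) (r (\<sigma> k)) (c k) (q k)) g sequentially"
proof -
  have r0: "r k > 0" and XK: "X k \<in> K" for k using good by (auto simp: good_def)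
  obtain k0 where k0: "1 / real (Suc k0) < \<tau>" using \<tau>0 nat_approx_posE by blast
  obtain p where p: "\<And>k h. norm h < \<tau> \<Longrightarrow> \<bar>U (X k + h) - U (X k) - p k \<bullet> h\<bar> \<le> L * (norm h)\<^sup>2"
    using jet[OF XK] by metis
  define c where "c k = U (X k) / (r k)\<^sup>2" for k
  define q where "q k = (1 / r k) *\<^sub>R p k" for k
  \<comment> \<open>The shift by \<open>k0\<close> discards the windows that may exceed the radius
    \<open>\<tau>\<close>.\<close>
  define G where "G k = blowup (X (k + k0)) (r (k + k0)) (c (k + k0)) (q (k + k0))" for k
  have bnd: "\<bar>G k y\<bar> \<le> L * (norm y)\<^sup>2" if y: "norm y \<le> real k" for k y
  proof -
    define j where "j = k + k0"
    have "norm (r j *\<^sub>R y) \<le> r j * real (Suc j)" using y r0[of j] by (simp add: j_def)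
    also have "\<dots> < 1 / real (Suc j)" by (rule good_r[OF good])
    also have "\<dots> \<le> 1 / real (Suc k0)" by (simp add: j_def field_simps)
    finally have "norm (r j *\<^sub>R y) < \<tau>" using k0 by linarith
    from p[OF this, of j] have "\<bar>U (X j + r j *\<^sub>R y) - U (X j) - r j * (p j \<bullet> y)\<bar> \<le> L * (norm y)\<^sup>2 * (r j)\<^sup>2"
      by (simp add: power_mult_distrib mult_ac)
    then have "\<bar>U (X j + r j *\<^sub>R y) - U (X j) - r j * (p j \<bullet> y)\<bar> / (r j)\<^sup>2 \<le> L * (norm y)\<^sup>2"
      using r0[of j] by (simp add: divide_le_eq)
    moreover have "G k y = (U (X j + r j *\<^sub>R y) - U (X j) - r j * (p j \<bullet> y)) / (r j)\<^sup>2"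
      using r0[of j] unfolding G_def blowup_def c_def q_def j_def[symmetric]
      by (simp add: diff_divide_distrib power2_eq_square)
    ultimately show ?thesis by (simp add: abs_divide)
  qed
  have contG: "continuous_on UNIV (G k)" for k unfolding G_def by (rule cont_blowup)
  have sdG: "second_diff (G k) y h \<ge> - L * (norm h)\<^sup>2" for k y h
    unfolding G_def by (rule second_diff_blowup_ge[OF r0])
  obtain \<sigma> g where \<sigma>: "strict_mono \<sigma>" and
    lim: "\<And>R. uniform_limit (cball 0 R) (\<lambda>k. G (\<sigma> k)) g sequentially"
    by (rule semiconvex_seq_compact[of L G, OF L0 contG sdG bnd]) (auto intro: that)
  have "g \<in> limits"
    unfolding limits_def mem_Collect_eq
  proof
    fix N
    have "1 / real (Suc N) > 0" by simp
    from uniform_limitD[OF lim this, of "real (Suc N)"] obtain k where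
      k: "\<And>y. y \<in> cball 0 (real (Suc N)) \<Longrightarrow> dist (G (\<sigma> k) y) (g y) < 1 / real (Suc N)" and kN: "k \<ge> N"
      unfolding eventually_sequentially by (metis linorder_linear)
    have "N \<le> \<sigma> k + k0" using kN seq_suble[OF \<sigma>, of k] by linarith
    then have "good N (X (\<sigma> k + k0)) (r (\<sigma> k + k0))" by (rule good_mono[OF good])
    then show "\<exists>x r c q. good N x r \<and> (\<forall>y\<in>cball 0 (real (Suc N)). \<bar>blowup x r c q y - g y\<bar> \<le> 1 / real (Suc N))"
      using k unfolding G_def dist_real_def by (meson less_imp_le)
  qed
  moreover have "strict_mono (\<lambda>k. \<sigma> k + k0)" using \<sigma> by (simp add: strict_mono_def)
  ultimately show ?thesis using lim unfolding G_def by (intro that[of "\<lambda>k. \<sigma> k + k0"]) auto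
qed

lemma limits_seq:
  assumes "f \<in> limits"
  obtains X r c q where "\<And>k. good k (X k) (r k)"
    "\<And>k y. norm y \<le> real (Suc k) \<Longrightarrow> \<bar>blowup (X k) (r k) (c k) (q k) y - f y\<bar> \<le> 1 / real (Suc k)"
    "\<And>R. uniform_limit (cball 0 R) (\<lambda>k. blowup (X k) (r k) (c k) (q k)) f sequentially"
    "continuous_on UNIV f"
proof -
  obtain X r c q where g: "\<And>k. good k (X k) (r k)" and
    b: "\<And>k y. norm y \<le> real (Suc k) \<Longrightarrow> \<bar>blowup (X k) (r k) (c k) (q k) y - f y\<bar> \<le> 1 / real (Suc k)"
  proof -
    have "\<forall>k. \<exists>x r c q. good k x r \<and> (\<forall>y\<in>cball 0 (real (Suc k)). \<bar>blowup x r c q y - f y\<bar> \<le> 1 / real (Suc k))"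
      using assms unfolding limits_def by blast
    from this[THEN choice] obtain X where "\<forall>k. \<exists>r c q. good k (X k) r \<and> (\<forall>y\<in>cball 0 (real (Suc k)). \<bar>blowup (X k) r c q y - f y\<bar> \<le> 1 / real (Suc k))" ..
    from this[THEN choice] obtain r where "\<forall>k. \<exists>c q. good k (X k) (r k) \<and> (\<forall>y\<in>cball 0 (real (Suc k)). \<bar>blowup (X k) (r k) c q y - f y\<bar> \<le> 1 / real (Suc k))" ..
    from this[THEN choice] obtain c where "\<forall>k. \<exists>q. good k (X k) (r k) \<and> (\<forall>y\<in>cball 0 (real (Suc k)). \<bar>blowup (X k) (r k) (c k) q y - f y\<bar> \<le> 1 / real (Suc k))" ..
    from this[THEN choice] obtain q where "\<forall>k. good k (X k) (r k) \<and> (\<forall>y\<in>cball 0 (real (Suc k)). \<bar>blowup (X k) (r k) (c k) (q k) y - f y\<bar> \<le> 1 / real (Suc k))" ..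
    then show ?thesis by (intro that[of X r c q]) auto
  qed
  have u: "uniform_limit (cball 0 R) (\<lambda>k. blowup (X k) (r k) (c k) (q k)) f sequentially" for R
  proof (rule uniform_limitI)
    fix e :: real assume "e > 0"
    then obtain N1 where N1: "1 / real (Suc N1) < e" using nat_approx_posE by blast
    obtain N2 where N2: "R \<le> real N2" using real_arch_simple by blast
    show "\<forall>\<^sub>F k in sequentially. \<forall>y\<in>cball 0 R. dist (blowup (X k) (r k) (c k) (q k) y) (f y) < e"
      unfolding eventually_sequentially
    proof (intro exI allI impI ballI)
      fix k and y :: 'a assume k: "N1 + N2 \<le> k" and y: "y \<in> cball 0 R"
      have "norm y \<le> real (Suc k)" using y N2 k by simp
      from b[OF this] have "dist (blowup (X k) (r k) (c k) (q k) y) (f y) \<le> 1 / real (Suc k)"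
        by (simp add: dist_real_def)
      also have "\<dots> \<le> 1 / real (Suc N1)" using k by (simp add: field_simps)
      finally show "dist (blowup (X k) (r k) (c k) (q k) y) (f y) < e" using N1 by linarith
    qed
  qed
  have "continuous_on (ball 0 (real n)) f" for n :: nat
    by (rule continuous_on_subset[OF uniform_limit_theorem[OF _ u[of "real n"]]])
      (auto intro!: always_eventually continuous_on_subset[OF cont_blowup])
  then have "continuous_on (\<Union>n::nat. ball 0 (real n)) f" by (intro continuous_on_open_UN) auto
  moreover have "(\<Union>n::nat. ball 0 (real n)) = (UNIV :: 'a set)"
    using reals_Archimedean2 by auto
  ultimately have "continuous_on UNIV f" by simp
  with g b u that show ?thesis by blast
qed

lemma nearby_contact:
  assumes good: "good k x r" and y: "norm y \<le> real (Suc k)"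
  obtains y' where "x + r *\<^sub>R y' \<in> K" "norm (y' - y) \<le> 1 / real (Suc k)"
proof -
  obtain z where z: "z \<in> K" "dist (x + r *\<^sub>R y) z \<le> r / real (Suc k)"
    using good y unfolding good_def by (metis mem_cball_0)
  have r: "r > 0" using good by (simp add: good_def)
  define y' where "y' = (1 / r) *\<^sub>R (z - x)"
  have zz: "x + r *\<^sub>R y' = z" using r by (simp add: y'_def)
  have "x + r *\<^sub>R y - z = r *\<^sub>R (y - y')" using zz[symmetric] by (simp add: algebra_simps)
  then have "dist (x + r *\<^sub>R y) z = r * norm (y' - y)"
    using r by (simp add: dist_norm norm_minus_commute)
  then have "r * norm (y' - y) \<le> r * (1 / real (Suc k))" using z(2) by simp
  then have "norm (y' - y) \<le> 1 / real (Suc k)" using r mult_le_cancel_left_pos by blast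
  moreover have "x + r *\<^sub>R y' \<in> K" using zz z(1) by simp
  ultimately show ?thesis using that by blast
qed

lemma second_diff_contact:
  assumes "x \<in> K" "norm h < \<tau>" shows "second_diff U x h \<le> 2 * L * (norm h)\<^sup>2"
proof -
  obtain q where q: "\<And>h. norm h < \<tau> \<Longrightarrow> \<bar>U (x + h) - U x - q \<bullet> h\<bar> \<le> L * (norm h)\<^sup>2"
    using jet[OF assms(1)] by blast
  from q[of h] q[of "-h"] assms(2) show ?thesis by (simp add: second_diff_def)
qed

text \<open>In blown-up coordinates contact points become dense, so every point \<open>y\<close> is
  a limit of rescaled contact points \<open>Y k\<close>. The upper bound, available only at contact
  points before the limit, therefore holds everywhere afterwards; the lower bound is
  semiconvexity.\<close>

lemma second_diff_limits:
  assumes f: "f \<in> limits" shows "\<bar>second_diff f y h\<bar> \<le> 2 * L * (norm h)\<^sup>2"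
proof -
  obtain X r c q where g: "\<And>k. good k (X k) (r k)" and
    u: "\<And>R. uniform_limit (cball 0 R) (\<lambda>k. blowup (X k) (r k) (c k) (q k)) f sequentially" and
    cf: "continuous_on UNIV f"
    by (rule limits_seq[OF f]) (rule that)
  define A where "A k = blowup (X k) (r k) (c k) (q k)" for k
  have r0: "r k > 0" for k using g by (auto simp: good_def)
  have "\<exists>y'. norm y \<le> real (Suc k) \<longrightarrow> X k + r k *\<^sub>R y' \<in> K \<and> norm (y' - y) \<le> 1 / real (Suc k)" for k
    using nearby_contact[OF g[of k], of y] by metis
  then obtain Y where Y: "\<And>k. norm y \<le> real (Suc k) \<Longrightarrow> X k + r k *\<^sub>R Y k \<in> K"
    "\<And>k. norm y \<le> real (Suc k) \<Longrightarrow> norm (Y k - y) \<le> 1 / real (Suc k)" by metis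
  obtain N where N: "norm y \<le> real N" using real_arch_simple by blast
  have Ylim: "Y \<longlonglongrightarrow> y"
  proof -
    have "(\<lambda>k. Y k - y) \<longlonglongrightarrow> 0"
    proof (rule Lim_null_comparison)
      show "\<forall>\<^sub>F k in sequentially. norm (Y k - y) \<le> 1 / real (Suc k)"
        unfolding eventually_sequentially using Y(2) N by (intro exI[of _ N]) auto
      show "(\<lambda>k. 1 / real (Suc k)) \<longlonglongrightarrow> 0"
        using LIMSEQ_inverse_real_of_nat by (simp add: inverse_eq_divide)
    qed
    then show ?thesis by (simp add: LIM_zero_iff)
  qed
  have lim: "(\<lambda>k. second_diff (A k) (Y k) h) \<longlonglongrightarrow> second_diff f y h"
    unfolding second_diff_def
    by (intro tendsto_intros tendsto_compose_loc_uniform[OF u[folded A_def] cf] Ylim)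
  have lo: "- L * (norm h)\<^sup>2 \<le> second_diff f y h"
    using LIMSEQ_le_const[OF lim] second_diff_blowup_ge[OF r0] unfolding A_def by blast
  obtain k0 where k0: "1 / real (Suc k0) < \<tau>" using \<tau>0 nat_approx_posE by blast
  obtain N' where N': "norm h \<le> real N'" using real_arch_simple by blast
  have hi: "second_diff f y h \<le> 2 * L * (norm h)\<^sup>2"
  proof (rule LIMSEQ_le_const2[OF lim], intro exI allI impI)
    fix k assume k: "N + N' + k0 \<le> k"
    have "norm (r k *\<^sub>R h) \<le> r k * real (Suc k)" using N' k r0[of k] by simp
    also have "\<dots> < 1 / real (Suc k)" by (rule good_r[OF g])
    also have "\<dots> \<le> 1 / real (Suc k0)" using k by (simp add: field_simps)
    finally have "norm (r k *\<^sub>R h) < \<tau>" using k0 by linarith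
    moreover have "X k + r k *\<^sub>R Y k \<in> K" using Y(1)[of k] N k by simp
    ultimately have "second_diff U (X k + r k *\<^sub>R Y k) (r k *\<^sub>R h) \<le> 2 * L * (norm (r k *\<^sub>R h))\<^sup>2"
      by (intro second_diff_contact)
    then show "second_diff (A k) (Y k) h \<le> 2 * L * (norm h)\<^sup>2"
      unfolding A_def second_diff_blowup using r0[of k] by (simp add: field_simps)
  qed
  have "0 \<le> L * (norm h)\<^sup>2" using L0 by simp
  then show ?thesis using lo hi by (simp add: abs_le_iff)
qed

text \<open>A blow-up of a blow-up is a blow-up of \<open>U\<close>, except that its centre
  \<open>x + \<rho> y\<close> need not lie in \<open>K\<close>. It is moved to a nearby contact
  point, and the uniform continuity of \<open>f\<close> absorbs the displacement.\<close>

lemma limits_rescale: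
  assumes f: "f \<in> limits" and s: "s > 0"
  shows "(\<lambda>z. f (y + s *\<^sub>R z) / s\<^sup>2) \<in> limits"
  unfolding limits_def mem_Collect_eq
proof
  fix N
  define M where "M = real (Suc N)"
  have M: "M \<ge> 1" by (simp add: M_def)
  obtain X r c q where g: "\<And>k. good k (X k) (r k)" and
    b: "\<And>k y. norm y \<le> real (Suc k) \<Longrightarrow> \<bar>blowup (X k) (r k) (c k) (q k) y - f y\<bar> \<le> 1 / real (Suc k)" and
    cf: "continuous_on UNIV f"
    by (rule limits_seq[OF f]) (rule that)
  define R where "R = norm y + 1 + s * M"
  have "uniformly_continuous_on (cball 0 R) f"
    by (intro compact_uniformly_continuous continuous_on_subset[OF cf]) auto
  moreover have e0: "s\<^sup>2 / (2 * M) > 0" using s M by simp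
  ultimately obtain d where d: "d > 0"
    "\<And>a b. norm a \<le> R \<Longrightarrow> norm b \<le> R \<Longrightarrow> dist b a < d \<Longrightarrow> dist (f b) (f a) < s\<^sup>2 / (2 * M)"
    unfolding uniformly_continuous_on_def by (metis mem_cball_0)
  \<comment> \<open>Four demands on the index: \<open>k1\<close> for the displacement of the centre,
    \<open>k2\<close> for the approximation error after division by \<open>s\<^sup>2\<close>,
    \<open>k3\<close> for the density of \<open>K\<close> at the new scale, \<open>k4\<close> for
    the size of the window.\<close>
  obtain k1 where k1: "1 / real (Suc k1) < d" using d(1) nat_approx_posE by blast
  obtain k2 where k2: "1 / real (Suc k2) < s\<^sup>2 / (2 * M)" using e0 nat_approx_posE by blast
  have "s / M > 0" using s M by simp
  then obtain k3 where k3: "1 / real (Suc k3) < s / M" using nat_approx_posE by blast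
  obtain k4 where k4: "R + s * M\<^sup>2 \<le> real k4" using real_arch_simple by blast
  define k where "k = k1 + k2 + k3 + k4"
  have kk: "1 / real (Suc k) \<le> 1 / real (Suc j)" if "j \<le> k" for j
    using that by (simp add: field_simps)
  have kd: "1 / real (Suc k) < d" "1 / real (Suc k) < s\<^sup>2 / (2 * M)" "1 / real (Suc k) < s / M"
    using k1 k2 k3 kk[of k1] kk[of k2] kk[of k3] by (auto simp: k_def)
  have "real k4 \<le> real k" by (simp add: k_def)
  moreover have sM: "0 < s * M" "0 < s * M\<^sup>2" using s M by simp_all
  ultimately have kR: "R \<le> real (Suc k)" "s * M\<^sup>2 \<le> real (Suc k)"
    using k4 norm_ge_zero[of y] unfolding R_def of_nat_Suc by linarith+
  define x where "x = X k"
  define \<rho> where "\<rho> = r k"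
  have \<rho>: "\<rho> > 0" using g[of k] by (simp add: good_def \<rho>_def)
  have "norm y \<le> real (Suc k)" using kR sM unfolding R_def by linarith
  then obtain y' where y': "x + \<rho> *\<^sub>R y' \<in> K" "norm (y' - y) \<le> 1 / real (Suc k)"
    using nearby_contact[OF g[of k]] unfolding x_def \<rho>_def by metis
  have y'1: "norm y' \<le> norm y + 1"
  proof -
    have "1 / real (Suc k) \<le> 1" by simp
    then have "norm (y' - y) \<le> 1" using y'(2) by linarith
    then show ?thesis using norm_triangle_ineq2[of y' y] by linarith
  qed
  have nz: "norm (y' + s *\<^sub>R z) \<le> R" "norm (y + s *\<^sub>R z) \<le> R" if "norm z \<le> M" for z
  proof -
    have "norm (s *\<^sub>R z) \<le> s * M" using that s by simp
    then show "norm (y' + s *\<^sub>R z) \<le> R" "norm (y + s *\<^sub>R z) \<le> R"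
      using y'1 norm_triangle_ineq[of y' "s *\<^sub>R z"] norm_triangle_ineq[of y "s *\<^sub>R z"]
      unfolding R_def by linarith+
  qed
  have pt: "(x + \<rho> *\<^sub>R y') + (s * \<rho>) *\<^sub>R z = x + \<rho> *\<^sub>R (y' + s *\<^sub>R z)" for z
    by (simp add: algebra_simps)
  have good: "good N (x + \<rho> *\<^sub>R y') (s * \<rho>)"
    unfolding good_def M_def[symmetric]
  proof (intro conjI ballI)
    have "s * \<rho> * M\<^sup>2 = \<rho> * (s * M\<^sup>2)" by simp
    also have "\<dots> \<le> \<rho> * real (Suc k)" using kR \<rho> by (intro mult_left_mono) auto
    also have "\<dots> < 1 / real (Suc k)" using good_r[OF g[of k]] by (simp add: \<rho>_def)
    also have "\<dots> \<le> 1" by simp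
    finally show "s * \<rho> * M\<^sup>2 < 1" .
  next
    fix z :: 'a assume "z \<in> cball 0 M"
    then have "norm (y' + s *\<^sub>R z) \<le> real (Suc k)" using nz(1)[of z] kR(1) by simp
    then obtain w where w: "w \<in> K" "dist (x + \<rho> *\<^sub>R (y' + s *\<^sub>R z)) w \<le> \<rho> / real (Suc k)"
      using g[of k] unfolding good_def x_def \<rho>_def by (metis mem_cball_0)
    have "\<rho> * (1 / real (Suc k)) \<le> \<rho> * (s / M)" using kd \<rho> by (intro mult_left_mono) auto
    then show "\<exists>w\<in>K. dist ((x + \<rho> *\<^sub>R y') + (s * \<rho>) *\<^sub>R z) w \<le> s * \<rho> / M"
      unfolding pt using w by (intro bexI[of _ w]) (auto simp: mult.commute)
  qed (use y' s \<rho> in auto)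
  define c' where "c' = (c k + q k \<bullet> y') / s\<^sup>2"
  define q' where "q' = (1 / s) *\<^sub>R q k"
  have "\<bar>blowup (x + \<rho> *\<^sub>R y') (s * \<rho>) c' q' z - f (y + s *\<^sub>R z) / s\<^sup>2\<bar> \<le> 1 / M" if z: "norm z \<le> M" for z
  proof -
    have eq: "blowup (x + \<rho> *\<^sub>R y') (s * \<rho>) c' q' z = blowup x \<rho> (c k) (q k) (y' + s *\<^sub>R z) / s\<^sup>2"
      unfolding blowup_def pt c'_def q'_def using s
      by (simp add: power_mult_distrib inner_add diff_divide_distrib add_divide_distrib power2_eq_square mult.commute)
    have "\<bar>blowup x \<rho> (c k) (q k) (y' + s *\<^sub>R z) - f (y' + s *\<^sub>R z)\<bar> \<le> 1 / real (Suc k)"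
      unfolding x_def \<rho>_def using nz(1)[OF z] kR(1) by (intro b) linarith
    moreover have "\<bar>f (y' + s *\<^sub>R z) - f (y + s *\<^sub>R z)\<bar> < s\<^sup>2 / (2 * M)"
    proof -
      have "dist (y' + s *\<^sub>R z) (y + s *\<^sub>R z) < d" using y'(2) kd(1) by (simp add: dist_norm)
      then show ?thesis using d(2)[OF nz(2)[OF z] nz(1)[OF z]] by (simp add: dist_real_def)
    qed
    ultimately have "\<bar>blowup x \<rho> (c k) (q k) (y' + s *\<^sub>R z) - f (y + s *\<^sub>R z)\<bar> \<le> s\<^sup>2 / (2 * M) + s\<^sup>2 / (2 * M)"
      using kd(2) by linarith
    also have "\<dots> = s\<^sup>2 / M" by simp
    finally have "\<bar>blowup x \<rho> (c k) (q k) (y' + s *\<^sub>R z) - f (y + s *\<^sub>R z)\<bar> / s\<^sup>2 \<le> s\<^sup>2 / M / s\<^sup>2"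
      by (rule divide_right_mono) simp
    then show ?thesis using s unfolding eq by (simp add: abs_divide diff_divide_distrib[symmetric])
  qed
  then show "\<exists>x r c q. good N x r \<and> (\<forall>z\<in>cball 0 (real (Suc N)).
      \<bar>blowup x r c q z - f (y + s *\<^sub>R z) / s\<^sup>2\<bar> \<le> 1 / real (Suc N))"
    using good unfolding M_def[symmetric] by (metis mem_cball_0)
qed

text \<open>A diagonal choice: \<open>F k\<close> is replaced by a blow-up of \<open>U\<close> that
  is \<open>1 / Suc k\<close> close to it on the ball of radius \<open>Suc k\<close>. Compactness of
  blow-ups applies, and the two affine normalisations are subtracted from each other.\<close>

lemma limits_compact:
  assumes F: "\<And>k. F k \<in> limits"
  shows "\<exists>f\<in>limits. \<exists>\<sigma> c q. strict_mono (\<sigma>::nat\<Rightarrow>nat) \<and>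
       (\<forall>R. uniform_limit (cball 0 R) (\<lambda>k y. F (\<sigma> k) y - c k - q k \<bullet> y) f sequentially)"
proof -
  have "\<exists>x r c q. good k x r \<and> (\<forall>y\<in>cball 0 (real (Suc k)). \<bar>blowup x r c q y - F k y\<bar> \<le> 1 / real (Suc k))" for k
    using F[of k] unfolding limits_def by blast
  then obtain X r c q where g: "\<And>k. good k (X k) (r k)" and
    b: "\<And>k y. norm y \<le> real (Suc k) \<Longrightarrow> \<bar>blowup (X k) (r k) (c k) (q k) y - F k y\<bar> \<le> 1 / real (Suc k)"
    by (simp add: Ball_def) metis
  obtain \<sigma> f c' q' where \<sigma>: "strict_mono (\<sigma>::nat\<Rightarrow>nat)" and f: "f \<in> limits" and
    u: "\<And>R. uniform_limit (cball 0 R) (\<lambda>k. blowup (X (\<sigma> k)) (r (\<sigma> k)) (c' k) (q' k)) f sequentially"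
    by (rule blowup_compact[OF g]) (rule that)
  define c2 where "c2 k = c' k - c (\<sigma> k)" for k
  define q2 where "q2 k = q' k - q (\<sigma> k)" for k
  have "uniform_limit (cball 0 R) (\<lambda>k y. F (\<sigma> k) y - c2 k - q2 k \<bullet> y) f sequentially" for R
  proof (rule uniform_limitI)
    fix e :: real assume e: "e > 0"
    then have e2: "e / 2 > 0" by simp
    then obtain N1 where N1: "1 / real (Suc N1) < e / 2" using nat_approx_posE by blast
    obtain N2 where N2: "R \<le> real N2" using real_arch_simple by blast
    have "\<forall>\<^sub>F k in sequentially. N1 + N2 \<le> k" by (rule eventually_ge_at_top)
    with uniform_limitD[OF u[of R] e2]
    show "\<forall>\<^sub>F k in sequentially. \<forall>y\<in>cball 0 R. dist (F (\<sigma> k) y - c2 k - q2 k \<bullet> y) (f y) < e"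
    proof eventually_elim
      case (elim k)
      show ?case
      proof
        fix y :: 'a assume y: "y \<in> cball 0 R"
        have k: "k \<le> \<sigma> k" by (rule seq_suble[OF \<sigma>])
        have "norm y \<le> real (Suc (\<sigma> k))" using y N2 k elim(2) by simp
        from b[OF this] have "\<bar>blowup (X (\<sigma> k)) (r (\<sigma> k)) (c (\<sigma> k)) (q (\<sigma> k)) y - F (\<sigma> k) y\<bar> \<le> 1 / real (Suc (\<sigma> k))" .
        also have "\<dots> \<le> 1 / real (Suc N1)" using k elim(2) by (simp add: field_simps)
        also have "\<dots> < e / 2" by (rule N1)
        finally have 1: "\<bar>blowup (X (\<sigma> k)) (r (\<sigma> k)) (c (\<sigma> k)) (q (\<sigma> k)) y - F (\<sigma> k) y\<bar> < e / 2" .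
        have 2: "\<bar>blowup (X (\<sigma> k)) (r (\<sigma> k)) (c' k) (q' k) y - f y\<bar> < e / 2"
          using elim(1) y by (auto simp: dist_real_def)
        have "blowup (X (\<sigma> k)) (r (\<sigma> k)) (c' k) (q' k) y
          = blowup (X (\<sigma> k)) (r (\<sigma> k)) (c (\<sigma> k)) (q (\<sigma> k)) y - c2 k - q2 k \<bullet> y"
          by (simp add: blowup_def c2_def q2_def inner_diff)
        then show "dist (F (\<sigma> k) y - c2 k - q2 k \<bullet> y) (f y) < e"
          using 1 2 unfolding dist_real_def by linarith
      qed
    qed
  qed
  with f \<sigma> show ?thesis by blast
qed

text \<open>This takes the place of Alexandrov's theorem: a second-order expansion that is valid only up to
  the prescribed error \<open>\<eta>\<close>, at one contact point and one scale.\<close>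

lemma coarse_second_order:
  assumes \<eta>: "\<eta> > 0"
  shows "\<exists>x\<in>K. \<exists>r. 0 < r \<and> r < \<eta> \<and> (\<exists>T c q. self_adjoint T \<and>
     (\<forall>y\<in>cball 0 1. \<bar>U (x + r *\<^sub>R y) / r\<^sup>2 - c - q \<bullet> y - (y \<bullet> T y) / 2\<bar> \<le> \<eta>))"
proof -
  obtain X r where "\<And>k. good k (X k) (r k)" using good_exists by metis
  then obtain g where "g \<in> limits" by (rule blowup_compact)
  then have ne: "limits \<noteq> {}" by blast
  have cont: "continuous_on UNIV f" if "f \<in> limits" for f using limits_seq[OF that] by blast
  obtain f T c q where f: "f \<in> limits" and T: "self_adjoint T" and
    fq: "\<And>x. f x = c + q \<bullet> x + (x \<bullet> T x) / 2"
    using quadratic_blowup[OF second_diff_limits cont limits_rescale limits_compact ne] by blast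
  obtain N where N: "1 / real (Suc N) < \<eta>" using \<eta> nat_approx_posE by blast
  obtain x r c' q' where g: "good N x r" and
    b: "\<And>y. norm y \<le> real (Suc N) \<Longrightarrow> \<bar>blowup x r c' q' y - f y\<bar> \<le> 1 / real (Suc N)"
  proof -
    obtain x r c' q' where "good N x r"
      "\<forall>y\<in>cball 0 (real (Suc N)). \<bar>blowup x r c' q' y - f y\<bar> \<le> 1 / real (Suc N)"
      using f unfolding limits_def by blast
    then show ?thesis by (intro that[of x r c' q']) auto
  qed
  have r: "0 < r" "x \<in> K" using g by (auto simp: good_def)
  have "r * 1 \<le> r * real (Suc N)" using r by (intro mult_left_mono) auto
  then have r\<eta>: "r < \<eta>" using good_r[OF g] N by linarith
  have "\<bar>U (x + r *\<^sub>R y) / r\<^sup>2 - (c' + c) - (q' + q) \<bullet> y - (y \<bullet> T y) / 2\<bar> \<le> \<eta>" if "y \<in> cball 0 1" for y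
  proof -
    have "norm y \<le> real (Suc N)" using that by simp
    from b[OF this] N show ?thesis unfolding blowup_def fq inner_add_left by linarith
  qed
  then show ?thesis using r r\<eta> T by blast
qed

end

section \<open>Sup-convolution and contact sets\<close>

text \<open>Otherwise every small ball centred in \<open>K\<close> has a hole of comparable size
  that misses \<open>K\<close>. In a disjoint Vitali family inside an open \<open>U\<close>
  containing \<open>K\<close>, the holes lie in \<open>U - K\<close> and occupy a fixed fraction of
  the family, which covers almost all of \<open>K\<close>. This is impossible when
  \<open>U - K\<close> is small enough compared with \<open>K\<close>.\<close>

lemma nonporous_of_not_negligible:
  fixes K :: "'a::euclidean_space set"
  assumes K: "compact K" and nn: "\<not> negligible K" and \<eta>: "\<eta> > 0"
  shows "\<exists>x\<in>K. \<exists>r. 0 < r \<and> r < \<eta> \<and> (\<forall>y\<in>cball x r. \<exists>z\<in>K. dist y z \<le> \<eta> * r)"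
proof (rule ccontr)
  assume "\<not> ?thesis"
  then have "\<forall>x r. \<exists>y. x \<in> K \<longrightarrow> 0 < r \<longrightarrow> r < \<eta> \<longrightarrow> y \<in> cball x r \<and> (\<forall>z\<in>K. \<eta> * r < dist y z)"
    by (meson not_le)
  then obtain Y where Y: "\<And>x r. x \<in> K \<Longrightarrow> 0 < r \<Longrightarrow> r < \<eta> \<Longrightarrow> Y x r \<in> cball x r"
    "\<And>x r z. x \<in> K \<Longrightarrow> 0 < r \<Longrightarrow> r < \<eta> \<Longrightarrow> z \<in> K \<Longrightarrow> \<eta> * r < dist (Y x r) z"
    by metis
  define n where "n = DIM('a)"
  \<comment> \<open>The volume ratio between a ball of radius \<open>(1 + \<eta>) * r\<close>,
    enlarged so as to contain the hole, and the hole of radius \<open>\<eta> * r\<close>.\<close>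
  define \<kappa> where "\<kappa> = ((1 + \<eta>) / \<eta>) ^ n"
  have \<kappa>: "\<kappa> > 0" using \<eta> by (simp add: \<kappa>_def)
  have borK: "K \<in> sets borel" using K by (simp add: borel_compact)
  have "emeasure lborel K \<noteq> 0"
    using nn borK by (auto simp: negligible_iff_null_sets null_sets_def)
  moreover have "emeasure lborel K \<noteq> \<infinity>"
    using emeasure_lborel_cbox_finite K bounded_subset_cbox_symmetric[OF compact_imp_bounded[OF K]]
    by (metis emeasure_bounded_finite compact_imp_bounded infinity_ennreal_def less_irrefl top.not_eq_extremum)
  ultimately obtain m where m: "m > 0" "emeasure lborel K = ennreal m"
    by (metis ennreal_cases ennreal_0 infinity_ennreal_def less_eq_real_def)
  obtain U where U: "open U" "K \<subseteq> U" "emeasure lborel (U - K) < ennreal (m / \<kappa>)"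
    using outer_regular_lborel[OF borK, of "m / \<kappa>"] m \<kappa> by auto
  \<comment> \<open>The indices keep the radius \<open>r\<close> from which the hole was chosen,
    while the Vitali balls have radius \<open>(1 + \<eta>) * r\<close>.\<close>
  define I where "I = {(x, r). x \<in> K \<and> 0 < r \<and> r < \<eta> \<and> cball x ((1 + \<eta>) * r) \<subseteq> U}"
  define a where "a i = fst i" for i :: "'a \<times> real"
  define R where "R i = (1 + \<eta>) * snd i" for i :: "'a \<times> real"
  define hole where "hole i = cball (Y (fst i) (snd i)) (\<eta> * snd i)" for i
  have 1: "0 < R i" if "i \<in> I" for i using that \<eta> by (auto simp: I_def R_def)
  have 2: "\<exists>i. i \<in> I \<and> x \<in> cball (a i) (R i) \<and> R i < d" if x: "x \<in> K" and d: "0 < d" for x d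
  proof -
    obtain e where e: "e > 0" "cball x e \<subseteq> U" using U x open_contains_cball by blast
    define r where "r = min (\<eta> / 2) (min (d / 2) (e / 2) / (1 + \<eta>))"
    have r: "0 < r" "r < \<eta>" using \<eta> d e by (auto simp: r_def)
    have "r \<le> min (d / 2) (e / 2) / (1 + \<eta>)" by (simp add: r_def)
    then have "(1 + \<eta>) * r \<le> min (d / 2) (e / 2)" using \<eta> by (simp add: field_simps)
    then have "(1 + \<eta>) * r < d" "(1 + \<eta>) * r \<le> e" using d e by auto
    moreover from this have "(x, r) \<in> I" using x r e by (auto simp: I_def)
    ultimately show ?thesis using r \<eta> by (intro exI[of _ "(x, r)"]) (auto simp: a_def R_def)
  qed
  obtain C where C: "countable C" "C \<subseteq> I"
    "pairwise (\<lambda>i j. disjnt (cball (a i) (R i)) (cball (a j) (R j))) C"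
    "negligible (K - (\<Union>i\<in>C. cball (a i) (R i)))"
    by (rule Vitali_covering_theorem_cballs[of I R K a]) (use 1 2 in auto)
  have hole_sub: "hole i \<subseteq> cball (a i) (R i)" if "i \<in> I" for i
  proof
    fix z assume "z \<in> hole i"
    then have "dist (Y (fst i) (snd i)) z \<le> \<eta> * snd i" by (simp add: hole_def)
    moreover have "dist (fst i) (Y (fst i) (snd i)) \<le> snd i" using Y(1) that by (auto simp: I_def)
    ultimately show "z \<in> cball (a i) (R i)"
      using dist_triangle[of "fst i" z "Y (fst i) (snd i)"] by (simp add: a_def R_def algebra_simps)
  qed
  have holeK: "hole i \<inter> K = {}" if "i \<in> I" for i
    using Y(2) that by (fastforce simp: hole_def I_def)
  have em: "emeasure lborel (cball (a i) (R i)) = ennreal \<kappa> * emeasure lborel (hole i)" if "i \<in> I" for i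
  proof -
    have r: "snd i > 0" using that by (auto simp: I_def)
    have "\<kappa> * (\<eta> * snd i) ^ n = ((1 + \<eta>) * snd i) ^ n"
      using \<eta> by (simp add: \<kappa>_def power_mult_distrib power_divide)
    then show ?thesis
      using r \<eta> \<kappa> unfolding hole_def R_def
      by (simp add: emeasure_cball n_def[symmetric] ennreal_mult[symmetric] mult.left_commute)
  qed
  have djC: "disjoint_family_on (\<lambda>i. cball (a i) (R i)) C"
    using C(3) by (auto simp: disjoint_family_on_def pairwise_def disjnt_def)
  have djH: "disjoint_family_on hole C"
    using djC hole_sub C(2) unfolding disjoint_family_on_def by blast
  have mh: "hole i \<in> sets borel" for i by (simp add: hole_def)
  have "emeasure lborel (\<Union>i\<in>C. cball (a i) (R i)) = (\<integral>\<^sup>+i. emeasure lborel (cball (a i) (R i)) \<partial>count_space C)"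
    by (rule emeasure_UN_countable[OF _ C(1) djC]) auto
  also have "\<dots> = (\<integral>\<^sup>+i. ennreal \<kappa> * emeasure lborel (hole i) \<partial>count_space C)"
    by (rule nn_integral_cong) (use em C(2) in auto)
  also have "\<dots> = ennreal \<kappa> * (\<integral>\<^sup>+i. emeasure lborel (hole i) \<partial>count_space C)"
    by (rule nn_integral_cmult) simp
  also have "(\<integral>\<^sup>+i. emeasure lborel (hole i) \<partial>count_space C) = emeasure lborel (\<Union>i\<in>C. hole i)"
    by (rule emeasure_UN_countable[symmetric, OF _ C(1) djH]) (use mh in auto)
  also have "\<dots> \<le> emeasure lborel (U - K)"
  proof (rule emeasure_mono)
    show "(\<Union>i\<in>C. hole i) \<subseteq> U - K"
    proof
      fix z assume "z \<in> (\<Union>i\<in>C. hole i)"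
      then obtain i where i: "i \<in> C" "z \<in> hole i" by blast
      then have iI: "i \<in> I" using C(2) by blast
      have "z \<in> cball (a i) (R i)" using hole_sub[OF iI] i by blast
      moreover have "cball (a i) (R i) \<subseteq> U" using iI by (auto simp: I_def a_def R_def)
      moreover have "z \<notin> K" using holeK[OF iI] i by blast
      ultimately show "z \<in> U - K" by blast
    qed
    show "U - K \<in> sets lborel" using U(1) borK by auto
  qed
  finally have le: "emeasure lborel (\<Union>i\<in>C. cball (a i) (R i)) \<le> ennreal \<kappa> * emeasure lborel (U - K)"
    by (simp add: mult_left_mono)
  have mC: "(\<Union>i\<in>C. cball (a i) (R i)) \<in> sets borel"
    using C(1) by (intro sets.countable_UN') auto
  have "emeasure lborel (K - (\<Union>i\<in>C. cball (a i) (R i))) = 0"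
    using C(4) borK mC by (auto simp: negligible_iff_null_sets null_sets_def)
  then have "emeasure lborel K \<le> emeasure lborel (\<Union>i\<in>C. cball (a i) (R i))"
  proof -
    assume z: "emeasure lborel (K - (\<Union>i\<in>C. cball (a i) (R i))) = 0"
    have "emeasure lborel K \<le> emeasure lborel ((K - (\<Union>i\<in>C. cball (a i) (R i))) \<union> (\<Union>i\<in>C. cball (a i) (R i)))"
      using borK mC by (intro emeasure_mono) auto
    also have "\<dots> \<le> emeasure lborel (K - (\<Union>i\<in>C. cball (a i) (R i))) + emeasure lborel (\<Union>i\<in>C. cball (a i) (R i))"
      using borK mC by (intro emeasure_subadditive) auto
    finally show ?thesis using z by simp
  qed
  also note le
  also have "ennreal \<kappa> * emeasure lborel (U - K) < ennreal \<kappa> * ennreal (m / \<kappa>)"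
    using U(3) \<kappa> by (intro ennreal_mult_strict_left_mono) auto
  also have "\<dots> = ennreal m" using \<kappa> m by (simp add: ennreal_mult[symmetric])
  finally show False using m by simp
qed

section \<open>Upper semicontinuity and sup-convolution\<close>

definition usc_real :: "'a::metric_space set \<Rightarrow> ('a \<Rightarrow> real) \<Rightarrow> bool" where
  "usc_real X f \<longleftrightarrow> (\<forall>x\<in>X. \<forall>c>f x. \<exists>d>0. \<forall>y\<in>X. dist y x < d \<longrightarrow> f y < c)"

lemma usc_realD:
  assumes "usc_real X f" "x \<in> X" "f x < c"
  obtains d where "d > 0" "\<And>y. y \<in> X \<Longrightarrow> dist y x < d \<Longrightarrow> f y < c"
  using assms unfolding usc_real_def by blast

lemma usc_real_subset: "usc_real X f \<Longrightarrow> Y \<subseteq> X \<Longrightarrow> usc_real Y f"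
  unfolding usc_real_def by (meson subsetD)

lemma usc_real_add:
  assumes "usc_real X f" "usc_real X g"
  shows "usc_real X (\<lambda>x. f x + g x)"
  unfolding usc_real_def
proof (intro ballI allI impI)
  fix x c assume x: "x \<in> X" and c: "f x + g x < c"
  define s where "s = (c - (f x + g x)) / 2"
  have s: "f x < f x + s" "g x < g x + s" "f x + s + (g x + s) = c" using c by (auto simp: s_def)
  obtain d where d: "d > 0" "\<And>y. y \<in> X \<Longrightarrow> dist y x < d \<Longrightarrow> f y < f x + s"
    by (rule usc_realD[OF assms(1) x s(1)]) (rule that)
  obtain e where e: "e > 0" "\<And>y. y \<in> X \<Longrightarrow> dist y x < e \<Longrightarrow> g y < g x + s"
    by (rule usc_realD[OF assms(2) x s(2)]) (rule that)
  show "\<exists>d>0. \<forall>y\<in>X. dist y x < d \<longrightarrow> f y + g y < c"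
  proof (intro exI[of _ "min d e"] conjI ballI impI)
    fix y assume "y \<in> X" "dist y x < min d e"
    then show "f y + g y < c" using d(2)[of y] e(2)[of y] s(3) by auto
  qed (use d e in auto)
qed

lemma usc_real_continuous:
  assumes "continuous_on X f" shows "usc_real X f"
  unfolding usc_real_def
proof (intro ballI allI impI)
  fix x c assume x: "x \<in> X" and c: "f x < c"
  then have "\<exists>d>0. \<forall>y\<in>X. dist y x < d \<longrightarrow> dist (f y) (f x) < c - f x"
    using assms unfolding continuous_on_iff by simp
  then show "\<exists>d>0. \<forall>y\<in>X. dist y x < d \<longrightarrow> f y < c"
    unfolding dist_real_def by (smt (verit))
qed

text \<open>If every \<open>x\<close> were beaten by some \<open>Y x\<close>, the same
  \<open>Y x\<close> would beat a whole neighbourhood. Among the finitely many \<open>Y x\<close> of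
  a subcover, the one with the largest value would itself be beaten by another.\<close>

lemma usc_real_attains_sup:
  assumes C: "compact C" "C \<noteq> {}" and f: "usc_real C f"
  shows "\<exists>x\<in>C. \<forall>y\<in>C. f y \<le> f x"
proof (rule ccontr)
  assume "\<not> ?thesis"
  then obtain Y where Y: "\<And>x. x \<in> C \<Longrightarrow> Y x \<in> C" "\<And>x. x \<in> C \<Longrightarrow> f x < f (Y x)"
    by (metis not_le)
  have "\<forall>x. \<exists>d. x \<in> C \<longrightarrow> d > 0 \<and> (\<forall>y\<in>C. dist y x < d \<longrightarrow> f y < f (Y x))"
    using f Y unfolding usc_real_def by meson
  then obtain d where d: "\<And>x. x \<in> C \<Longrightarrow> d x > 0"
    "\<And>x y. x \<in> C \<Longrightarrow> y \<in> C \<Longrightarrow> dist y x < d x \<Longrightarrow> f y < f (Y x)"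
    by metis
  have "C \<subseteq> (\<Union>x\<in>C. ball x (d x))" using d(1) by force
  then obtain S where S: "S \<subseteq> C" "finite S" "C \<subseteq> (\<Union>x\<in>S. ball x (d x))"
    using compactE_image[OF C(1), of C "\<lambda>x. ball x (d x)"] by auto
  have neS: "S \<noteq> {}" using S C by auto
  define M where "M = Max ((\<lambda>x. f (Y x)) ` S)"
  have "M \<in> (\<lambda>x. f (Y x)) ` S" unfolding M_def using S(2) neS by (intro Max_in) auto
  then obtain s where s: "s \<in> S" "f (Y s) = M" by auto
  then obtain t where t: "t \<in> S" "Y s \<in> ball t (d t)" using S Y(1) by blast
  have "f (Y s) < f (Y t)"
    using d(2)[of t "Y s"] t S(1) s(1) Y(1) by (auto simp: dist_commute)
  moreover have "f (Y t) \<le> M" unfolding M_def using S(2) t(1) by (intro Max_ge) auto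
  ultimately show False using s by simp
qed

text \<open>The sup-convolution. The maximising point ranges over the compact \<open>C\<close> and
  the argument over the whole space, so that the supremum is attained and semiconvexity holds
  everywhere.\<close>

definition sup_conv :: "real \<Rightarrow> 'a::euclidean_space set \<Rightarrow> ('a \<Rightarrow> real) \<Rightarrow> 'a \<Rightarrow> real" where
  "sup_conv \<delta> C u x = Sup ((\<lambda>y. u y - (norm (x - y))\<^sup>2 / (2 * \<delta>)) ` C)"

context
  fixes \<delta> :: real and C :: "'a::euclidean_space set" and u :: "'a \<Rightarrow> real"
  assumes \<delta>: "\<delta> > 0" and C: "compact C" "C \<noteq> {}" and u: "usc_real C u"
begin

lemma sup_conv_attained:
  obtains y where "y \<in> C" "sup_conv \<delta> C u x = u y - (norm (x - y))\<^sup>2 / (2 * \<delta>)"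
    "\<And>z. z \<in> C \<Longrightarrow> u z - (norm (x - z))\<^sup>2 / (2 * \<delta>) \<le> u y - (norm (x - y))\<^sup>2 / (2 * \<delta>)"
proof -
  have "usc_real C (\<lambda>y. - (norm (x - y))\<^sup>2 / (2 * \<delta>))"
    using \<delta> by (intro usc_real_continuous continuous_intros) auto
  from usc_real_attains_sup[OF C usc_real_add[OF u this]] obtain y where
    y: "y \<in> C" "\<And>z. z \<in> C \<Longrightarrow> u z - (norm (x - z))\<^sup>2 / (2 * \<delta>) \<le> u y - (norm (x - y))\<^sup>2 / (2 * \<delta>)"
    by auto
  have "sup_conv \<delta> C u x = u y - (norm (x - y))\<^sup>2 / (2 * \<delta>)"
    unfolding sup_conv_def by (rule cSup_eq_maximum) (use y in auto)
  with y that show ?thesis by blast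
qed

lemma sup_conv_ge:
  assumes "z \<in> C" shows "u z - (norm (x - z))\<^sup>2 / (2 * \<delta>) \<le> sup_conv \<delta> C u x"
  using sup_conv_attained[of x] assms by metis

text \<open>Keeping the maximising point \<open>y\<close> fixed while \<open>x\<close> moves gives a
  paraboloid that touches from below, with slope \<open>(y - x) / \<delta>\<close>.\<close>

lemma sup_conv_jet: "\<exists>q. \<forall>h. sup_conv \<delta> C u (x + h) \<ge> sup_conv \<delta> C u x + q \<bullet> h - (norm h)\<^sup>2 / (2 * \<delta>)"
proof -
  obtain y where y: "y \<in> C" "sup_conv \<delta> C u x = u y - (norm (x - y))\<^sup>2 / (2 * \<delta>)"
    by (rule sup_conv_attained)
  show ?thesis
  proof (intro exI allI)
    fix h
    have *: "(norm (x + h - y))\<^sup>2 = (norm (x - y))\<^sup>2 - 2 * ((y - x) \<bullet> h) + (norm h)\<^sup>2"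
      by (simp add: power2_norm_eq_inner inner_diff inner_add inner_commute algebra_simps)
    then have "u y - (norm (x + h - y))\<^sup>2 / (2 * \<delta>)
        = u y - (norm (x - y))\<^sup>2 / (2 * \<delta>) + ((1 / \<delta>) *\<^sub>R (y - x)) \<bullet> h - (norm h)\<^sup>2 / (2 * \<delta>)"
      unfolding * inner_scaleR_left by (simp add: diff_divide_distrib add_divide_distrib)
    then show "sup_conv \<delta> C u (x + h) \<ge> sup_conv \<delta> C u x + ((1 / \<delta>) *\<^sub>R (y - x)) \<bullet> h - (norm h)\<^sup>2 / (2 * \<delta>)"
      using sup_conv_ge[OF y(1), of "x + h"] y(2) by simp
  qed
qed

lemma second_diff_sup_conv: "second_diff (sup_conv \<delta> C u) x h \<ge> - (1 / \<delta>) * (norm h)\<^sup>2"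
proof -
  obtain q where q: "\<And>h. sup_conv \<delta> C u (x + h) \<ge> sup_conv \<delta> C u x + q \<bullet> h - (norm h)\<^sup>2 / (2 * \<delta>)"
    using sup_conv_jet by blast
  from q[of h] q[of "-h"] have "second_diff (sup_conv \<delta> C u) x h \<ge> - 2 * ((norm h)\<^sup>2 / (2 * \<delta>))"
    by (simp add: second_diff_def)
  then show ?thesis using \<delta> by simp
qed

lemma continuous_sup_conv: "continuous_on UNIV (sup_conv \<delta> C u)"
proof -
  obtain B where B: "\<And>y. y \<in> C \<Longrightarrow> norm y \<le> B"
    using compact_imp_bounded[OF C(1)] unfolding bounded_iff by blast
  define E where "E x x' = (norm x + norm x' + 2 * B) * norm (x - x') / (2 * \<delta>)" for x x' :: 'a
  have le: "sup_conv \<delta> C u x \<le> sup_conv \<delta> C u x' + E x x'" for x x'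
  proof -
    obtain y where y: "y \<in> C" "sup_conv \<delta> C u x = u y - (norm (x - y))\<^sup>2 / (2 * \<delta>)"
      by (rule sup_conv_attained)
    have "(norm (x' - y))\<^sup>2 - (norm (x - y))\<^sup>2 = (norm (x' - y) - norm (x - y)) * (norm (x' - y) + norm (x - y))"
      by (simp add: power2_eq_square algebra_simps)
    also have "\<dots> \<le> norm (x - x') * (norm x + norm x' + 2 * B)"
    proof (rule mult_mono)
      show "norm (x' - y) - norm (x - y) \<le> norm (x - x')"
        using norm_triangle_ineq2[of "x' - y" "x - y"] by (simp add: norm_minus_commute)
      show "norm (x' - y) + norm (x - y) \<le> norm x + norm x' + 2 * B"
        using norm_triangle_ineq4[of x' y] norm_triangle_ineq4[of x y] B[OF y(1)] by linarith
    qed auto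
    finally have "((norm (x' - y))\<^sup>2 - (norm (x - y))\<^sup>2) / (2 * \<delta>) \<le> E x x'"
      unfolding E_def using \<delta> by (intro divide_right_mono) (auto simp: mult.commute)
    then show ?thesis using sup_conv_ge[OF y(1), of x'] y(2) by (simp add: diff_divide_distrib)
  qed
  have "isCont (sup_conv \<delta> C u) x" for x
    unfolding isCont_def
  proof (rule LIM_zero_cancel, rule Lim_null_comparison)
    show "\<forall>\<^sub>F x' in at x. norm (sup_conv \<delta> C u x' - sup_conv \<delta> C u x) \<le> E x x'"
      using le[of x] le[of _ x] by (intro always_eventually) (auto simp: abs_le_iff E_def norm_minus_commute add.commute algebra_simps)
    have "isCont (E x) x" unfolding E_def using \<delta> by (intro continuous_intros) auto
    then show "((E x) \<longlongrightarrow> 0) (at x)" by (simp add: isCont_def E_def)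
  qed
  then show ?thesis by (simp add: continuous_at_imp_continuous_on)
qed

end

text \<open>The penalty is bounded because \<open>u\<close>, \<open>v\<close> and \<open>w\<close>
  are bounded above on \<open>C\<close>; as \<open>\<delta>\<close> tends to 0 the three points
  therefore merge, and semicontinuity at their common limit in \<open>E\<close> contradicts the
  strict inequality. With \<open>E\<close> the frontier, this keeps the maximising points of both
  sup-convolutions in the interior.\<close>

lemma doubling_localized:
  fixes u v :: "'a::euclidean_space \<Rightarrow> real"
  assumes C: "compact C" and E: "closed E" "E \<subseteq> C" and u: "usc_real C u" and v: "usc_real C v"
    and w: "continuous_on C w" and less: "\<And>x. x \<in> E \<Longrightarrow> u x + v x + w x < c"
  shows "\<exists>\<delta>>0. \<forall>x\<in>C. \<forall>y\<in>C. \<forall>z\<in>C.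
     u y + v z + w x - ((norm (x - y))\<^sup>2 + (norm (x - z))\<^sup>2) / (2 * \<delta>) \<ge> c \<longrightarrow> x \<notin> E \<and> y \<notin> E \<and> z \<notin> E"
proof (cases "C = {}")
  case False
  show ?thesis
  proof (rule ccontr)
    assume neg: "\<not> ?thesis"
    obtain yu where yu: "\<And>y. y \<in> C \<Longrightarrow> u y \<le> u yu" using usc_real_attains_sup[OF C False u] by blast
    obtain yv where yv: "\<And>y. y \<in> C \<Longrightarrow> v y \<le> v yv" using usc_real_attains_sup[OF C False v] by blast
    obtain yw where yw: "\<And>y. y \<in> C \<Longrightarrow> w y \<le> w yw" using continuous_attains_sup[OF C False w] by blast
    \<comment> \<open>The most that the penalty can amount to when the penalised sum still reaches
      \<open>c\<close>.\<close>
    define B where "B = u yu + v yv + w yw - c"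
    define d where "d k = inverse (real (Suc k))" for k
    have d0: "d k > 0" for k by (simp add: d_def)
    have "\<forall>k. \<exists>x y z. x \<in> C \<and> y \<in> C \<and> z \<in> C \<and>
       u y + v z + w x - ((norm (x - y))\<^sup>2 + (norm (x - z))\<^sup>2) / (2 * d k) \<ge> c \<and> (x \<in> E \<or> y \<in> E \<or> z \<in> E)"
      using neg d0 by blast
    then obtain x y z where xyz: "\<And>k. x k \<in> C" "\<And>k. y k \<in> C" "\<And>k. z k \<in> C"
      "\<And>k. u (y k) + v (z k) + w (x k) - ((norm (x k - y k))\<^sup>2 + (norm (x k - z k))\<^sup>2) / (2 * d k) \<ge> c"
      "\<And>k. x k \<in> E \<or> y k \<in> E \<or> z k \<in> E" by metis
    \<comment> \<open>Selects one of the three points that lies in \<open>E\<close>; since all three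
      merge, its limit is theirs.\<close>
    define e where "e k = (if x k \<in> E then x k else if y k \<in> E then y k else z k)" for k
    have eE: "e k \<in> E" for k using xyz(5)[of k] by (auto simp: e_def)
    have "compact E" using C E by (metis compact_Int_closed inf.absorb_iff2)
    then obtain e0 \<sigma> where e0: "e0 \<in> E" "strict_mono (\<sigma>::nat\<Rightarrow>nat)" "(e \<circ> \<sigma>) \<longlonglongrightarrow> e0"
      using eE unfolding compact_def by blast
    have sq: "(norm (x k - y k))\<^sup>2 + (norm (x k - z k))\<^sup>2 \<le> 2 * B * d k" for k
    proof -
      have "((norm (x k - y k))\<^sup>2 + (norm (x k - z k))\<^sup>2) / (2 * d k) \<le> B"
        using xyz(4)[of k] yu[OF xyz(2)] yv[OF xyz(3)] yw[OF xyz(1)] unfolding B_def by (smt (verit))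
      then show ?thesis using d0[of k] by (simp add: divide_le_eq mult_ac)
    qed
    have sqs: "(norm (x k - y k))\<^sup>2 \<le> 2 * B * d k" "(norm (x k - z k))\<^sup>2 \<le> 2 * B * d k" for k
      using sq[of k] zero_le_power2[of "norm (x k - y k)"] zero_le_power2[of "norm (x k - z k)"]
      by linarith+
    have dl: "(\<lambda>k. 2 * B * d k) \<longlonglongrightarrow> 0"
      using tendsto_mult_left[OF LIMSEQ_inverse_real_of_nat, of "2 * B"] by (simp add: d_def)
    have nxy: "(\<lambda>k. norm (x k - y k)) \<longlonglongrightarrow> 0" and nxz: "(\<lambda>k. norm (x k - z k)) \<longlonglongrightarrow> 0"
    proof -
      have "(\<lambda>k. (norm (x k - y k))\<^sup>2) \<longlonglongrightarrow> 0"
        by (rule tendsto_sandwich[OF _ _ tendsto_const dl]) (use sqs in \<open>auto intro!: always_eventually\<close>)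
      from tendsto_real_sqrt[OF this] show "(\<lambda>k. norm (x k - y k)) \<longlonglongrightarrow> 0" by simp
      have "(\<lambda>k. (norm (x k - z k))\<^sup>2) \<longlonglongrightarrow> 0"
        by (rule tendsto_sandwich[OF _ _ tendsto_const dl]) (use sqs in \<open>auto intro!: always_eventually\<close>)
      from tendsto_real_sqrt[OF this] show "(\<lambda>k. norm (x k - z k)) \<longlonglongrightarrow> 0" by simp
    qed
    have ex: "(\<lambda>k. x k - e k) \<longlonglongrightarrow> 0"
    proof (rule Lim_null_comparison)
      show "\<forall>\<^sub>F k in sequentially. norm (x k - e k) \<le> norm (x k - y k) + norm (x k - z k)"
        by (intro always_eventually) (auto simp: e_def)
      show "(\<lambda>k. norm (x k - y k) + norm (x k - z k)) \<longlonglongrightarrow> 0"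
        using tendsto_add[OF nxy nxz] by simp
    qed
    have x0: "(\<lambda>k. x (\<sigma> k)) \<longlonglongrightarrow> e0"
      using tendsto_add[OF LIMSEQ_subseq_LIMSEQ[OF ex e0(2)] e0(3)] by (simp add: o_def)
    have y0: "(\<lambda>k. y (\<sigma> k)) \<longlonglongrightarrow> e0"
      using tendsto_diff[OF x0 LIMSEQ_subseq_LIMSEQ[OF tendsto_norm_zero_cancel[OF nxy] e0(2)]] by (simp add: o_def)
    have z0: "(\<lambda>k. z (\<sigma> k)) \<longlonglongrightarrow> e0"
      using tendsto_diff[OF x0 LIMSEQ_subseq_LIMSEQ[OF tendsto_norm_zero_cancel[OF nxz] e0(2)]] by (simp add: o_def)
    have e0C: "e0 \<in> C" using e0 E by blast
    define s where "s = (c - (u e0 + v e0 + w e0)) / 3"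
    have s: "s > 0" "u e0 + s + (v e0 + s) + (w e0 + s) = c" using less[OF e0(1)] by (simp_all add: s_def field_simps)
    obtain du where du: "du > 0" "\<And>y. y \<in> C \<Longrightarrow> dist y e0 < du \<Longrightarrow> u y < u e0 + s"
      using u e0C s(1) unfolding usc_real_def by (metis less_add_same_cancel1)
    obtain dv where dv: "dv > 0" "\<And>y. y \<in> C \<Longrightarrow> dist y e0 < dv \<Longrightarrow> v y < v e0 + s"
      using v e0C s(1) unfolding usc_real_def by (metis less_add_same_cancel1)
    obtain dw where dw: "dw > 0" "\<And>y. y \<in> C \<Longrightarrow> dist y e0 < dw \<Longrightarrow> w y < w e0 + s"
      using usc_real_continuous[OF w] e0C s(1) unfolding usc_real_def by (metis less_add_same_cancel1)
    have "\<forall>\<^sub>F k in sequentially. dist (x (\<sigma> k)) e0 < dw \<and> dist (y (\<sigma> k)) e0 < du \<and> dist (z (\<sigma> k)) e0 < dv"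
      using tendstoD[OF x0 dw(1)] tendstoD[OF y0 du(1)] tendstoD[OF z0 dv(1)] by eventually_elim auto
    then obtain k where "dist (x (\<sigma> k)) e0 < dw" "dist (y (\<sigma> k)) e0 < du" "dist (z (\<sigma> k)) e0 < dv"
      unfolding eventually_sequentially by blast
    then have "u (y (\<sigma> k)) + v (z (\<sigma> k)) + w (x (\<sigma> k)) < c"
      using du(2)[OF xyz(2)] dv(2)[OF xyz(3)] dw(2)[OF xyz(1)] s(2) by (smt (verit))
    moreover have "((norm (x (\<sigma> k) - y (\<sigma> k)))\<^sup>2 + (norm (x (\<sigma> k) - z (\<sigma> k)))\<^sup>2) / (2 * d (\<sigma> k)) \<ge> 0"
      using d0[of "\<sigma> k"] by simp
    ultimately show False using xyz(4)[of "\<sigma> k"] by linarith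
  qed
qed (auto intro: exI[of _ 1])

text \<open>This turns an approximate expansion into an exact test: with a function that follows a
  quadratic up to \<open>\<eta>\<close>, an additional term \<open>- s\<close> on the unit sphere
  outweighs the errors and forces an interior maximum.\<close>

lemma cball_interior_max:
  fixes G :: "'a::euclidean_space \<Rightarrow> real"
  assumes cont: "continuous_on (cball 0 1) G" and s: "s > 2 * \<eta>" and 0: "G 0 \<ge> - \<eta>"
    and bd: "\<And>y. norm y = 1 \<Longrightarrow> G y \<le> \<eta> - s"
  shows "\<exists>y. norm y < 1 \<and> (\<forall>z\<in>cball 0 1. G z \<le> G y)"
proof -
  obtain y where y: "y \<in> cball 0 1" "\<And>z. z \<in> cball 0 1 \<Longrightarrow> G z \<le> G y"
    using continuous_attains_sup[OF compact_cball _ cont] by auto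
  have "norm y \<noteq> 1" using bd[of y] y(2)[of 0] 0 s by auto
  then show ?thesis using y by (intro exI[of _ y]) auto
qed

section \<open>Contact sets of semiconvex functions\<close>

lemma contact_set_compact:
  fixes W :: "'a::euclidean_space \<Rightarrow> real"
  assumes C: "compact C" and cont: "continuous_on UNIV W"
    and K: "K = {x \<in> C. \<exists>p\<in>cball 0 \<rho>. \<forall>y\<in>C. W y \<le> W x + p \<bullet> (y - x)}"
  shows "compact K"
proof -
  have "closed K"
    unfolding closed_sequential_limits
  proof (intro allI impI)
    fix x l assume x: "(\<forall>n. x n \<in> K) \<and> x \<longlonglongrightarrow> l"
    then have "\<forall>n. \<exists>p. p \<in> cball 0 \<rho> \<and> (\<forall>y\<in>C. W y \<le> W (x n) + p \<bullet> (y - x n))" unfolding K by blast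
    then obtain p where p: "\<And>n. p n \<in> cball 0 \<rho>" "\<And>n y. y \<in> C \<Longrightarrow> W y \<le> W (x n) + p n \<bullet> (y - x n)"
      by metis
    obtain q \<sigma> where q: "q \<in> cball 0 \<rho>" "strict_mono (\<sigma>::nat\<Rightarrow>nat)" "(p \<circ> \<sigma>) \<longlonglongrightarrow> q"
      using compact_cball[of 0 \<rho>] p(1) unfolding compact_def by blast
    have xl: "(\<lambda>n. x (\<sigma> n)) \<longlonglongrightarrow> l" using LIMSEQ_subseq_LIMSEQ[OF conjunct2[OF x] q(2)] by (simp add: o_def)
    have pl: "(\<lambda>n. p (\<sigma> n)) \<longlonglongrightarrow> q" using q(3) by (simp add: o_def)
    have lC: "l \<in> C"
      using closed_sequentially[OF compact_imp_closed[OF C], of x l] x unfolding K by blast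
    have "W y \<le> W l + q \<bullet> (y - l)" if "y \<in> C" for y
    proof (rule LIMSEQ_le_const)
      show "(\<lambda>n. W (x (\<sigma> n)) + p (\<sigma> n) \<bullet> (y - x (\<sigma> n))) \<longlonglongrightarrow> W l + q \<bullet> (y - l)"
        by (intro tendsto_intros continuous_on_tendsto_compose[OF cont xl] xl pl) auto
    qed (use p(2)[OF that] in auto)
    then show "l \<in> K" unfolding K using lC q(1) by blast
  qed
  moreover have "bounded K" using compact_imp_bounded[OF C] K by (auto intro: bounded_subset)
  ultimately show ?thesis by (simp add: compact_eq_bounded_closed)
qed

text \<open>Jensen's argument: the set of points where \<open>W\<close> is touched from above by a plane of small slope
  is mapped by the slope, a Lipschitz map, onto a full ball.\<close>

lemma contact_set_not_negligible:
  fixes W :: "'a::euclidean_space \<Rightarrow> real"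
  assumes C: "compact C" "C \<noteq> {}" and cont: "continuous_on UNIV W" and \<Lambda>: "\<Lambda> > 0"
    and semi: "\<And>x h. second_diff W x h \<ge> - \<Lambda> * (norm h)\<^sup>2" and \<rho>: "\<rho> > 0" and \<tau>: "\<tau> > 0"
    and K: "K = {x \<in> C. \<exists>p\<in>cball 0 \<rho>. \<forall>y\<in>C. W y \<le> W x + p \<bullet> (y - x)}"
    and KC: "\<And>x. x \<in> K \<Longrightarrow> ball x \<tau> \<subseteq> C"
  shows "\<not> negligible K"
proof
  assume neg: "negligible K"
  define P where "P x p \<longleftrightarrow> p \<in> cball 0 \<rho> \<and> (\<forall>y\<in>C. W y \<le> W x + p \<bullet> (y - x))" for x p
  \<comment> \<open>The plane above \<open>W\<close> is evaluated at \<open>x - h\<close>;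
    semiconvexity converts this into a lower paraboloid at \<open>x + h\<close>.\<close>
  have lower: "W (x + h) \<ge> W x + p \<bullet> h - \<Lambda> * (norm h)\<^sup>2" if x: "x \<in> K" "P x p" "norm h < \<tau>" for x p h
  proof -
    have "x - h \<in> ball x \<tau>" using x(3) by (simp add: dist_norm)
    then have "x - h \<in> C" using KC[OF x(1)] by blast
    then have "W (x - h) \<le> W x - p \<bullet> h" using x(2) unfolding P_def by (fastforce simp: inner_diff)
    then show ?thesis using semi[of h x] by (simp add: second_diff_def)
  qed
  have key: "norm (p - p') \<le> 4 * \<Lambda> * t"
    if x: "x \<in> K" "P x p" and x': "x' \<in> K" "P x' p'" and t: "norm (x - x') \<le> t" "0 < t" "t < \<tau> / 2"
    for x p x' p' t
  proof (cases "p = p'")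
    case False
    \<comment> \<open>A step of length \<open>t\<close> in the direction in which the two slopes
      differ. At \<open>x' + k\<close> the plane through \<open>x'\<close> lies above
      \<open>W\<close> and the paraboloid at \<open>x\<close> below, so their slopes cannot be far
      apart.\<close>
    define k where "k = (t / norm (p - p')) *\<^sub>R (p - p')"
    have nk: "norm k = t" using False t by (simp add: k_def)
    have pk: "(p - p') \<bullet> k = t * norm (p - p')"
      using False by (simp add: k_def dot_square_norm power2_eq_square)
    have nh: "norm (x' + k - x) \<le> 2 * t"
      using norm_triangle_ineq[of "x' - x" k] t(1) nk by (simp add: norm_minus_commute algebra_simps)
    have "x' + k \<in> ball x' \<tau>" using nk t by (simp add: dist_norm)
    then have "x' + k \<in> C" using KC[OF x'(1)] by blast
    then have "W (x' + k) \<le> W x' + p' \<bullet> k" using x'(2) unfolding P_def by fastforce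
    moreover have "x' \<in> C" using x'(1) K by blast
    then have "W x' \<le> W x + p \<bullet> (x' - x)" using x(2) unfolding P_def by blast
    moreover have "W (x + (x' + k - x)) \<ge> W x + p \<bullet> (x' + k - x) - \<Lambda> * (norm (x' + k - x))\<^sup>2"
      by (rule lower[OF x]) (use nh t in linarith)
    ultimately have "(p - p') \<bullet> k \<le> \<Lambda> * (norm (x' + k - x))\<^sup>2"
      by (simp add: inner_diff inner_add)
    also have "\<dots> \<le> \<Lambda> * (2 * t)\<^sup>2" using \<Lambda> nh by (intro mult_left_mono power_mono) auto
    finally have "t * norm (p - p') \<le> t * (4 * \<Lambda> * t)" by (simp add: pk power2_eq_square mult_ac)
    then show ?thesis using t(2) by simp
  qed (use \<Lambda> t in simp)
  have uniq: "p = p'" if "x \<in> K" "P x p" "P x p'" for x p p'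
  proof (rule ccontr)
    assume "p \<noteq> p'"
    \<comment> \<open>Small enough that \<open>key\<close>, applied with \<open>x' = x\<close>,
      bounds \<open>norm (p - p')\<close> by half of itself.\<close>
    define t where "t = min (\<tau> / 4) (norm (p - p') / (8 * \<Lambda>))"
    have t: "0 < t" "t < \<tau> / 2" using \<open>p \<noteq> p'\<close> \<tau> \<Lambda> by (auto simp: t_def)
    have "norm (p - p') \<le> 4 * \<Lambda> * t" by (rule key[OF that(1,2,1,3)]) (use t in auto)
    also have "\<dots> \<le> 4 * \<Lambda> * (norm (p - p') / (8 * \<Lambda>))" using \<Lambda> by (intro mult_left_mono) (auto simp: t_def)
    also have "\<dots> = norm (p - p') / 2" using \<Lambda> by simp
    finally show False using \<open>p \<noteq> p'\<close> by simp
  qed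
  define f where "f x = (SOME p. P x p)" for x
  have f: "P x (f x)" if "x \<in> K" for x
    unfolding f_def by (rule someI_ex) (use that in \<open>auto simp: K P_def\<close>)
  have "negligible (f ` K)"
  proof (rule negligible_locally_Lipschitz_image[OF _ neg])
    fix x assume x: "x \<in> K"
    have "norm (f y - f x) \<le> 4 * \<Lambda> * norm (y - x)" if "y \<in> K \<inter> ball x (\<tau> / 2)" for y
    proof (cases "y = x")
      case False
      then show ?thesis
        using that by (intro key[OF _ f x f[OF x]]) (auto simp: dist_norm norm_minus_commute)
    qed simp
    then show "\<exists>T B. open T \<and> x \<in> T \<and> (\<forall>y\<in>K \<inter> T. norm (f y - f x) \<le> B * norm (y - x))"
      using \<tau> by (intro exI[of _ "ball x (\<tau> / 2)"] exI[of _ "4 * \<Lambda>"]) auto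
  qed simp
  moreover have "ball 0 \<rho> \<subseteq> f ` K"
  proof
    fix p :: 'a assume p: "p \<in> ball 0 \<rho>"
    \<comment> \<open>Every slope in the ball occurs: at a maximum of
      \<open>W x - p \<bullet> x\<close> over \<open>C\<close> the plane of slope \<open>p\<close>
      lies above \<open>W\<close>.\<close>
    have "continuous_on C (\<lambda>x. W x - p \<bullet> x)"
      by (intro continuous_intros continuous_on_subset[OF cont]) auto
    then obtain x where x: "x \<in> C" "\<And>y. y \<in> C \<Longrightarrow> W y - p \<bullet> y \<le> W x - p \<bullet> x"
      using continuous_attains_sup[OF C] by blast
    have Px: "P x p" unfolding P_def using p x(2) by (force simp: inner_diff)
    then have xK: "x \<in> K" using x(1) unfolding K P_def by blast
    then have "f x = p" using uniq[OF xK f[OF xK] Px] by simp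
    then show "p \<in> f ` K" using xK by blast
  qed
  ultimately have "negligible (ball (0::'a) \<rho>)" by (rule negligible_subset)
  moreover have "\<not> negligible (ball (0::'a) \<rho>)" using \<rho> by (intro open_not_negligible) auto
  ultimately show False by simp
qed

section \<open>Comparison\<close>

text \<open>The properties shared by \<open>F\<close> and its dual, by
  \<open>subequation_dual\<close>, so that one argument serves both.\<close>

definition subequation :: "(real^'n^'n) set \<Rightarrow> bool" where
  "subequation F \<longleftrightarrow> F \<subseteq> {A. sym_mat A} \<and> closed F \<and> (\<forall>A\<in>F. \<forall>P. psd P \<longrightarrow> A + P \<in> F)"

text \<open>Viscosity subharmonicity of a real-valued function, tested by quadratic polynomials only and
  without the upper semicontinuity.\<close>

definition quad_sub :: "(real^'n^'n) set \<Rightarrow> (real^'n) set \<Rightarrow> (real^'n \<Rightarrow> real) \<Rightarrow> bool" where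
  "quad_sub F X u \<longleftrightarrow> (\<forall>x\<in>X. \<forall>q A. sym_mat A \<longrightarrow>
     (\<exists>r>0. \<forall>y\<in>X \<inter> ball x r. u y \<le> u x + q \<bullet> (y - x) + ((y - x) \<bullet> (A *v (y - x))) / 2) \<longrightarrow> A \<in> F)"

lemma quad_subD:
  assumes "quad_sub F X u" "x \<in> X" "sym_mat A" "r > 0"
    "\<And>y. y \<in> X \<Longrightarrow> dist x y < r \<Longrightarrow> u y \<le> u x + q \<bullet> (y - x) + ((y - x) \<bullet> (A *v (y - x))) / 2"
  shows "A \<in> F"
  using assms unfolding quad_sub_def by (meson IntD1 IntD2 mem_ball)

section \<open>Symmetric matrices and their quadratic forms\<close>

lemma sym_mat_add: "sym_mat A \<Longrightarrow> sym_mat B \<Longrightarrow> sym_mat (A + B)"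
  by (simp add: sym_mat_def transpose_def vec_eq_iff)

lemma sym_mat_diff: "sym_mat A \<Longrightarrow> sym_mat B \<Longrightarrow> sym_mat (A - B)"
  by (simp add: sym_mat_def transpose_def vec_eq_iff)

lemma sym_mat_uminus [simp]: "sym_mat (- A) \<longleftrightarrow> sym_mat A"
  by (simp add: sym_mat_def transpose_def vec_eq_iff)

lemma sym_mat_scaleR: "sym_mat A \<Longrightarrow> sym_mat (c *\<^sub>R A)"
  by (simp add: sym_mat_def transpose_def vec_eq_iff)

lemma sym_mat_id [simp]: "sym_mat (c *\<^sub>R mat 1)"
  by (simp add: sym_mat_def transpose_def mat_def vec_eq_iff)

lemma scaleR_mat_vec: "(c *\<^sub>R A) *v x = c *\<^sub>R (A *v (x :: real^'n))" for A :: "real^'n^'m"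
  by (simp add: scaleR_matrix_vector_assoc)

lemma quad_form_id [simp]: "v \<bullet> ((c *\<^sub>R mat 1) *v v) = c * (norm v)\<^sup>2" for v :: "real^'n"
  by (simp add: scaleR_mat_vec power2_norm_eq_inner)

lemma sym_mat_swap: "sym_mat A \<Longrightarrow> x \<bullet> (A *v y) = y \<bullet> (A *v x)" for A :: "real^'n^'n"
  by (metis dot_lmul_matrix inner_commute sym_mat_def transpose_matrix_vector)

lemma quad_form_add:
  assumes "sym_mat A"
  shows "(x + y) \<bullet> (A *v (x + y)) = x \<bullet> (A *v x) + 2 * (y \<bullet> (A *v x)) + y \<bullet> (A *v y)"
  using sym_mat_swap[OF assms, of x y]
  by (simp add: inner_add matrix_vector_right_distrib)

lemma norm_matrix_vector_le:
  fixes A :: "real^'n^'m"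
  shows "norm (A *v x) \<le> norm A * norm x"
proof -
  have "norm (A *v x) = L2_set (\<lambda>i. norm ((A *v x) $ i)) UNIV" by (simp add: norm_vec_def)
  also have "\<dots> \<le> L2_set (\<lambda>i. norm (A $ i) * norm x) UNIV"
    by (intro L2_set_mono) (auto simp: matrix_vector_mul_component Cauchy_Schwarz_ineq2)
  also have "\<dots> = norm A * norm x" by (simp add: norm_vec_def L2_set_left_distrib)
  finally show ?thesis .
qed

lemma abs_quad_form_le: "\<bar>v \<bullet> (A *v v)\<bar> \<le> norm A * (norm v)\<^sup>2" for A :: "real^'n^'n"
proof -
  have "\<bar>v \<bullet> (A *v v)\<bar> \<le> norm v * norm (A *v v)" by (rule Cauchy_Schwarz_ineq2)
  also have "\<dots> \<le> norm v * (norm A * norm v)" by (intro mult_left_mono norm_matrix_vector_le) auto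
  finally show ?thesis by (simp add: power2_eq_square mult_ac)
qed

text \<open>Every symmetric \<open>C\<close> within \<open>\<epsilon>\<close> of \<open>- B\<close>
  satisfies \<open>C - A \<ge> 0\<close>, because \<open>C - A = (C + B) - (A + B)\<close>.
  Positivity puts it into \<open>F\<close>, so \<open>- B\<close> would be interior.\<close>

lemma dual_gap:
  assumes F: "subequation F" and A: "A \<in> F" and B: "B \<in> dual_subeq F" and \<epsilon>: "\<epsilon> > 0"
    and neg: "\<And>v. v \<bullet> ((A + B) *v v) \<le> - \<epsilon> * (norm v)\<^sup>2"
  shows False
proof -
  have sA: "sym_mat A" using F A by (auto simp: subequation_def)
  have sB: "sym_mat B" "- B \<notin> sym_interior F" using B by (auto simp: dual_subeq_def)
  have "C \<in> F" if C: "sym_mat C" "dist C (- B) < \<epsilon>" for C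
  proof -
    have "0 \<le> v \<bullet> ((C - A) *v v)" for v
    proof -
      have "v \<bullet> ((C - A) *v v) = v \<bullet> ((C + B) *v v) - v \<bullet> ((A + B) *v v)"
        by (simp add: matrix_vector_mult_diff_rdistrib matrix_vector_mult_add_rdistrib inner_add inner_diff)
      moreover have "\<bar>v \<bullet> ((C + B) *v v)\<bar> \<le> \<epsilon> * (norm v)\<^sup>2"
        using abs_quad_form_le[of v "C + B"] C(2)
        by (smt (verit) dist_norm diff_minus_eq_add mult_right_mono zero_le_power2)
      ultimately show ?thesis using neg[of v] by simp
    qed
    then have "psd (C - A)" using C sA by (simp add: psd_def sym_mat_diff)
    then have "A + (C - A) \<in> F" using F A unfolding subequation_def by blast
    then show ?thesis by simp
  qed
  then have "- B \<in> sym_interior F" using sB \<epsilon> by (auto simp: sym_interior_def)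
  with sB show False by blast
qed

text \<open>Translation by \<open>y - x\<close> carries tests of the sup-convolution at
  \<open>x\<close> to tests of \<open>u\<close> at the maximising point \<open>y\<close>: moving
  both points together leaves the penalty unchanged.\<close>

lemma sup_conv_quad_test:
  fixes u :: "real^'n \<Rightarrow> real"
  assumes \<delta>: "\<delta> > 0" and C: "compact C" "C \<noteq> {}" and u: "usc_real C u" and sub: "quad_sub F X u"
    and X: "interior C \<subseteq> X"
    and y: "y \<in> interior C" "sup_conv \<delta> C u x = u y - (norm (x - y))\<^sup>2 / (2 * \<delta>)"
    and A: "sym_mat A" and r: "r > 0"
    and touch: "\<And>k. norm k < r \<Longrightarrow>
        sup_conv \<delta> C u (x + k) \<le> sup_conv \<delta> C u x + q \<bullet> k + (k \<bullet> (A *v k)) / 2"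
  shows "A \<in> F"
proof -
  obtain s where s: "s > 0" "ball y s \<subseteq> C" using y(1) by (meson mem_interior)
  show ?thesis
  proof (rule quad_subD[OF sub _ A, of y "min r s" q])
    show "y \<in> X" using X y(1) by blast
    show "min r s > 0" using r s by simp
    fix z assume z: "dist y z < min r s"
    then have zC: "z \<in> C" using s by auto
    have "u z - (norm (x - y))\<^sup>2 / (2 * \<delta>) \<le> sup_conv \<delta> C u (x + (z - y))"
      using sup_conv_ge[OF \<delta> C u zC, of "x + (z - y)"] by (simp add: algebra_simps)
    also have "\<dots> \<le> sup_conv \<delta> C u x + q \<bullet> (z - y) + ((z - y) \<bullet> (A *v (z - y))) / 2"
      using z by (intro touch) (simp add: dist_norm norm_minus_commute)
    finally show "u z \<le> u y + q \<bullet> (z - y) + ((z - y) \<bullet> (A *v (z - y))) / 2" using y(2) by simp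
  qed
qed

text \<open>Dividing by \<open>r\<^sup>2\<close> compensates the change of scale in second
  derivatives, so the matrix found in blown-up coordinates is also the one that tests
  \<open>U\<close>; only the slope changes.\<close>

lemma rescaled_quad_touch:
  fixes U :: "real^'n \<Rightarrow> real"
  assumes r: "r > 0" and A: "sym_mat A" and y1: "norm y1 < 1"
    and max: "\<And>z. z \<in> cball 0 1 \<Longrightarrow>
        U (x + r *\<^sub>R z) / r\<^sup>2 - (q \<bullet> z + (z \<bullet> (A *v z)) / 2) \<le> U (x + r *\<^sub>R y1) / r\<^sup>2 - (q \<bullet> y1 + (y1 \<bullet> (A *v y1)) / 2)"
    and k: "norm k < r * (1 - norm y1)"
  shows "U (x + r *\<^sub>R y1 + k) \<le> U (x + r *\<^sub>R y1) + (r *\<^sub>R (q + A *v y1)) \<bullet> k + (k \<bullet> (A *v k)) / 2"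
proof -
  define z where "z = y1 + (1 / r) *\<^sub>R k"
  have "norm z \<le> norm y1 + norm k / r"
    unfolding z_def using r by (intro order_trans[OF norm_triangle_ineq]) simp
  also have "\<dots> \<le> 1" using k r by (simp add: field_simps)
  finally have z: "z \<in> cball 0 1" by simp
  have xz: "x + r *\<^sub>R z = x + r *\<^sub>R y1 + k" using r by (simp add: z_def algebra_simps)
  have zz: "z \<bullet> (A *v z) = y1 \<bullet> (A *v y1) + 2 * ((k \<bullet> (A *v y1)) / r) + (k \<bullet> (A *v k)) / r\<^sup>2"
    unfolding z_def quad_form_add[OF A] by (simp add: matrix_vector_mult_scaleR power2_eq_square)
  have qz: "q \<bullet> z = q \<bullet> y1 + (q \<bullet> k) / r" by (simp add: z_def inner_add)
  have lin: "U1 - (a + b + (c + 2 * d + e) / 2) \<le> U0 - (a + c / 2) \<Longrightarrow> U1 \<le> U0 + b + d + e / 2"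
    for U1 U0 a b c d e :: real by (simp add: field_simps)
  have "U (x + r *\<^sub>R y1 + k) / r\<^sup>2 \<le> U (x + r *\<^sub>R y1) / r\<^sup>2 + (q \<bullet> k) / r + (k \<bullet> (A *v y1)) / r + (k \<bullet> (A *v k)) / r\<^sup>2 / 2"
    using max[OF z] unfolding xz qz zz by (rule lin)
  then have "U (x + r *\<^sub>R y1 + k) / r\<^sup>2 * r\<^sup>2 \<le> (U (x + r *\<^sub>R y1) / r\<^sup>2 + (q \<bullet> k) / r + (k \<bullet> (A *v y1)) / r + (k \<bullet> (A *v k)) / r\<^sup>2 / 2) * r\<^sup>2"
    by (rule mult_right_mono) simp
  moreover have "a / r * r\<^sup>2 = r * a" "a / r\<^sup>2 * r\<^sup>2 = a" "a / r\<^sup>2 / 2 * r\<^sup>2 = a / 2" for a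
    using r by (simp_all add: power2_eq_square)
  ultimately have "U (x + r *\<^sub>R y1 + k) \<le> U (x + r *\<^sub>R y1) + r * (q \<bullet> k) + r * (k \<bullet> (A *v y1)) + (k \<bullet> (A *v k)) / 2"
    by (simp only: distrib_right)
  then show ?thesis by (simp add: inner_add inner_commute distrib_left)
qed

lemma self_adjoint_matrix:
  fixes T :: "real^'n \<Rightarrow> real^'n"
  assumes "self_adjoint T"
  obtains A where "sym_mat A" "\<And>x. T x = A *v x"
proof -
  have lin: "linear T" and sa: "\<And>x y. T x \<bullet> y = x \<bullet> T y" using assms by (auto simp: self_adjoint_def)
  define A where "A = matrix T"
  have TA: "T x = A *v x" for x using lin by (simp add: A_def matrix_vector_mul)
  have "A $ i $ j = A $ j $ i" for i j
    using sa[of "axis i 1" "axis j 1"] unfolding TA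
    by (simp add: inner_axis inner_axis' matrix_vector_mult_basis column_def)
  then have "sym_mat A" by (simp add: sym_mat_def transpose_def vec_eq_iff)
  with TA that show ?thesis by blast
qed

text \<open>Only \<open>u\<close> needs a second-order expansion: at a contact point \<open>v\<close> is bounded above by a plane minus
  \<open>u\<close>, hence tested by the negative of the quadratic polynomial that approximates \<open>u\<close>.\<close>

lemma comparison_compact:
  fixes u v :: "real^'n \<Rightarrow> real"
  assumes F: "subequation F" and C: "compact C"
    and u: "usc_real C u" "quad_sub F (interior C) u"
    and v: "usc_real C v" "quad_sub (dual_subeq F) (interior C) v"
    and bd: "\<And>x. x \<in> frontier C \<Longrightarrow> u x + v x \<le> m" and x0: "x0 \<in> interior C"
  shows "u x0 + v x0 \<le> m"
proof (rule ccontr)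
  assume "\<not> u x0 + v x0 \<le> m"
  then have gap: "u x0 + v x0 - m > 0" by simp
  \<comment> \<open>The excess \<open>3 * g\<close> is split in three: one part bounds
    \<open>w\<close> on \<open>C\<close>, one separates the level \<open>c = m + 2 * g\<close> from
    the frontier values, and one keeps \<open>W x0\<close> above \<open>c\<close>.\<close>
  define g where "g = (u x0 + v x0 - m) / 3"
  have g: "g > 0" "u x0 + v x0 = m + 3 * g" using gap by (simp_all add: g_def field_simps)
  have x0C: "x0 \<in> C" using x0 interior_subset by blast
  have neC: "C \<noteq> {}" using x0C by blast
  obtain D where D: "D > 0" "\<And>x. x \<in> C \<Longrightarrow> norm (x - x0) \<le> D"
  proof -
    obtain B where B: "\<And>x. x \<in> C \<Longrightarrow> norm x \<le> B"
      using compact_imp_bounded[OF C] unfolding bounded_iff by blast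
    have "norm (x - x0) \<le> \<bar>B\<bar> + norm x0 + 1" if "x \<in> C" for x
      using norm_triangle_ineq4[of x x0] B[OF that] by linarith
    then show ?thesis by (intro that[of "\<bar>B\<bar> + norm x0 + 1"]) (auto intro: add_nonneg_pos)
  qed
  \<comment> \<open>Chosen so that \<open>w\<close> is at most \<open>g\<close> on \<open>C\<close>.
    The Hessian \<open>2 * \<epsilon>\<close> of \<open>w\<close> is the source of strictness in the
    final matrix inequality.\<close>
  define \<epsilon> where "\<epsilon> = g / D\<^sup>2"
  have \<epsilon>: "\<epsilon> > 0" using g D by (simp add: \<epsilon>_def)
  define w where "w x = \<epsilon> * (norm (x - x0))\<^sup>2" for x
  have wD: "w x \<le> g" if "x \<in> C" for x
  proof -
    have "w x \<le> \<epsilon> * D\<^sup>2" unfolding w_def using D(2)[OF that] \<epsilon> by (intro mult_left_mono power_mono) auto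
    also have "\<dots> = g" using D by (simp add: \<epsilon>_def)
    finally show ?thesis .
  qed
  define c where "c = m + 2 * g"
  have frC: "frontier C \<subseteq> C" using C compact_imp_closed frontier_subset_closed by blast
  have "u x + v x + w x < c" if "x \<in> frontier C" for x
    using bd[OF that] wD[of x] frC that g unfolding c_def by force
  moreover have "continuous_on C w" unfolding w_def by (intro continuous_intros)
  ultimately obtain \<delta> where \<delta>: "\<delta> > 0" and \<delta>C: "\<And>x y z. x \<in> C \<Longrightarrow> y \<in> C \<Longrightarrow> z \<in> C \<Longrightarrow>
     u y + v z + w x - ((norm (x - y))\<^sup>2 + (norm (x - z))\<^sup>2) / (2 * \<delta>) \<ge> c \<Longrightarrow>
       x \<notin> frontier C \<and> y \<notin> frontier C \<and> z \<notin> frontier C"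
    using doubling_localized[OF C frontier_closed frC u(1) v(1), of w c] by blast
  define U where "U = sup_conv \<delta> C u"
  define V where "V = sup_conv \<delta> C v"
  define W where "W x = U x + V x + w x" for x
  have contU: "continuous_on UNIV U" and contV: "continuous_on UNIV V"
    unfolding U_def V_def by (rule continuous_sup_conv[OF \<delta> C neC] , fact)+
  have contW: "continuous_on UNIV W" unfolding W_def w_def by (intro continuous_intros contU contV)
  have Uat: "\<exists>y\<in>C. U x = u y - (norm (x - y))\<^sup>2 / (2 * \<delta>)" for x
    unfolding U_def using sup_conv_attained[OF \<delta> C neC u(1), of x] by metis
  have Vat: "\<exists>y\<in>C. V x = v y - (norm (x - y))\<^sup>2 / (2 * \<delta>)" for x
    unfolding V_def using sup_conv_attained[OF \<delta> C neC v(1), of x] by metis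
  have int: "x \<in> interior C" if "x \<in> C" "x \<notin> frontier C" for x
    using that closure_subset by (auto simp: frontier_def)
  have loc: "x \<in> interior C \<and> (\<exists>y\<in>interior C. U x = u y - (norm (x - y))\<^sup>2 / (2 * \<delta>))
      \<and> (\<exists>z\<in>interior C. V x = v z - (norm (x - z))\<^sup>2 / (2 * \<delta>))" if x: "x \<in> C" "W x \<ge> c" for x
  proof -
    obtain y where y: "y \<in> C" "U x = u y - (norm (x - y))\<^sup>2 / (2 * \<delta>)" using Uat by blast
    obtain z where z: "z \<in> C" "V x = v z - (norm (x - z))\<^sup>2 / (2 * \<delta>)" using Vat by blast
    have "u y + v z + w x - ((norm (x - y))\<^sup>2 + (norm (x - z))\<^sup>2) / (2 * \<delta>) \<ge> c"
      using x(2) unfolding W_def y z by (simp add: add_divide_distrib)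
    from \<delta>C[OF x(1) y(1) z(1) this] show ?thesis using int x(1) y z by blast
  qed
  have Wx0: "W x0 \<ge> c + g"
    using sup_conv_ge[OF \<delta> C neC u(1) x0C, of x0] sup_conv_ge[OF \<delta> C neC v(1) x0C, of x0] g
    by (simp add: W_def U_def V_def w_def c_def)
  \<comment> \<open>A plane of slope at most \<open>\<rho>\<close> varies by at most
    \<open>g / 2\<close> between \<open>x0\<close> and a point of \<open>C\<close>, so contact
    points stay above the level \<open>c\<close>.\<close>
  define \<rho> where "\<rho> = g / (2 * D)"
  have \<rho>: "\<rho> > 0" using g D by (simp add: \<rho>_def)
  define K where "K = {x \<in> C. \<exists>p\<in>cball 0 \<rho>. \<forall>y\<in>C. W y \<le> W x + p \<bullet> (y - x)}"
  have KW: "W x > c" if xK: "x \<in> K" for x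
  proof -
    obtain p where p: "norm p \<le> \<rho>" "W x0 \<le> W x + p \<bullet> (x0 - x)" and xC: "x \<in> C"
      using xK x0C unfolding K_def by auto
    have "p \<bullet> (x0 - x) \<le> norm p * norm (x0 - x)" by (rule norm_cauchy_schwarz)
    also have "\<dots> \<le> \<rho> * D" using p(1) D(2)[OF xC] \<rho> by (intro mult_mono) (auto simp: norm_minus_commute)
    also have "\<dots> = g / 2" using D by (simp add: \<rho>_def)
    finally show ?thesis using p(2) Wx0 g by linarith
  qed
  \<comment> \<open>Here, by \<open>loc\<close>, both sup-convolutions have maximising points in the
    interior of \<open>C\<close>, so they may be tested.\<close>
  define Op where "Op = interior C \<inter> {x. W x > c}"
  have opO: "open Op" unfolding Op_def
    by (intro open_Int open_interior open_Collect_less contW continuous_on_const)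
  have KC: "K \<subseteq> C" by (auto simp: K_def)
  have KO: "K \<subseteq> Op"
  proof
    fix x assume xK: "x \<in> K"
    then show "x \<in> Op" using loc[of x] KW[OF xK] KC by (auto simp: Op_def)
  qed
  \<comment> \<open>Each sup-convolution contributes \<open>1 / \<delta>\<close>. The value also
    covers the jets of \<open>U\<close>, whose constant is
    \<open>1 / \<delta> + 1 / (2 * \<delta>)\<close>.\<close>
  define \<Lambda> where "\<Lambda> = 2 / \<delta>"
  have \<Lambda>: "\<Lambda> > 0" using \<delta> by (simp add: \<Lambda>_def)
  have sdw: "second_diff w x h = 2 * \<epsilon> * (norm h)\<^sup>2" for x h
    by (simp add: second_diff_def w_def power2_norm_eq_inner inner_add inner_diff inner_commute algebra_simps)
  have sdU: "second_diff U x h \<ge> - (1 / \<delta>) * (norm h)\<^sup>2" for x h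
    unfolding U_def by (rule second_diff_sup_conv[OF \<delta> C neC u(1)])
  have sdV: "second_diff V x h \<ge> - (1 / \<delta>) * (norm h)\<^sup>2" for x h
    unfolding V_def by (rule second_diff_sup_conv[OF \<delta> C neC v(1)])
  have sdWsum: "second_diff W x h = second_diff U x h + second_diff V x h + 2 * \<epsilon> * (norm h)\<^sup>2" for x h
    unfolding sdw[of x h, symmetric] by (simp add: second_diff_def W_def)
  have eh: "0 \<le> 2 * \<epsilon> * (norm h)\<^sup>2" for h :: "real^'n" using \<epsilon> by simp
  have sdW: "second_diff W x h \<ge> - \<Lambda> * (norm h)\<^sup>2" for x h
    using sdU[where x=x and h=h] sdV[where x=x and h=h] eh[of h]
    unfolding sdWsum \<Lambda>_def by (simp add: field_simps)
  have compK: "compact K" by (rule contact_set_compact[OF C contW K_def])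
  obtain \<tau> where \<tau>: "\<tau> > 0" and \<tau>O: "\<And>x. x \<in> K \<Longrightarrow> ball x \<tau> \<subseteq> Op"
    using compact_subset_open_imp_ball_epsilon_subset[OF compK opO KO] by (metis UN_subset_iff)
  have OpC: "Op \<subseteq> interior C" by (auto simp: Op_def)
  have \<tau>C: "ball x \<tau> \<subseteq> C" if "x \<in> K" for x
    using \<tau>O[OF that] OpC interior_subset by blast
  have nonneg: "\<not> negligible K"
    by (rule contact_set_not_negligible[OF C neC contW \<Lambda> sdW \<rho> \<tau> K_def \<tau>C])
  interpret second_order_contact U K \<Lambda> \<tau>
  proof
    show "\<Lambda> \<ge> 0" "\<tau> > 0" "continuous_on UNIV U" using \<Lambda> \<tau> contU by auto
    show "- \<Lambda> * (norm h)\<^sup>2 \<le> second_diff U y h" for y h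
    proof -
      have "(1 / \<delta>) * (norm h)\<^sup>2 \<le> \<Lambda> * (norm h)\<^sup>2"
        using \<delta> by (intro mult_right_mono) (auto simp: \<Lambda>_def field_simps)
      then show ?thesis using sdU[where x=y and h=h] by simp
    qed
    show "\<exists>x\<in>K. \<exists>r. 0 < r \<and> r < \<eta> \<and> (\<forall>y\<in>cball x r. \<exists>z\<in>K. dist y z \<le> \<eta> * r)" if "0 < \<eta>" for \<eta>
      by (rule nonporous_of_not_negligible[OF compK nonneg that])
    \<comment> \<open>The lower half is \<open>sup_conv_jet\<close>. The upper half holds at contact
      points because \<open>W\<close> has nonpositive second differences there while those of
      \<open>V\<close> and \<open>w\<close> are bounded below.\<close>
    show "\<exists>q. \<forall>h. norm h < \<tau> \<longrightarrow> \<bar>U (x + h) - U x - q \<bullet> h\<bar> \<le> \<Lambda> * (norm h)\<^sup>2" if x: "x \<in> K" for x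
    proof -
      obtain q where q: "\<And>h. U (x + h) \<ge> U x + q \<bullet> h - (norm h)\<^sup>2 / (2 * \<delta>)"
        unfolding U_def using sup_conv_jet[OF \<delta> C neC u(1), of x] by blast
      obtain p where p: "\<And>y. y \<in> C \<Longrightarrow> W y \<le> W x + p \<bullet> (y - x)" using x unfolding K_def by blast
      have "\<bar>U (x + h) - U x - q \<bullet> h\<bar> \<le> \<Lambda> * (norm h)\<^sup>2" if h: "norm h < \<tau>" for h
      proof -
        have "x + h \<in> ball x \<tau>" "x - h \<in> ball x \<tau>" using h by (auto simp: dist_norm)
        then have "x + h \<in> C" "x - h \<in> C" using \<tau>C[OF x] by auto
        from p[OF this(1)] p[OF this(2)] have "second_diff W x h \<le> 0"
          by (simp add: second_diff_def)
        then have "second_diff U x h \<le> (1 / \<delta>) * (norm h)\<^sup>2"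
          using sdWsum[of x h] sdV[where x=x and h=h] eh[of h] by linarith
        then have "U (x + h) - U x - q \<bullet> h \<le> (1 / \<delta>) * (norm h)\<^sup>2 + (norm h)\<^sup>2 / (2 * \<delta>)"
          using q[of "-h"] by (simp add: second_diff_def)
        moreover have "U (x + h) - U x - q \<bullet> h \<ge> - ((norm h)\<^sup>2 / (2 * \<delta>))" using q[of h] by simp
        moreover have "(1 / \<delta>) * (norm h)\<^sup>2 + (norm h)\<^sup>2 / (2 * \<delta>) \<le> \<Lambda> * (norm h)\<^sup>2"
          "(norm h)\<^sup>2 / (2 * \<delta>) \<le> \<Lambda> * (norm h)\<^sup>2"
          using \<delta> by (simp_all add: \<Lambda>_def field_simps)
        ultimately show ?thesis by linarith
      qed
      then show ?thesis by blast
    qed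
  qed
  \<comment> \<open>The first bound makes \<open>2 * \<eta>\<close> less than
    \<open>s = \<epsilon> / 4\<close>, as \<open>cball_interior_max\<close> requires; the second
    keeps the unit window at scale \<open>r\<close> inside \<open>Op\<close>.\<close>
  define \<eta> where "\<eta> = min (\<epsilon> / 16) \<tau>"
  have \<eta>: "\<eta> > 0" "\<eta> \<le> \<epsilon> / 16" "\<eta> \<le> \<tau>" using \<epsilon> \<tau> by (auto simp: \<eta>_def)
  obtain x r T c1 q1 where x: "x \<in> K" and r: "0 < r" "r < \<eta>" and T: "self_adjoint T" and
    approx: "\<And>y. y \<in> cball 0 1 \<Longrightarrow> \<bar>U (x + r *\<^sub>R y) / r\<^sup>2 - c1 - q1 \<bullet> y - (y \<bullet> T y) / 2\<bar> \<le> \<eta>"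
    using coarse_second_order[OF \<eta>(1)] by blast
  obtain A where A: "sym_mat A" "\<And>x. T x = A *v x" by (rule self_adjoint_matrix[OF T]) (rule that)
  define Q where "Q y = q1 \<bullet> y + (y \<bullet> (A *v y)) / 2" for y
  have ap: "\<bar>U (x + r *\<^sub>R y) / r\<^sup>2 - c1 - Q y\<bar> \<le> \<eta>" if "y \<in> cball 0 1" for y
    using approx[OF that] unfolding A Q_def by (simp add: algebra_simps)
  have Q0: "Q 0 = 0" by (simp add: Q_def)
  have contQ: "continuous_on UNIV Q"
    unfolding Q_def by (intro continuous_intros linear_continuous_on) auto
  have inOp: "x + r *\<^sub>R y \<in> Op" if "norm y < 1" for y
  proof -
    have "norm (r *\<^sub>R y) < r * 1" using r that by simp
    then have "norm (r *\<^sub>R y) < \<tau>" using r \<eta> by linarith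
    then have "x + r *\<^sub>R y \<in> ball x \<tau>" by (simp add: dist_norm)
    then show ?thesis using \<tau>O[OF x] by blast
  qed
  \<comment> \<open>The slack \<open>2 * s\<close> is spent once on \<open>A\<close> and once on
    \<open>B\<close>; with \<open>s = \<epsilon> / 4\<close> half of the gap
    \<open>2 * \<epsilon>\<close> remains.\<close>
  define s where "s = \<epsilon> / 4"
  have s2: "s > 2 * \<eta>" using \<eta> \<epsilon> by (simp add: s_def)
  have contr: "continuous_on (cball 0 1) (\<lambda>y. f (x + r *\<^sub>R y) / r\<^sup>2)" if "continuous_on UNIV f"
    for f :: "real^'n \<Rightarrow> real"
    unfolding divide_inverse by (intro continuous_intros continuous_on_compose2[OF that]) auto
  have 0: "(0::real^'n) \<in> cball 0 1" by simp
  have AF: "A + (2 * s) *\<^sub>R mat 1 \<in> F"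
  proof -
    define G where "G y = U (x + r *\<^sub>R y) / r\<^sup>2 - c1 - Q y - s * (norm y)\<^sup>2" for y
    have contG: "continuous_on (cball 0 1) G" unfolding G_def
      by (intro continuous_intros contr contU continuous_on_subset[OF contQ]) auto
    have G0: "G 0 \<ge> - \<eta>" using ap[OF 0] by (simp add: G_def)
    have G1: "G y \<le> \<eta> - s" if "norm y = 1" for y
      using ap[of y] that by (simp add: G_def)
    obtain y1 where y1: "norm y1 < 1" "\<And>z. z \<in> cball 0 1 \<Longrightarrow> G z \<le> G y1"
      using cball_interior_max[OF contG s2 G0 G1] by blast
    have sym: "sym_mat (A + (2 * s) *\<^sub>R mat 1)" using A by (simp add: sym_mat_add)
    have Geq: "G y = U (x + r *\<^sub>R y) / r\<^sup>2 - (q1 \<bullet> y + (y \<bullet> ((A + (2 * s) *\<^sub>R mat 1) *v y)) / 2) - c1" for y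
      by (simp add: G_def Q_def matrix_vector_mult_add_rdistrib inner_add add_divide_distrib)
    have mx: "U (x + r *\<^sub>R z) / r\<^sup>2 - (q1 \<bullet> z + (z \<bullet> ((A + (2 * s) *\<^sub>R mat 1) *v z)) / 2)
      \<le> U (x + r *\<^sub>R y1) / r\<^sup>2 - (q1 \<bullet> y1 + (y1 \<bullet> ((A + (2 * s) *\<^sub>R mat 1) *v y1)) / 2)"
      if "z \<in> cball 0 1" for z
      using y1(2)[OF that] unfolding Geq by simp
    have "x + r *\<^sub>R y1 \<in> C" "W (x + r *\<^sub>R y1) \<ge> c"
      using inOp[OF y1(1)] interior_subset unfolding Op_def by auto
    then obtain y where y: "y \<in> interior C" "U (x + r *\<^sub>R y1) = u y - (norm (x + r *\<^sub>R y1 - y))\<^sup>2 / (2 * \<delta>)"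
      using loc by blast
    show ?thesis
      by (rule sup_conv_quad_test[OF \<delta> C neC u order_refl y(1) y(2)[unfolded U_def] sym
            _ rescaled_quad_touch[OF r(1) sym y1(1) mx, unfolded U_def]])
        (use r y1 in auto)
  qed
  \<comment> \<open>The plane above \<open>W\<close> gives
    \<open>V \<le> affine - U - \<epsilon> (norm y)\<^sup>2\<close> in blown-up coordinates.
    Replacing \<open>U\<close> by its approximate quadratic leaves the matrix
    \<open>- A - 2 * \<epsilon>\<close>, relaxed by \<open>2 * s\<close> to absorb the
    error.\<close>
  define B where "B = - A + (- 2 * (\<epsilon> - s)) *\<^sub>R mat 1"
  have BF: "B \<in> dual_subeq F"
  proof -
    obtain p where p: "\<And>y. y \<in> C \<Longrightarrow> W y \<le> W x + p \<bullet> (y - x)" using x unfolding K_def by blast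
    define b where "b = (1 / r) *\<^sub>R p - (2 * \<epsilon> / r) *\<^sub>R (x - x0)"
    define a where "a = (U x + V x) / r\<^sup>2"
    have Vle: "V (x + r *\<^sub>R y) / r\<^sup>2 \<le> a + b \<bullet> y - U (x + r *\<^sub>R y) / r\<^sup>2 - \<epsilon> * (norm y)\<^sup>2" if "y \<in> cball 0 1" for y
    proof -
      have "norm (r *\<^sub>R y) \<le> r * 1" using that r by simp
      then have "norm (r *\<^sub>R y) < \<tau>" using r \<eta> by linarith
    then have "x + r *\<^sub>R y \<in> ball x \<tau>" by (simp add: dist_norm)
      then have "x + r *\<^sub>R y \<in> C" using \<tau>C[OF x] by blast
      from p[OF this] have "W (x + r *\<^sub>R y) \<le> W x + r * (p \<bullet> y)" by simp
      moreover have "w (x + r *\<^sub>R y) = w x + 2 * \<epsilon> * r * ((x - x0) \<bullet> y) + \<epsilon> * r\<^sup>2 * (norm y)\<^sup>2"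
        by (simp add: w_def power2_norm_eq_inner inner_add inner_diff inner_commute power2_eq_square[of r] algebra_simps)
      ultimately have "V (x + r *\<^sub>R y) \<le> (U x + V x) + (r * (p \<bullet> y) - 2 * \<epsilon> * r * ((x - x0) \<bullet> y)) - U (x + r *\<^sub>R y) - \<epsilon> * r\<^sup>2 * (norm y)\<^sup>2"
        unfolding W_def by linarith
      then have "V (x + r *\<^sub>R y) / r\<^sup>2 \<le> ((U x + V x) + (r * (p \<bullet> y) - 2 * \<epsilon> * r * ((x - x0) \<bullet> y)) - U (x + r *\<^sub>R y) - \<epsilon> * r\<^sup>2 * (norm y)\<^sup>2) / r\<^sup>2"
        by (rule divide_right_mono) simp
      also have "\<dots> = a + (r * (p \<bullet> y) - 2 * \<epsilon> * r * ((x - x0) \<bullet> y)) / r\<^sup>2 - U (x + r *\<^sub>R y) / r\<^sup>2 - \<epsilon> * (norm y)\<^sup>2"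
        using r by (simp add: a_def add_divide_distrib diff_divide_distrib)
      also have "(r * (p \<bullet> y) - 2 * \<epsilon> * r * ((x - x0) \<bullet> y)) / r\<^sup>2 = b \<bullet> y"
        unfolding b_def inner_diff_left[of "(1 / r) *\<^sub>R p"] inner_scaleR_left using r
        by (simp add: diff_divide_distrib power2_eq_square)
      finally show ?thesis .
    qed
    define G where "G y = V (x + r *\<^sub>R y) / r\<^sup>2 - (a - c1) - b \<bullet> y + Q y + (\<epsilon> - s) * (norm y)\<^sup>2" for y
    have contG: "continuous_on (cball 0 1) G" unfolding G_def
      by (intro continuous_intros contr contV continuous_on_subset[OF contQ]) auto
    have G0: "G 0 \<ge> - \<eta>"
      using ap[OF 0] unfolding G_def a_def Q0 by (simp add: Q0 add_divide_distrib)
    have G1: "G y \<le> \<eta> - s" if "norm y = 1" for y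
    proof -
      have y: "y \<in> cball 0 1" using that by simp
      show ?thesis using ap[OF y] Vle[OF y] that unfolding G_def by (simp add: algebra_simps)
    qed
    obtain y1 where y1: "norm y1 < 1" "\<And>z. z \<in> cball 0 1 \<Longrightarrow> G z \<le> G y1"
      using cball_interior_max[OF contG s2 G0 G1] by blast
    have sym: "sym_mat B" unfolding B_def using A(1) by (intro sym_mat_add) simp_all
    have Geq: "G y = V (x + r *\<^sub>R y) / r\<^sup>2 - ((b - q1) \<bullet> y + (y \<bullet> (B *v y)) / 2) - (a - c1)" for y
    proof -
      have "y \<bullet> (B *v y) = - (y \<bullet> (A *v y)) - 2 * (\<epsilon> - s) * (norm y)\<^sup>2"
        unfolding B_def matrix_vector_mult_add_rdistrib inner_add_right quad_form_id
        by (simp add: scaleR_mat_vec[of "-1", simplified] algebra_simps)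
      then show ?thesis by (simp add: G_def Q_def inner_diff_left algebra_simps)
    qed
    have mx: "V (x + r *\<^sub>R z) / r\<^sup>2 - ((b - q1) \<bullet> z + (z \<bullet> (B *v z)) / 2)
      \<le> V (x + r *\<^sub>R y1) / r\<^sup>2 - ((b - q1) \<bullet> y1 + (y1 \<bullet> (B *v y1)) / 2)"
      if "z \<in> cball 0 1" for z
      using y1(2)[OF that] unfolding Geq by simp
    have "x + r *\<^sub>R y1 \<in> C" "W (x + r *\<^sub>R y1) \<ge> c"
      using inOp[OF y1(1)] interior_subset unfolding Op_def by auto
    then obtain y where y: "y \<in> interior C" "V (x + r *\<^sub>R y1) = v y - (norm (x + r *\<^sub>R y1 - y))\<^sup>2 / (2 * \<delta>)"
      using loc by blast
    show ?thesis
      by (rule sup_conv_quad_test[OF \<delta> C neC v order_refl y(1) y(2)[unfolded V_def] sym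
            _ rescaled_quad_touch[OF r(1) sym y1(1) mx, unfolded V_def]])
        (use r y1 in auto)
  qed
  show False
  proof (rule dual_gap[OF F AF BF \<epsilon>])
    fix y :: "real^'n"
    have "A + (2 * s) *\<^sub>R mat 1 + B = (- \<epsilon>) *\<^sub>R mat 1"
      unfolding B_def s_def by (simp add: algebra_simps flip: scaleR_add_left)
    then show "y \<bullet> ((A + (2 * s) *\<^sub>R mat 1 + B) *v y) \<le> - \<epsilon> * (norm y)\<^sup>2"
      by (simp only: quad_form_id)
  qed
qed

section \<open>Viscosity tests by quadratic polynomials\<close>

lemma usc_on_ereal_iff: "usc_on X (\<lambda>x. ereal (u x)) \<longleftrightarrow> usc_real X u"
proof
  assume L: "usc_on X (\<lambda>x. ereal (u x))"
  show "usc_real X u"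
    unfolding usc_real_def
  proof (intro ballI allI impI)
    fix x c assume x: "x \<in> X" "u x < c"
    have "\<forall>\<^sub>F y in at x within X. ereal (u y) < ereal c"
      using L[unfolded usc_on_def, rule_format, of x "ereal c"] x by simp
    then obtain d where d: "d > 0" "\<And>y. y \<in> X \<Longrightarrow> y \<noteq> x \<Longrightarrow> dist y x < d \<Longrightarrow> u y < c"
      unfolding eventually_at by auto
    then show "\<exists>d>0. \<forall>y\<in>X. dist y x < d \<longrightarrow> u y < c" using x(2) by metis
  qed
next
  assume R: "usc_real X u"
  show "usc_on X (\<lambda>x. ereal (u x))"
    unfolding usc_on_def
  proof (intro ballI allI impI)
    fix x c assume x: "x \<in> X" "ereal (u x) < c"
    show "\<forall>\<^sub>F y in at x within X. ereal (u y) < c"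
    proof (cases c)
      case (real r)
      then have "u x < r" using x by simp
      then obtain d where "d > 0" "\<forall>y\<in>X. dist y x < d \<longrightarrow> u y < r"
        using R x(1) unfolding usc_real_def by blast
      then show ?thesis unfolding real eventually_at by auto
    qed (use x in auto)
  qed
qed

lemma partial_deriv_eq:
  assumes "(f has_derivative f') (at y)" shows "partial_deriv i f y = f' (axis i 1)"
  using frechet_derivative_at[OF assms] by (simp add: partial_deriv_def)

text \<open>A quadratic polynomial is itself an admissible test function; the work is to compute its
  iterated partial derivatives.\<close>

lemma F_subharmonic_imp_quad_sub:
  fixes u :: "real^'n \<Rightarrow> real"
  assumes "F_subharmonic F X (\<lambda>x. ereal (u x))"
  shows "quad_sub F X u"
  unfolding quad_sub_def
proof (intro ballI allI impI)
  fix x q A assume x: "x \<in> X" and A: "sym_mat A" and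
    "\<exists>r>0. \<forall>y\<in>X \<inter> ball x r. u y \<le> u x + q \<bullet> (y - x) + ((y - x) \<bullet> (A *v (y - x))) / 2"
  then obtain r where r: "r > 0"
    "\<And>y. y \<in> X \<inter> ball x r \<Longrightarrow> u y \<le> u x + q \<bullet> (y - x) + ((y - x) \<bullet> (A *v (y - x))) / 2" by blast
  define \<phi> where "\<phi> y = u x + q \<bullet> (y - x) + ((y - x) \<bullet> (A *v (y - x))) / 2" for y
  have lin: "bounded_linear ((*v) A)" by simp
  have d1: "(\<phi> has_derivative (\<lambda>h. q \<bullet> h + (A *v (y - x)) \<bullet> h)) (at y)" for y
  proof -
    have "(\<phi> has_derivative (\<lambda>h. q \<bullet> h + ((y - x) \<bullet> (A *v h) + h \<bullet> (A *v (y - x))) / 2)) (at y)"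
      unfolding \<phi>_def divide_inverse
      by (auto intro!: derivative_eq_intros bounded_linear.has_derivative[OF lin])
    moreover have "((y - x) \<bullet> (A *v h) + h \<bullet> (A *v (y - x))) / 2 = (A *v (y - x)) \<bullet> h" for h
      using sym_mat_swap[OF A, of "y - x" h] by (simp add: inner_commute)
    ultimately show ?thesis by simp
  qed
  have p1: "partial_deriv i \<phi> = (\<lambda>y. q $ i + (A *v (y - x)) $ i)" for i
    by (rule ext) (simp add: partial_deriv_eq[OF d1] inner_axis)
  have d2: "((\<lambda>y. q $ i + (A *v (y - x)) $ i) has_derivative (\<lambda>h. (A *v h) $ i)) (at y)" for i y
    by (auto intro!: derivative_eq_intros bounded_linear.has_derivative[OF bounded_linear_vec_nth]
        bounded_linear.has_derivative[OF lin])
  have p2: "partial_deriv j (partial_deriv i \<phi>) = (\<lambda>y. A $ i $ j)" for i j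
    unfolding p1 by (rule ext) (simp add: partial_deriv_eq[OF d2] matrix_vector_mult_basis column_def)
  have cont1: "continuous_on UNIV \<phi>"
    by (rule differentiable_imp_continuous_on)
      (use d1 in \<open>auto simp: differentiable_on_def differentiable_def intro: has_derivative_at_withinI\<close>)
  have cont2: "continuous_on UNIV (partial_deriv i \<phi>)" for i
    unfolding p1 by (rule differentiable_imp_continuous_on)
      (use d2 in \<open>auto simp: differentiable_on_def differentiable_def intro: has_derivative_at_withinI\<close>)
  have "C_k_on 2 UNIV \<phi>"
    unfolding numeral_2_eq_2 C_k_on.simps
  proof (intro conjI ballI allI)
    show "\<phi> differentiable at y" for y using d1 by (auto simp: differentiable_def)
    show "partial_deriv i \<phi> differentiable at y" for i y
      using d2 unfolding p1 by (auto simp: differentiable_def)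
    show "continuous_on UNIV (partial_deriv j (partial_deriv i \<phi>))" for i j
      unfolding p2 by simp
  qed (use cont1 cont2 in auto)
  moreover have "hessian \<phi> x = A" by (simp add: hessian_def p2 vec_eq_iff)
  moreover have "\<exists>r>0. \<forall>y\<in>X \<inter> ball x r. ereal (u y) \<le> ereal (\<phi> y)"
    using r by (auto simp: \<phi>_def)
  moreover have "ereal (u x) = ereal (\<phi> x)" by (simp add: \<phi>_def)
  ultimately show "A \<in> F"
    using assms x unfolding F_subharmonic_def by (metis UNIV_I open_UNIV)
qed

text \<open>A test function seen only through its gradient near \<open>x1\<close> and the derivative
  of the gradient at the one point \<open>x1\<close>.\<close>

context
  fixes \<phi> :: "real^'n \<Rightarrow> real" and G :: "real^'n \<Rightarrow> real^'n" and H :: "real^'n^'n"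
    and x1 :: "real^'n" and U :: "(real^'n) set"
  assumes U: "open U" "x1 \<in> U"
    and dG: "\<And>y. y \<in> U \<Longrightarrow> (\<phi> has_derivative (\<lambda>h. G y \<bullet> h)) (at y)"
    and dH: "(G has_derivative (\<lambda>h. H *v h)) (at x1)"
begin

lemma gradient_expansion:
  assumes "\<epsilon> > 0"
  obtains r where "r > 0" "ball x1 r \<subseteq> U"
    "\<And>y. norm (y - x1) < r \<Longrightarrow> norm (G y - G x1 - H *v (y - x1)) \<le> \<epsilon> * norm (y - x1)"
proof -
  obtain d where d: "d > 0" "\<And>y. norm (y - x1) < d \<Longrightarrow> norm (G y - G x1 - H *v (y - x1)) \<le> \<epsilon> * norm (y - x1)"
    using dH assms unfolding has_derivative_at_alt by blast
  obtain e where e: "e > 0" "ball x1 e \<subseteq> U" using U open_contains_ball by blast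
  show ?thesis by (rule that[of "min d e"]) (use d e in auto)
qed

lemma has_derivative_along_line:
  assumes "a + s *\<^sub>R d \<in> U"
  shows "((\<lambda>s. \<phi> (a + s *\<^sub>R d)) has_real_derivative G (a + s *\<^sub>R d) \<bullet> d) (at s)"
proof -
  have "((\<lambda>s. a + s *\<^sub>R d) has_derivative (\<lambda>t. t *\<^sub>R d)) (at s)"
    by (auto intro!: derivative_eq_intros)
  from has_derivative_compose[OF this dG[OF assms]]
  show ?thesis by (simp add: has_field_derivative_def mult.commute[of _ "G (a + s *\<^sub>R d) \<bullet> d"])
qed

text \<open>As in the proof of Schwarz's theorem, the mixed difference is the increment of a
  function of one variable in the direction \<open>a\<close>. The mean value theorem reduces it to a
  difference of two gradients, which the derivative \<open>H\<close> at \<open>x1\<close> evaluates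
  up to a small error.\<close>

lemma mixed_difference_bound:
  assumes \<epsilon>: "\<epsilon> > 0"
  shows "\<exists>t0>0. \<forall>t. 0 < t \<longrightarrow> t < t0 \<longrightarrow>
    \<bar>\<phi> (x1 + t *\<^sub>R a + t *\<^sub>R b) - \<phi> (x1 + t *\<^sub>R a) - \<phi> (x1 + t *\<^sub>R b) + \<phi> x1 - t\<^sup>2 * ((H *v b) \<bullet> a)\<bar>
      \<le> \<epsilon> * t\<^sup>2"
proof -
  define N where "N = norm a + norm b + 1"
  have N: "N > 0" using norm_ge_zero[of a] norm_ge_zero[of b] unfolding N_def by linarith
  \<comment> \<open>There are two gradient errors of size \<open>e * (t * N)\<close>, each paired
    with \<open>a\<close>, whose norm is at most \<open>N\<close>.\<close>
  define e where "e = \<epsilon> / (2 * N * N)"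
  have e: "e > 0" using \<epsilon> N by (simp add: e_def)
  obtain r where r: "r > 0" "ball x1 r \<subseteq> U"
    "\<And>y. norm (y - x1) < r \<Longrightarrow> norm (G y - G x1 - H *v (y - x1)) \<le> e * norm (y - x1)"
    by (rule gradient_expansion[OF e]) (rule that)
  show ?thesis
  proof (intro exI[of _ "r / N"] conjI allI impI)
    show "r / N > 0" using r N by simp
    fix t assume t: "0 < t" "t < r / N"
    have tN: "t * N < r" using t N by (simp add: field_simps)
    have small: "norm (s *\<^sub>R (t *\<^sub>R a) + c *\<^sub>R (t *\<^sub>R b)) \<le> t * N" if "0 \<le> s" "s \<le> 1" "0 \<le> c" "c \<le> 1" for s c
    proof -
      have "norm (s *\<^sub>R (t *\<^sub>R a) + c *\<^sub>R (t *\<^sub>R b)) \<le> s * (t * norm a) + c * (t * norm b)"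
        using that t by (intro order_trans[OF norm_triangle_ineq]) simp
      also have "\<dots> \<le> 1 * (t * norm a) + 1 * (t * norm b)"
        using that t by (intro add_mono mult_right_mono) auto
      also have "\<dots> \<le> t * N" using t by (simp add: N_def distrib_left)
      finally show ?thesis .
    qed
    define f where "f s = \<phi> (x1 + t *\<^sub>R b + s *\<^sub>R (t *\<^sub>R a)) - \<phi> (x1 + s *\<^sub>R (t *\<^sub>R a))" for s
    have inball: "x1 + d \<in> ball x1 r" if "norm d < r" for d
      using that by (simp add: dist_norm)
    have inU: "x1 + t *\<^sub>R b + s *\<^sub>R (t *\<^sub>R a) \<in> U" "x1 + s *\<^sub>R (t *\<^sub>R a) \<in> U" if "0 \<le> s" "s \<le> 1" for s
    proof -
      have "norm (s *\<^sub>R (t *\<^sub>R a) + t *\<^sub>R b) < r" "norm (s *\<^sub>R (t *\<^sub>R a)) < r"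
        using small[of s 1] small[of s 0] that tN by simp_all
      then have "x1 + (s *\<^sub>R (t *\<^sub>R a) + t *\<^sub>R b) \<in> ball x1 r" "x1 + s *\<^sub>R (t *\<^sub>R a) \<in> ball x1 r"
        by (simp_all only: inball)
      then show "x1 + t *\<^sub>R b + s *\<^sub>R (t *\<^sub>R a) \<in> U" "x1 + s *\<^sub>R (t *\<^sub>R a) \<in> U"
        using r(2) by (auto simp: add_ac)
    qed
    have "\<exists>z>0. z < 1 \<and> f 1 - f 0 = (1 - 0) * (G (x1 + t *\<^sub>R b + z *\<^sub>R (t *\<^sub>R a)) \<bullet> (t *\<^sub>R a) - G (x1 + z *\<^sub>R (t *\<^sub>R a)) \<bullet> (t *\<^sub>R a))"
      by (rule MVT2) (auto simp only: f_def intro!: DERIV_diff has_derivative_along_line inU zero_less_one)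
    then obtain z where z: "0 < z" "z < 1" and fz: "f 1 - f 0 = t * ((G (x1 + t *\<^sub>R b + z *\<^sub>R (t *\<^sub>R a)) - G (x1 + z *\<^sub>R (t *\<^sub>R a))) \<bullet> a)"
      by (auto simp: inner_diff right_diff_distrib)
    define d1 where "d1 = z *\<^sub>R (t *\<^sub>R a) + t *\<^sub>R b"
    define d2 where "d2 = z *\<^sub>R (t *\<^sub>R a)"
    have nd: "norm d1 \<le> t * N" "norm d2 \<le> t * N" using small[of z 1] small[of z 0] z by (auto simp: d1_def d2_def)
    have pts: "x1 + t *\<^sub>R b + z *\<^sub>R (t *\<^sub>R a) = x1 + d1" "x1 + z *\<^sub>R (t *\<^sub>R a) = x1 + d2"
      by (simp_all add: d1_def d2_def)
    define E where "E d = G (x1 + d) - G x1 - H *v d" for d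
    have E: "norm (E d) \<le> e * (t * N)" if "norm d \<le> t * N" for d
    proof -
      have "norm (E d) \<le> e * norm d" using r(3)[of "x1 + d"] that tN by (simp add: E_def)
      also have "\<dots> \<le> e * (t * N)" using that e by (intro mult_left_mono) auto
      finally show ?thesis .
    qed
    have "G (x1 + d1) - G (x1 + d2) = t *\<^sub>R (H *v b) + (E d1 - E d2)"
    proof -
      have "d1 = d2 + t *\<^sub>R b" by (simp add: d1_def d2_def)
      then show ?thesis by (simp add: E_def matrix_vector_right_distrib matrix_vector_mult_scaleR)
    qed
    then have "f 1 - f 0 = t\<^sup>2 * ((H *v b) \<bullet> a) + t * ((E d1 - E d2) \<bullet> a)"
      unfolding fz pts by (simp add: inner_add power2_eq_square distrib_left)
    moreover have "f 1 - f 0 = \<phi> (x1 + t *\<^sub>R a + t *\<^sub>R b) - \<phi> (x1 + t *\<^sub>R a) - \<phi> (x1 + t *\<^sub>R b) + \<phi> x1"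
      by (simp add: f_def add_ac)
    ultimately have eq: "\<phi> (x1 + t *\<^sub>R a + t *\<^sub>R b) - \<phi> (x1 + t *\<^sub>R a) - \<phi> (x1 + t *\<^sub>R b) + \<phi> x1 - t\<^sup>2 * ((H *v b) \<bullet> a)
        = t * ((E d1 - E d2) \<bullet> a)" by simp
    have "\<bar>(E d1 - E d2) \<bullet> a\<bar> \<le> norm (E d1 - E d2) * norm a" by (rule Cauchy_Schwarz_ineq2)
    also have "\<dots> \<le> (2 * (e * (t * N))) * N"
    proof (rule mult_mono)
      show "norm (E d1 - E d2) \<le> 2 * (e * (t * N))"
        using norm_triangle_ineq4[of "E d1" "E d2"] E[OF nd(1)] E[OF nd(2)] by linarith
      show "norm a \<le> N" unfolding N_def by simp
    qed (use e t N in auto)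
    also have "\<dots> = \<epsilon> * t" using N by (simp add: e_def)
    finally have "t * \<bar>(E d1 - E d2) \<bullet> a\<bar> \<le> t * (\<epsilon> * t)" using t by (intro mult_left_mono) auto
    then show "\<bar>\<phi> (x1 + t *\<^sub>R a + t *\<^sub>R b) - \<phi> (x1 + t *\<^sub>R a) - \<phi> (x1 + t *\<^sub>R b) + \<phi> x1 - t\<^sup>2 * ((H *v b) \<bullet> a)\<bar>
      \<le> \<epsilon> * t\<^sup>2"
      unfolding eq using t by (simp add: abs_mult power2_eq_square mult_ac)
  qed
qed

text \<open>The mixed difference is symmetric in \<open>a\<close> and \<open>b\<close>, and hence so
  is its leading coefficient. Symmetry is required because \<open>quad_sub\<close> tests with
  symmetric matrices.\<close>

lemma hessian_symmetric: "sym_mat H"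
proof -
  have "(H *v b) \<bullet> a = (H *v a) \<bullet> b" for a b
  proof (rule ccontr)
    assume ne: "(H *v b) \<bullet> a \<noteq> (H *v a) \<bullet> b"
    define \<epsilon> where "\<epsilon> = \<bar>(H *v b) \<bullet> a - (H *v a) \<bullet> b\<bar> / 4"
    have \<epsilon>: "\<epsilon> > 0" using ne by (simp add: \<epsilon>_def)
    obtain t1 where t1: "t1 > 0" "\<And>t. 0 < t \<Longrightarrow> t < t1 \<Longrightarrow>
      \<bar>\<phi> (x1 + t *\<^sub>R a + t *\<^sub>R b) - \<phi> (x1 + t *\<^sub>R a) - \<phi> (x1 + t *\<^sub>R b) + \<phi> x1 - t\<^sup>2 * ((H *v b) \<bullet> a)\<bar> \<le> \<epsilon> * t\<^sup>2"
      using mixed_difference_bound[OF \<epsilon>, of a b] by blast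
    obtain t2 where t2: "t2 > 0" "\<And>t. 0 < t \<Longrightarrow> t < t2 \<Longrightarrow>
      \<bar>\<phi> (x1 + t *\<^sub>R b + t *\<^sub>R a) - \<phi> (x1 + t *\<^sub>R b) - \<phi> (x1 + t *\<^sub>R a) + \<phi> x1 - t\<^sup>2 * ((H *v a) \<bullet> b)\<bar> \<le> \<epsilon> * t\<^sup>2"
      using mixed_difference_bound[OF \<epsilon>, of b a] by blast
    define t where "t = min t1 t2 / 2"
    have t: "0 < t" "t < t1" "t < t2" using t1(1) t2(1) by (auto simp: t_def)
    have sw: "x1 + t *\<^sub>R b + t *\<^sub>R a = x1 + t *\<^sub>R a + t *\<^sub>R b" by simp
    have "\<bar>t\<^sup>2 * ((H *v b) \<bullet> a) - t\<^sup>2 * ((H *v a) \<bullet> b)\<bar> \<le> \<epsilon> * t\<^sup>2 + \<epsilon> * t\<^sup>2"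
      using t1(2)[OF t(1,2)] t2(2)[OF t(1,3)] unfolding sw by linarith
    then have "t\<^sup>2 * \<bar>(H *v b) \<bullet> a - (H *v a) \<bullet> b\<bar> \<le> t\<^sup>2 * (2 * \<epsilon>)"
      by (simp only: right_diff_distrib[symmetric] abs_mult) (simp add: mult_ac)
    then have "\<bar>(H *v b) \<bullet> a - (H *v a) \<bullet> b\<bar> \<le> 2 * \<epsilon>" using t by simp
    then show False using \<epsilon> unfolding \<epsilon>_def by simp
  qed
  from this[of "axis j 1" "axis i 1" for i j] have "H $ i $ j = H $ j $ i" for i j
    by (simp add: inner_axis matrix_vector_mult_basis column_def)
  then show ?thesis by (simp add: sym_mat_def transpose_def vec_eq_iff)
qed

text \<open>The mean value theorem along the segment, applied to \<open>\<phi>\<close> minus its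
  Taylor polynomial: the derivative is the remainder that \<open>gradient_expansion\<close>
  controls.\<close>

lemma taylor_upper:
  assumes \<epsilon>: "\<epsilon> > 0"
  obtains r where "r > 0"
    "\<And>y. norm (y - x1) < r \<Longrightarrow> \<phi> y \<le> \<phi> x1 + G x1 \<bullet> (y - x1) + ((y - x1) \<bullet> (H *v (y - x1))) / 2 + \<epsilon> * (norm (y - x1))\<^sup>2"
proof -
  obtain r where r: "r > 0" "ball x1 r \<subseteq> U"
    "\<And>y. norm (y - x1) < r \<Longrightarrow> norm (G y - G x1 - H *v (y - x1)) \<le> \<epsilon> * norm (y - x1)"
    by (rule gradient_expansion[OF \<epsilon>]) (rule that)
  have "\<phi> y \<le> \<phi> x1 + G x1 \<bullet> (y - x1) + ((y - x1) \<bullet> (H *v (y - x1))) / 2 + \<epsilon> * (norm (y - x1))\<^sup>2"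
    if y: "norm (y - x1) < r" for y
  proof -
    define d where "d = y - x1"
    have nsd: "norm (s *\<^sub>R d) < r" if "0 \<le> s" "s \<le> 1" for s
      using y that mult_right_mono[of s 1 "norm d"] by (simp add: d_def)
    have inU: "x1 + s *\<^sub>R d \<in> U" if "0 \<le> s" "s \<le> 1" for s
    proof -
      have "x1 + s *\<^sub>R d \<in> ball x1 r" using nsd[OF that] by (simp add: dist_norm)
      then show ?thesis using r(2) by blast
    qed
    define f where "f s = \<phi> (x1 + s *\<^sub>R d) - s * (G x1 \<bullet> d) - s\<^sup>2 * ((d \<bullet> (H *v d)) / 2)" for s
    have "\<exists>z>0. z < 1 \<and> f 1 - f 0 = (1 - 0) * (G (x1 + z *\<^sub>R d) \<bullet> d - G x1 \<bullet> d - z * (d \<bullet> (H *v d)))"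
    proof (rule MVT2)
      fix s :: real assume s: "0 \<le> s" "s \<le> 1"
      show "(f has_real_derivative G (x1 + s *\<^sub>R d) \<bullet> d - G x1 \<bullet> d - s * (d \<bullet> (H *v d))) (at s)"
        unfolding f_def by (auto intro!: derivative_eq_intros has_derivative_along_line[OF inU[OF s]])
    qed simp
    then obtain z where z: "0 < z" "z < 1" and fz: "f 1 - f 0 = G (x1 + z *\<^sub>R d) \<bullet> d - G x1 \<bullet> d - z * (d \<bullet> (H *v d))"
      by auto
    have "f 1 - f 0 = (G (x1 + z *\<^sub>R d) - G x1 - H *v (z *\<^sub>R d)) \<bullet> d"
      unfolding fz by (simp add: inner_diff matrix_vector_mult_scaleR inner_commute)
    also have "\<dots> \<le> norm (G (x1 + z *\<^sub>R d) - G x1 - H *v (z *\<^sub>R d)) * norm d" by (rule norm_cauchy_schwarz)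
    also have "\<dots> \<le> (\<epsilon> * norm (z *\<^sub>R d)) * norm d"
      using r(3)[of "x1 + z *\<^sub>R d"] nsd[of z] z by (intro mult_right_mono) auto
    also have "\<dots> = z * (\<epsilon> * (norm d)\<^sup>2)" using z by (simp add: power2_eq_square)
    also have "\<dots> \<le> 1 * (\<epsilon> * (norm d)\<^sup>2)" using z \<epsilon> by (intro mult_right_mono) auto
    finally have "f 1 - f 0 \<le> \<epsilon> * (norm d)\<^sup>2" by simp
    moreover have "f 1 = \<phi> y - G x1 \<bullet> d - (d \<bullet> (H *v d)) / 2" "f 0 = \<phi> x1" by (simp_all add: f_def d_def)
    ultimately show ?thesis unfolding d_def by linarith
  qed
  with r(1) show ?thesis by (rule that)
qed

end

lemma C_2_derivatives:
  fixes \<phi> :: "real^'n \<Rightarrow> real"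
  assumes "C_k_on 2 U \<phi>" "x \<in> U"
  shows "(\<phi> has_derivative (\<lambda>h. gradient \<phi> x \<bullet> h)) (at x)"
    "(gradient \<phi> has_derivative (\<lambda>h. hessian \<phi> x *v h)) (at x)"
proof -
  have lin: "f' h = (\<chi> i. f' (axis i 1)) \<bullet> h" if "linear f'" for f' :: "real^'n \<Rightarrow> real" and h
  proof -
    have "f' h = f' (\<Sum>i\<in>UNIV. h $ i *\<^sub>R axis i 1)" by (simp add: basis_expansion scalar_mult_eq_scaleR[symmetric])
    also have "\<dots> = (\<Sum>i\<in>UNIV. h $ i * f' (axis i 1))" by (simp add: linear_sum[OF that] linear_cmul[OF that])
    finally show ?thesis by (simp add: inner_vec_def mult.commute)
  qed
  have rep: "(f has_derivative (\<lambda>h. (\<chi> i. partial_deriv i f x) \<bullet> h)) (at x)" if "f differentiable (at x)" for f :: "real^'n \<Rightarrow> real"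
  proof -
    have D: "(f has_derivative frechet_derivative f (at x)) (at x)" using that frechet_derivative_works by blast
    have "frechet_derivative f (at x) = (\<lambda>h. (\<chi> i. partial_deriv i f x) \<bullet> h)"
      unfolding partial_deriv_def by (rule ext, rule lin[OF has_derivative_linear[OF D]])
    then show ?thesis using D by simp
  qed
  have "\<phi> differentiable (at x)" and di: "\<And>i. partial_deriv i \<phi> differentiable (at x)"
    using assms by (auto simp: numeral_2_eq_2)
  from rep[OF this(1)] show "(\<phi> has_derivative (\<lambda>h. gradient \<phi> x \<bullet> h)) (at x)" by (simp add: gradient_def)
  show "(gradient \<phi> has_derivative (\<lambda>h. hessian \<phi> x *v h)) (at x)"
  proof (rule has_derivative_componentwise_within[THEN iffD2], rule ballI)
    fix b :: "real^'n" assume "b \<in> Basis"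
    then obtain i where b: "b = axis i 1" by (auto simp: Basis_vec_def)
    have "(\<chi> j. partial_deriv j (partial_deriv i \<phi>) x) \<bullet> h = (hessian \<phi> x *v h) $ i" for h
      by (simp add: hessian_def matrix_vector_mult_def inner_vec_def)
    then show "((\<lambda>x. gradient \<phi> x \<bullet> b) has_derivative (\<lambda>h. (hessian \<phi> x *v h) \<bullet> b)) (at x)"
      using rep[OF di[of i]] by (simp add: b inner_axis gradient_def)
  qed
qed

lemma subequation_perturb:
  assumes F: "subequation F" and A: "\<And>\<epsilon>. \<epsilon> > 0 \<Longrightarrow> A + (2 * \<epsilon>) *\<^sub>R mat 1 \<in> F"
  shows "A \<in> F"
proof -
  have cl: "closed F" using F by (simp add: subequation_def)
  have "(\<lambda>n. A + (2 * inverse (real (Suc n))) *\<^sub>R mat 1) \<longlonglongrightarrow> A + (2 * 0) *\<^sub>R mat 1"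
    by (intro tendsto_intros LIMSEQ_inverse_real_of_nat)
  then have "(\<lambda>n. A + (2 * inverse (real (Suc n))) *\<^sub>R mat 1) \<longlonglongrightarrow> A" by simp
  then show ?thesis
    by (rule closed_sequentially[OF cl, rotated]) (intro A, simp)
qed

text \<open>Near the point, a test function lies below its Taylor polynomial plus
  \<open>\<epsilon> (norm (y - x1))\<^sup>2\<close>, a quadratic test. Closedness of
  \<open>F\<close> removes the resulting shift of the Hessian.\<close>

lemma quad_sub_imp_F_subharmonic:
  fixes u :: "real^'n \<Rightarrow> real"
  assumes F: "subequation F" and usc: "usc_real X u" and sub: "quad_sub F X u"
  shows "F_subharmonic F X (\<lambda>x. ereal (u x))"
  unfolding F_subharmonic_def usc_on_ereal_iff
proof (intro conjI ballI allI impI usc)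
  fix x1 \<phi> U
  assume x1: "x1 \<in> X" and "open U \<and> x1 \<in> U \<and> C_k_on 2 U \<phi> \<and>
     (\<exists>r>0. \<forall>y\<in>X \<inter> ball x1 r. ereal (u y) \<le> ereal (\<phi> y)) \<and> ereal (u x1) = ereal (\<phi> x1)"
  then obtain r where U: "open U" "x1 \<in> U" and C2: "C_k_on 2 U \<phi>" and r: "r > 0"
    "\<And>y. y \<in> X \<inter> ball x1 r \<Longrightarrow> u y \<le> \<phi> y" and eq: "u x1 = \<phi> x1" by auto
  note D = U C_2_derivatives(1)[OF C2] C_2_derivatives(2)[OF C2 U(2)]
  have sym: "sym_mat (hessian \<phi> x1)" by (rule hessian_symmetric[OF D])
  have "hessian \<phi> x1 + (2 * \<epsilon>) *\<^sub>R mat 1 \<in> F" if \<epsilon>: "\<epsilon> > 0" for \<epsilon>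
  proof -
    obtain s where s: "s > 0" "\<And>y. norm (y - x1) < s \<Longrightarrow> \<phi> y \<le> \<phi> x1 + gradient \<phi> x1 \<bullet> (y - x1)
        + ((y - x1) \<bullet> (hessian \<phi> x1 *v (y - x1))) / 2 + \<epsilon> * (norm (y - x1))\<^sup>2"
      by (rule taylor_upper[OF D \<epsilon>]) (assumption, rule that)
    show ?thesis
    proof (rule quad_subD[OF sub x1, of _ "min r s" "gradient \<phi> x1"])
      show "sym_mat (hessian \<phi> x1 + (2 * \<epsilon>) *\<^sub>R mat 1)" using sym by (intro sym_mat_add) auto
      show "min r s > 0" using r s by simp
      fix y assume y: "y \<in> X" "dist x1 y < min r s"
      have "u y \<le> \<phi> y" using r(2)[of y] y by simp
      also have "\<phi> y \<le> \<phi> x1 + gradient \<phi> x1 \<bullet> (y - x1)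
        + ((y - x1) \<bullet> (hessian \<phi> x1 *v (y - x1))) / 2 + \<epsilon> * (norm (y - x1))\<^sup>2"
        using y by (intro s(2)) (simp add: dist_norm norm_minus_commute)
      finally show "u y \<le> u x1 + gradient \<phi> x1 \<bullet> (y - x1)
        + ((y - x1) \<bullet> ((hessian \<phi> x1 + (2 * \<epsilon>) *\<^sub>R mat 1) *v (y - x1))) / 2"
        unfolding eq matrix_vector_mult_add_rdistrib inner_add_right quad_form_id
        by (simp add: add_divide_distrib)
    qed
  qed
  then show "hessian \<phi> x1 \<in> F" by (rule subequation_perturb[OF F])
qed simp

section \<open>Perron's method\<close>

lemma quad_sub_mono:
  assumes sub: "quad_sub F X u" and Y: "open Y" "Y \<subseteq> X"
  shows "quad_sub F Y u"
  unfolding quad_sub_def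
proof (intro ballI allI impI)
  fix x q A assume x: "x \<in> Y" and A: "sym_mat A" and
    "\<exists>r>0. \<forall>y\<in>Y \<inter> ball x r. u y \<le> u x + q \<bullet> (y - x) + ((y - x) \<bullet> (A *v (y - x))) / 2"
  then obtain r where r: "r > 0"
    "\<And>y. y \<in> Y \<inter> ball x r \<Longrightarrow> u y \<le> u x + q \<bullet> (y - x) + ((y - x) \<bullet> (A *v (y - x))) / 2" by blast
  obtain s where s: "s > 0" "ball x s \<subseteq> Y" using Y(1) x open_contains_ball by blast
  show "A \<in> F"
    by (rule quad_subD[OF sub _ A, of x "min r s" q]) (use x Y r s in auto)
qed

lemma quad_sub_local:
  assumes "quad_sub F X u" "\<And>x. x \<in> X \<Longrightarrow> v x = u x"
  shows "quad_sub F X v"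
  using assms unfolding quad_sub_def by simp

text \<open>The continuous majorant \<open>G\<close> carries all information at the boundary and the
  poles. A superlevel set of \<open>G\<close> above \<open>m\<close> is compact inside the punctured
  domain, and comparison is applied on a neighbourhood of it.\<close>

lemma comparison_punctured:
  fixes u v :: "real^'n \<Rightarrow> real"
  assumes F: "subequation F" and \<Omega>: "open \<Omega>" "bounded \<Omega>" and P: "finite P" "P \<subseteq> \<Omega>"
    and u: "usc_real (\<Omega> - P) u" "quad_sub F (\<Omega> - P) u"
    and v: "usc_real (\<Omega> - P) v" "quad_sub (dual_subeq F) (\<Omega> - P) v"
    and G: "continuous_on (closure \<Omega> - P) G" and uvG: "\<And>x. x \<in> \<Omega> - P \<Longrightarrow> u x + v x \<le> G x"
    and Gfr: "\<And>x. x \<in> frontier \<Omega> \<Longrightarrow> G x \<le> m"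
    and GP: "\<And>p. p \<in> P \<Longrightarrow> \<exists>s>0. \<forall>x\<in>ball p s \<inter> \<Omega> - P. G x \<le> m"
    and x0: "x0 \<in> \<Omega> - P"
  shows "u x0 + v x0 \<le> m"
proof (rule ccontr)
  assume "\<not> u x0 + v x0 \<le> m"
  \<comment> \<open>Strictly above \<open>m\<close>, so that the set where \<open>G\<close> reaches
    \<open>m'\<close> stays away from the frontier and the punctures.\<close>
  define m' where "m' = (m + (u x0 + v x0)) / 2"
  have m': "m < m'" "m' < u x0 + v x0" using \<open>\<not> u x0 + v x0 \<le> m\<close> by (auto simp: m'_def)
  obtain s where s: "\<And>p. p \<in> P \<Longrightarrow> s p > 0" "\<And>p x. p \<in> P \<Longrightarrow> x \<in> ball p (s p) \<inter> \<Omega> - P \<Longrightarrow> G x \<le> m"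
    using GP by metis
  define S where "S = closure \<Omega> - (\<Union>p\<in>P. ball p (s p))"
  have compS: "compact S"
    unfolding S_def using \<Omega>(2) P(1) by (intro compact_diff) (auto simp: compact_closure)
  have SP: "S \<subseteq> closure \<Omega> - P" using s(1) by (force simp: S_def)
  define C0 where "C0 = {x \<in> S. m' \<le> G x}"
  have "C0 = S \<inter> G -` {m'..}" by (auto simp: C0_def)
  then have "closedin (top_of_set S) C0"
    using continuous_closedin_preimage[OF continuous_on_subset[OF G SP], of "{m'..}"] by simp
  then have compC0: "compact C0" using closedin_compact[OF compS] by blast
  have C0X: "C0 \<subseteq> \<Omega> - P"
  proof
    fix x assume x: "x \<in> C0"
    then have "x \<in> closure \<Omega>" "x \<notin> P" using SP by (auto simp: C0_def)
    moreover have "x \<notin> frontier \<Omega>" using Gfr[of x] x m' by (auto simp: C0_def)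
    ultimately show "x \<in> \<Omega> - P" using \<Omega>(1) by (auto simp: frontier_def interior_open)
  qed
  have opX: "open (\<Omega> - P)" using \<Omega>(1) P(1) by (simp add: finite_imp_closed open_Diff)
  have out: "u x + v x < m'" if x: "x \<in> \<Omega> - P" "x \<notin> C0" for x
  proof (cases "x \<in> S")
    case True
    then show ?thesis using x uvG[OF x(1)] by (auto simp: C0_def)
  next
    case False
    then obtain p where "p \<in> P" "x \<in> ball p (s p)" using x closure_subset[of \<Omega>] by (auto simp: S_def)
    then show ?thesis using s(2)[of p x] uvG[OF x(1)] x m' by auto
  qed
  have x0C: "x0 \<in> C0" using out[OF x0] m' by fastforce
  obtain e where e: "e > 0" "(\<Union>x\<in>C0. cball x e) \<subseteq> \<Omega> - P"
    using compact_subset_open_imp_cball_epsilon_subset[OF compC0 opX C0X] by blast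
  \<comment> \<open>The closed \<open>e\<close>-neighbourhood of \<open>C0\<close>, written as a sum
    of compact sets to obtain compactness; its frontier misses \<open>C0\<close>, where alone
    \<open>u + v\<close> can reach \<open>m'\<close>.\<close>
  define C where "C = (\<Union>x\<in>C0. \<Union>y\<in>cball 0 e. {x + y})"
  have compC: "compact C" unfolding C_def by (intro compact_sums' compC0 compact_cball)
  have Ceq: "C = (\<Union>x\<in>C0. cball x e)"
  proof (intro subset_antisym subsetI)
    fix z assume "z \<in> (\<Union>x\<in>C0. cball x e)"
    then obtain x where "x \<in> C0" "dist x z \<le> e" by auto
    then have "x \<in> C0" "z - x \<in> cball 0 e" "z = x + (z - x)" by (auto simp: dist_norm norm_minus_commute)
    then show "z \<in> C" unfolding C_def by blast
  next
    fix z assume "z \<in> C"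
    then obtain x y where "x \<in> C0" "norm y \<le> e" "z = x + y" by (auto simp: C_def)
    then show "z \<in> (\<Union>x\<in>C0. cball x e)" by (intro UN_I[of x]) (simp_all add: dist_norm)
  qed
  have CX: "C \<subseteq> \<Omega> - P" using e Ceq by simp
  have "C0 \<subseteq> interior C"
  proof
    fix x assume "x \<in> C0"
    then have "ball x e \<subseteq> C" unfolding Ceq using ball_subset_cball by blast
    then show "x \<in> interior C" using e(1) by (meson centre_in_ball interior_maximal open_ball subsetD)
  qed
  then have int: "x0 \<in> interior C" and fr: "frontier C \<inter> C0 = {}" using x0C by (auto simp: frontier_def)
  have intX: "interior C \<subseteq> \<Omega> - P" using CX interior_subset by blast
  have "u x0 + v x0 \<le> m'"
  proof (rule comparison_compact[OF F compC _ _ _ _ _ int])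
    show "usc_real C u" "usc_real C v" using u(1) v(1) CX by (auto intro: usc_real_subset)
    show "quad_sub F (interior C) u" "quad_sub (dual_subeq F) (interior C) v"
      using u(2) v(2) intX by (auto intro: quad_sub_mono)
    fix x assume x: "x \<in> frontier C"
    then have "x \<in> C" using compC compact_imp_closed frontier_subset_closed by blast
    then show "u x + v x \<le> m'" using out[of x] x fr CX by fastforce
  qed
  then show False using m' by simp
qed

text \<open>A test from above of \<open>v\<close> also tests whichever of the two functions agrees
  with \<open>v\<close> at the point. Both the barriers and the modified Perron candidate have this
  form.\<close>

lemma quad_sub_glue:
  fixes u1 u2 v :: "real^'n \<Rightarrow> real"
  assumes u1: "quad_sub F X u1" and Y: "open Y" and u2: "quad_sub F (X \<inter> Y) u2"
    and ge1: "\<And>y. y \<in> X \<Longrightarrow> u1 y \<le> v y" and ge2: "\<And>y. y \<in> X \<inter> Y \<Longrightarrow> u2 y \<le> v y"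
    and eq: "\<And>y. y \<in> X \<Longrightarrow> v y = u1 y \<or> y \<in> Y \<and> v y = u2 y"
  shows "quad_sub F X v"
  unfolding quad_sub_def
proof (intro ballI allI impI)
  fix x q A assume x: "x \<in> X" and A: "sym_mat A" and
    "\<exists>r>0. \<forall>y\<in>X \<inter> ball x r. v y \<le> v x + q \<bullet> (y - x) + ((y - x) \<bullet> (A *v (y - x))) / 2"
  then obtain r where r: "r > 0"
    "\<And>y. y \<in> X \<Longrightarrow> dist x y < r \<Longrightarrow> v y \<le> v x + q \<bullet> (y - x) + ((y - x) \<bullet> (A *v (y - x))) / 2" by auto
  show "A \<in> F"
  proof (cases "v x = u1 x")
    case True
    show ?thesis
    proof (rule quad_subD[OF u1 x A r(1)])
      fix y assume "y \<in> X" "dist x y < r"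
      then show "u1 y \<le> u1 x + q \<bullet> (y - x) + ((y - x) \<bullet> (A *v (y - x))) / 2"
        using r(2)[of y] ge1[of y] True by simp
    qed
  next
    case False
    then have x2: "x \<in> Y" "v x = u2 x" using eq[OF x] by auto
    show ?thesis
    proof (rule quad_subD[OF u2 _ A r(1)])
      show "x \<in> X \<inter> Y" using x x2 by simp
      fix y assume "y \<in> X \<inter> Y" "dist x y < r"
      then show "u2 y \<le> u2 x + q \<bullet> (y - x) + ((y - x) \<bullet> (A *v (y - x))) / 2"
        using r(2)[of y] ge2[of y] x2 by simp
    qed
  qed
qed

section \<open>Quadratic polynomials and upper semicontinuous hulls\<close>

definition quad_poly :: "real \<Rightarrow> real^'n \<Rightarrow> real^'n^'n \<Rightarrow> real^'n \<Rightarrow> real^'n \<Rightarrow> real" where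
  "quad_poly c q A x y = c + q \<bullet> (y - x) + ((y - x) \<bullet> (A *v (y - x))) / 2"

lemma quad_poly_recenter:
  assumes "sym_mat A"
  shows "quad_poly c q A x y = quad_poly (quad_poly c q A x z) (q + A *v (z - x)) A z y"
proof -
  have "(y - x) \<bullet> (A *v (y - x)) = (z - x) \<bullet> (A *v (z - x)) + 2 * ((y - z) \<bullet> (A *v (z - x))) + (y - z) \<bullet> (A *v (y - z))"
    using quad_form_add[OF assms, of "z - x" "y - z"] by simp
  moreover have "q \<bullet> (y - x) = q \<bullet> (z - x) + q \<bullet> (y - z)" by (simp add: inner_diff)
  ultimately show ?thesis
    by (simp add: quad_poly_def inner_add_left inner_commute[of "A *v (z - x)"] add_divide_distrib)
qed

lemma continuous_quad_poly: "continuous_on X (quad_poly c q A x)"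
proof -
  have "continuous_on X (\<lambda>y. A *v (y - x))"
    by (rule continuous_on_compose2[OF linear_continuous_on[of "(*v) A" UNIV]]) (auto intro!: continuous_intros)
  then show ?thesis unfolding quad_poly_def divide_inverse by (intro continuous_intros)
qed

lemma quad_poly_center [simp]: "quad_poly c q A x x = c"
  by (simp add: quad_poly_def)

lemma quad_poly_add_sq:
  "quad_poly c q (A + (2 * e) *\<^sub>R mat 1) x y = quad_poly c q A x y + e * (norm (y - x))\<^sup>2"
  unfolding quad_poly_def matrix_vector_mult_add_rdistrib inner_add_right quad_form_id
  by (simp add: add_divide_distrib)

text \<open>Adding the inequalities at \<open>x + t v\<close> and \<open>x - t v\<close> cancels the
  first-order terms.\<close>

lemma psd_of_quad_touch:
  fixes A B :: "real^'n^'n"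
  assumes A: "sym_mat A" and B: "sym_mat B" and r: "r > 0"
    and le: "\<And>y. dist x y < r \<Longrightarrow> quad_poly c p B x y \<le> quad_poly c q A x y"
  shows "psd (A - B)"
  unfolding psd_def
proof (intro conjI allI sym_mat_diff A B)
  fix v :: "real^'n"
  define t where "t = r / (2 * (norm v + 1))"
  have nv: "norm v + 1 > 0" using norm_ge_zero[of v] by linarith
  have t: "t > 0" using r nv by (simp add: t_def)
  have tv: "norm (t *\<^sub>R v) < r"
  proof -
    have "norm (t *\<^sub>R v) = t * norm v" using t by simp
    also have "\<dots> < t * (2 * (norm v + 1))" 
    proof (rule mult_strict_left_mono[OF _ t])
      show "norm v < 2 * (norm v + 1)" using add_nonneg_pos[OF norm_ge_zero[of v], of 2] by simp
    qed
    also have "\<dots> = r" using nv by (simp add: t_def)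
    finally show ?thesis .
  qed
  have AB: "v \<bullet> ((A - B) *v v) = v \<bullet> (A *v v) - v \<bullet> (B *v v)"
    by (simp add: matrix_vector_mult_diff_rdistrib inner_diff)
  have 1: "p \<bullet> w + (w \<bullet> (B *v w)) / 2 \<le> q \<bullet> w + (w \<bullet> (A *v w)) / 2" if "norm w < r" for w
    using le[of "x + w"] that by (simp add: quad_poly_def dist_norm)
  have 2: "(t *\<^sub>R v) \<bullet> (B *v (t *\<^sub>R v)) \<le> (t *\<^sub>R v) \<bullet> (A *v (t *\<^sub>R v))"
  proof -
    have neg: "(- w) \<bullet> (M *v (- w)) = w \<bullet> (M *v w)" for w and M :: "real^'n^'n"
      using matrix_vector_mult_scaleR[of M "-1" w] by simp
    show ?thesis using 1[OF tv] 1[of "- (t *\<^sub>R v)"] tv unfolding neg by simp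
  qed
  then have "t\<^sup>2 * (v \<bullet> (B *v v)) \<le> t\<^sup>2 * (v \<bullet> (A *v v))"
    by (simp add: matrix_vector_mult_scaleR power2_eq_square mult.assoc)
  then show "0 \<le> v \<bullet> ((A - B) *v v)" using t AB by simp
qed

lemma quad_sub_quad_poly:
  assumes F: "subequation F" and B: "B \<in> F" and X: "open X"
  shows "quad_sub F X (quad_poly c q B x)"
  unfolding quad_sub_def
proof (intro ballI allI impI)
  fix y p A assume y: "y \<in> X" and A: "sym_mat A" and
    "\<exists>r>0. \<forall>z\<in>X \<inter> ball y r. quad_poly c q B x z \<le> quad_poly c q B x y + p \<bullet> (z - y) + ((z - y) \<bullet> (A *v (z - y))) / 2"
  then obtain r where r: "r > 0" "\<And>z. z \<in> X \<inter> ball y r \<Longrightarrow>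
      quad_poly c q B x z \<le> quad_poly (quad_poly c q B x y) p A y z"
    unfolding quad_poly_def[of _ p A y] by blast
  obtain s where s: "s > 0" "ball y s \<subseteq> X" using X y open_contains_ball by blast
  have sB: "sym_mat B" using F B by (auto simp: subequation_def)
  have "psd (A - B)"
  proof (rule psd_of_quad_touch[OF A sB])
    show "min r s > 0" using r s by simp
    fix z assume "dist y z < min r s"
    then have "z \<in> X \<inter> ball y r" using s by auto
    from r(2)[OF this] show "quad_poly (quad_poly c q B x y) (q + B *v (y - x)) B y z
        \<le> quad_poly (quad_poly c q B x y) p A y z"
      unfolding quad_poly_recenter[OF sB, of c q x z y] .
  qed
  then have "B + (A - B) \<in> F" using F B unfolding subequation_def by blast
  then show "A \<in> F" by simp
qed

text \<open>The upper semicontinuous regularisation, as the infimum of local upper bounds. The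
  infimum is meaningful on \<open>X\<close> when \<open>f\<close> has a continuous majorant
  there.\<close>

definition usc_hull :: "'a::metric_space set \<Rightarrow> ('a \<Rightarrow> real) \<Rightarrow> 'a \<Rightarrow> real" where
  "usc_hull X f x = Inf {c. \<exists>r>0. \<forall>y\<in>X \<inter> ball x r. f y \<le> c}"

context
  fixes X :: "'a::metric_space set" and f B :: "'a \<Rightarrow> real"
  assumes fB: "\<And>x. x \<in> X \<Longrightarrow> f x \<le> B x" and contB: "continuous_on X B"
begin

lemma usc_hull_set:
  assumes "x \<in> X"
  shows "{c. \<exists>r>0. \<forall>y\<in>X \<inter> ball x r. f y \<le> c} \<noteq> {}" "bdd_below {c. \<exists>r>0. \<forall>y\<in>X \<inter> ball x r. f y \<le> c}"
proof -
  obtain d where "d > 0" "\<And>y. y \<in> X \<Longrightarrow> dist y x < d \<Longrightarrow> B y < B x + 1"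
    by (rule usc_realD[OF usc_real_continuous[OF contB] assms, of "B x + 1"]) (simp, rule that)
  then have "\<exists>r>0. \<forall>y\<in>X \<inter> ball x r. f y \<le> B x + 1"
    using fB by (intro exI[of _ d]) (fastforce simp: dist_commute)
  then show "{c. \<exists>r>0. \<forall>y\<in>X \<inter> ball x r. f y \<le> c} \<noteq> {}" by blast
  show "bdd_below {c. \<exists>r>0. \<forall>y\<in>X \<inter> ball x r. f y \<le> c}"
    using assms by (intro bdd_belowI[of _ "f x"]) auto
qed

lemma le_usc_hull: "x \<in> X \<Longrightarrow> f x \<le> usc_hull X f x"
  unfolding usc_hull_def by (intro cInf_greatest usc_hull_set) auto

lemma usc_hull_le:
  assumes x: "x \<in> X" and r: "r > 0" "\<And>y. y \<in> X \<Longrightarrow> dist x y < r \<Longrightarrow> f y \<le> \<psi> y" and \<psi>: "continuous_on X \<psi>"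
  shows "usc_hull X f x \<le> \<psi> x"
proof (rule field_le_epsilon)
  fix e :: real assume e: "e > 0"
  obtain d where d: "d > 0" "\<And>y. y \<in> X \<Longrightarrow> dist y x < d \<Longrightarrow> \<psi> y < \<psi> x + e"
    by (rule usc_realD[OF usc_real_continuous[OF \<psi>] x, of "\<psi> x + e"]) (use e in simp, rule that)
  have "\<exists>r>0. \<forall>y\<in>X \<inter> ball x r. f y \<le> \<psi> x + e"
    using d r by (intro exI[of _ "min d r"]) (fastforce simp: dist_commute)
  then show "usc_hull X f x \<le> \<psi> x + e"
    unfolding usc_hull_def by (intro cInf_lower usc_hull_set x) simp
qed

lemma usc_hull_usc: "usc_real X (usc_hull X f)"
  unfolding usc_real_def
proof (intro ballI allI impI)
  fix x c assume x: "x \<in> X" and "usc_hull X f x < c"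
  then obtain c' r where c': "c' < c" "r > 0" "\<And>y. y \<in> X \<inter> ball x r \<Longrightarrow> f y \<le> c'"
    unfolding usc_hull_def using cInf_lessD[OF usc_hull_set(1)[OF x]] by blast
  show "\<exists>d>0. \<forall>y\<in>X. dist y x < d \<longrightarrow> usc_hull X f y < c"
  proof (intro exI conjI ballI impI)
    fix y assume y: "y \<in> X" "dist y x < r"
    have "f z \<le> c'" if "z \<in> X" "dist y z < r - dist y x" for z
      using c'(3)[of z] that dist_triangle[of x z y] by (auto simp: dist_commute)
    then have "usc_hull X f y \<le> c'"
      using usc_hull_le[OF y(1), of "r - dist y x" "\<lambda>_. c'"] y(2) by auto
    then show "usc_hull X f y < c" using c'(1) by simp
  qed (rule c'(2))
qed

lemma usc_hull_approx:
  assumes x: "x \<in> X" and "s > 0" "e > 0"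
  obtains y where "y \<in> X" "dist x y < s" "f y > usc_hull X f x - e"
proof (rule ccontr)
  note found = that
  assume "\<not> thesis"
  then have "f y \<le> usc_hull X f x - e" if "y \<in> X" "dist x y < s" for y
    using found[OF that] by (meson not_le)
  then have "usc_hull X f x \<le> usc_hull X f x - e"
    by (intro usc_hull_le[OF x \<open>s > 0\<close>, where \<psi> = "\<lambda>_. usc_hull X f x - e"]) auto
  then show False using \<open>e > 0\<close> by simp
qed

end

text \<open>The supremum need not be attained by a member, so the test is first made strict by
  adding \<open>\<epsilon> (norm (y - x0))\<^sup>2\<close>. A member that nearly reaches the hull
  close to \<open>x0\<close> then has an interior maximum against the strict test and yields the
  perturbed matrix.\<close>

lemma usc_hull_Sup_quad_sub:
  fixes \<U> :: "(real^'n \<Rightarrow> real) set"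
  assumes F: "subequation F" and X: "open X" and W: "continuous_on X W"
    and \<U>: "\<And>u. u \<in> \<U> \<Longrightarrow> usc_real X u \<and> quad_sub F X u \<and> (\<forall>x\<in>X. u x \<le> W x)" and ne: "\<U> \<noteq> {}"
    and h0: "\<And>x. h0 x = Sup ((\<lambda>u. u x) ` \<U>)"
  shows "quad_sub F X (usc_hull X h0)"
  unfolding quad_sub_def
proof (intro ballI allI impI)
  define h where "h = usc_hull X h0"
  have bddU: "bdd_above ((\<lambda>u. u x) ` \<U>)" if "x \<in> X" for x
    using \<U> that by (intro bdd_aboveI[of _ "W x"]) auto
  have h0W: "h0 x \<le> W x" if "x \<in> X" for x
    unfolding h0 using \<U> ne that by (intro cSup_least) auto
  have uh0: "u x \<le> h0 x" if "u \<in> \<U>" "x \<in> X" for u x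
    unfolding h0 using bddU that by (intro cSup_upper) auto
  have h0h: "h0 x \<le> h x" if "x \<in> X" for x
    unfolding h_def by (rule le_usc_hull[OF h0W W that])
  fix x0 q A assume x0: "x0 \<in> X" and A: "sym_mat A" and
    "\<exists>r>0. \<forall>y\<in>X \<inter> ball x0 r. usc_hull X h0 y \<le> usc_hull X h0 x0 + q \<bullet> (y - x0) + ((y - x0) \<bullet> (A *v (y - x0))) / 2"
  then obtain r where r: "r > 0" "\<And>y. y \<in> X \<Longrightarrow> dist x0 y < r \<Longrightarrow> h y \<le> quad_poly (h x0) q A x0 y"
    unfolding h_def[symmetric] quad_poly_def by auto
  have "A + (2 * \<epsilon>) *\<^sub>R mat 1 \<in> F" if \<epsilon>: "\<epsilon> > 0" for \<epsilon>
  proof -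
    define A' where "A' = A + (2 * \<epsilon>) *\<^sub>R mat 1"
    have A': "sym_mat A'" unfolding A'_def using A by (intro sym_mat_add) auto
    define Q where "Q = quad_poly (h x0) q A' x0"
    have Qeq: "Q y = quad_poly (h x0) q A x0 y + \<epsilon> * (norm (y - x0))\<^sup>2" for y
      unfolding Q_def A'_def by (rule quad_poly_add_sq)
    obtain e where e: "e > 0" "cball x0 e \<subseteq> X" using X x0 open_contains_cball by blast
    define \<rho> where "\<rho> = min e (r / 2)"
    have \<rho>: "\<rho> > 0" "\<rho> < r" "cball x0 \<rho> \<subseteq> X" using e r by (auto simp: \<rho>_def)
    \<comment> \<open>Near \<open>x0\<close> the selected member falls short of \<open>Q\<close> by
      less than \<open>2 * g\<close>, on the sphere of radius \<open>\<rho>\<close> by at least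
      \<open>4 * g\<close>, so its maximum is not on the sphere.\<close>
    define g where "g = \<epsilon> * \<rho>\<^sup>2 / 4"
    have g: "g > 0" using \<epsilon> \<rho> by (simp add: g_def)
    have Qx0: "Q x0 < h x0 + g" using g by (simp add: Q_def)
    obtain d where d: "d > 0" "\<And>y. y \<in> X \<Longrightarrow> dist y x0 < d \<Longrightarrow> Q y < h x0 + g"
      by (rule usc_realD[OF usc_real_continuous[OF continuous_quad_poly] x0 Qx0[unfolded Q_def]])
        (rule that, auto simp: Q_def)
    obtain x where x: "x \<in> X" "dist x0 x < min d \<rho>" "h0 x > h x0 - g"
      unfolding h_def
      by (rule usc_hull_approx[OF h0W W x0 _ g, of "min d \<rho>"]) (use d \<rho> in simp_all)
    have "h0 x > Q x - 2 * g" using x(3) d(2)[OF x(1)] x(2) by (simp add: dist_commute)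
    then obtain u where u: "u \<in> \<U>" "u x > Q x - 2 * g"
      unfolding h0 using less_cSupD[of "(\<lambda>u. u x) ` \<U>"] ne by blast
    have uscu: "usc_real X u" "quad_sub F X u" using \<U>[OF u(1)] by auto
    have "usc_real (cball x0 \<rho>) (\<lambda>y. u y + (- Q y))"
      by (intro usc_real_add usc_real_subset[OF uscu(1) \<rho>(3)] usc_real_continuous)
        (auto simp: Q_def intro!: continuous_intros continuous_quad_poly)
    from usc_real_attains_sup[OF compact_cball _ this] \<rho> obtain y1 where
      y1: "y1 \<in> cball x0 \<rho>" "\<And>y. y \<in> cball x0 \<rho> \<Longrightarrow> u y - Q y \<le> u y1 - Q y1" by auto
    have y1X: "y1 \<in> X" using y1 \<rho> by blast
    have "u y1 - Q y1 > - 2 * g" using y1(2)[of x] x(2) u(2) by simp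
    moreover have "u y1 - Q y1 \<le> - (\<epsilon> * (dist x0 y1)\<^sup>2)"
    proof -
      have "u y1 \<le> h y1" using uh0[OF u(1) y1X] h0h[OF y1X] by simp
      also have "\<dots> \<le> quad_poly (h x0) q A x0 y1" using r(2)[OF y1X] y1(1) \<rho> by simp
      finally show ?thesis by (simp add: Qeq dist_norm norm_minus_commute)
    qed
    ultimately have "\<epsilon> * (dist x0 y1)\<^sup>2 < 2 * g" by simp
    then have "dist x0 y1 \<noteq> \<rho>" using \<epsilon> \<rho> by (auto simp: g_def)
    then have lt: "dist x0 y1 < \<rho>" using y1(1) by simp
    show ?thesis
      unfolding A'_def[symmetric]
    proof (rule quad_subD[OF uscu(2) y1X A', of "\<rho> - dist x0 y1" "q + A' *v (y1 - x0)"])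
      show "\<rho> - dist x0 y1 > 0" using lt by simp
      fix y assume "y \<in> X" "dist y1 y < \<rho> - dist x0 y1"
      then have "y \<in> cball x0 \<rho>" using dist_triangle[of x0 y y1] by simp
      from y1(2)[OF this] have "u y \<le> u y1 + (Q y - Q y1)" by simp
      also have "Q y - Q y1 = (q + A' *v (y1 - x0)) \<bullet> (y - y1) + ((y - y1) \<bullet> (A' *v (y - y1))) / 2"
        unfolding Q_def by (subst quad_poly_recenter[OF A', of _ _ _ y y1]) (simp add: quad_poly_def[of _ _ A' y1 y])
      finally show "u y \<le> u y1 + (q + A' *v (y1 - x0)) \<bullet> (y - y1) + ((y - y1) \<bullet> (A' *v (y - y1))) / 2"
        by simp
    qed
  qed
  then show "A \<in> F" by (rule subequation_perturb[OF F])
qed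

text \<open>The envelope \<open>h\<close> lies in its own class of competitors. If the hull
  \<open>g\<close> of \<open>- h\<close> failed the dual test, a slightly raised quadratic could be
  glued onto \<open>h\<close> to form a larger competitor. Continuity of \<open>h\<close>, that is
  \<open>g = - h\<close>, is left to a later comparison.\<close>

lemma perron:
  fixes w W :: "real^'n \<Rightarrow> real"
  assumes F: "subequation F" and X: "open X"
    and w: "continuous_on X w" "quad_sub F X w"
    and W: "continuous_on X W" "quad_sub (dual_subeq F) X (\<lambda>x. - W x)"
    and wW: "\<And>x. x \<in> X \<Longrightarrow> w x \<le> W x"
  obtains h g where "usc_real X h" "quad_sub F X h" "usc_real X g" "quad_sub (dual_subeq F) X g"
    "\<And>x. x \<in> X \<Longrightarrow> w x \<le> h x \<and> h x \<le> W x" "\<And>x. x \<in> X \<Longrightarrow> - h x \<le> g x \<and> g x \<le> - w x"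
proof -
  define \<U> where "\<U> = {u. usc_real X u \<and> quad_sub F X u \<and> (\<forall>x\<in>X. w x \<le> u x \<and> u x \<le> W x)}"
  have w\<U>: "w \<in> \<U>" using w wW by (auto simp: \<U>_def intro: usc_real_continuous)
  define h0 where "h0 x = Sup ((\<lambda>u. u x) ` \<U>)" for x
  have bddU: "bdd_above ((\<lambda>u. u x) ` \<U>)" if "x \<in> X" for x
    using that by (intro bdd_aboveI[of _ "W x"]) (auto simp: \<U>_def)
  have h0W: "h0 x \<le> W x" if "x \<in> X" for x
    unfolding h0_def using w\<U> that by (intro cSup_least) (auto simp: \<U>_def)
  have uh0: "u x \<le> h0 x" if "u \<in> \<U>" "x \<in> X" for u x
    unfolding h0_def using bddU that by (intro cSup_upper) auto
  define h where "h = usc_hull X h0"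
  have h0h: "h0 x \<le> h x" if "x \<in> X" for x
    unfolding h_def by (rule le_usc_hull[OF h0W W(1) that])
  have hW: "h x \<le> W x" if "x \<in> X" for x
    unfolding h_def by (rule usc_hull_le[OF h0W W(1) that, of 1]) (use h0W W(1) in auto)
  have wh: "w x \<le> h x" if "x \<in> X" for x using uh0[OF w\<U> that] h0h[OF that] by simp
  have hsub: "quad_sub F X h"
    unfolding h_def by (rule usc_hull_Sup_quad_sub[OF F X W(1) _ _ h0_def]) (use w\<U> in \<open>auto simp: \<U>_def\<close>)
  have husc: "usc_real X h" unfolding h_def by (rule usc_hull_usc[OF h0W W(1)])
  have h\<U>: "h \<in> \<U>" using hsub husc wh hW by (auto simp: \<U>_def)
  have max: "u x \<le> h x" if "u \<in> \<U>" "x \<in> X" for u x using uh0[OF that] h0h[OF that(2)] by simp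
  have mhw: "- h x \<le> - w x" if "x \<in> X" for x using wh[OF that] by simp
  have contmw: "continuous_on X (\<lambda>x. - w x)" by (intro continuous_intros w)
  define g where "g = usc_hull X (\<lambda>x. - h x)"
  have gh: "- h x \<le> g x" if "x \<in> X" for x
    unfolding g_def by (rule le_usc_hull[OF mhw contmw that])
  have gw: "g x \<le> - w x" if "x \<in> X" for x
    unfolding g_def by (rule usc_hull_le[OF mhw contmw that, of 1]) (use mhw contmw in auto)
  have gusc: "usc_real X g" unfolding g_def by (rule usc_hull_usc[OF mhw contmw])
  have gW: "- W x \<le> g x" if "x \<in> X" for x using gh[OF that] hW[OF that] by simp
  have gsub: "quad_sub (dual_subeq F) X g"
    unfolding quad_sub_def
  proof (intro ballI allI impI)
    fix x0 q A assume x0: "x0 \<in> X" and A: "sym_mat A" and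
      "\<exists>r>0. \<forall>y\<in>X \<inter> ball x0 r. g y \<le> g x0 + q \<bullet> (y - x0) + ((y - x0) \<bullet> (A *v (y - x0))) / 2"
    then obtain r where r: "r > 0" "\<And>y. y \<in> X \<Longrightarrow> dist x0 y < r \<Longrightarrow> g y \<le> quad_poly (g x0) q A x0 y"
      unfolding quad_poly_def by auto
    show "A \<in> dual_subeq F"
    proof (cases "g x0 = - W x0")
      \<comment> \<open>Where the envelope meets the upper obstacle there is no room to raise it,
        but the test then touches \<open>- W\<close> as well.\<close>
      case True
      show ?thesis
      proof (rule quad_subD[OF W(2) x0 A r(1)])
        fix y assume "y \<in> X" "dist x0 y < r"
        then show "- W y \<le> - W x0 + q \<bullet> (y - x0) + ((y - x0) \<bullet> (A *v (y - x0))) / 2"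
          using r(2)[of y] gW[of y] True by (simp add: quad_poly_def)
      qed
    next
      case False
      then have lt: "- g x0 < W x0" using gW[OF x0] by simp
      show ?thesis
      proof (rule ccontr)
        assume "A \<notin> dual_subeq F"
        then have "- A \<in> sym_interior F" using A by (simp add: dual_subeq_def)
        then obtain e where e: "e > 0" "\<And>B. sym_mat B \<Longrightarrow> dist B (- A) < e \<Longrightarrow> B \<in> F"
          by (auto simp: sym_interior_def)
        \<comment> \<open>Makes the shift of \<open>- A\<close> by \<open>- 2 * \<epsilon>\<close>
          times the identity shorter than \<open>e / 2\<close>, so that \<open>B\<close> remains in
          \<open>F\<close>.\<close>
        define \<epsilon> where "\<epsilon> = e / (4 * (norm (mat 1 :: real^'n^'n) + 1))"
        have nn: "norm (mat 1 :: real^'n^'n) + 1 > 0" using norm_ge_zero[of "mat 1 :: real^'n^'n"] by linarith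
        have \<epsilon>: "\<epsilon> > 0" using e nn by (simp add: \<epsilon>_def)
        define B where "B = - A + (2 * (- \<epsilon>)) *\<^sub>R mat 1"
        have symB: "sym_mat B" unfolding B_def using A by (intro sym_mat_add) simp_all
        have BF: "B \<in> F"
        proof (rule e(2)[OF symB])
          have "dist B (- A) = 2 * \<epsilon> * norm (mat 1 :: real^'n^'n)"
            using \<epsilon> by (simp add: B_def dist_norm)
          also have "\<dots> < 2 * \<epsilon> * (norm (mat 1 :: real^'n^'n) + 1)" using \<epsilon> by simp
          also have "\<dots> = e / 2" using nn by (simp add: \<epsilon>_def field_simps)
          finally show "dist B (- A) < e" using e by simp
        qed
        define P where "P = quad_poly (- g x0) (- q) (- A) x0"
        have P: "P y = - quad_poly (g x0) q A x0 y" for y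
          using scaleR_mat_vec[of "-1" A "y - x0"] by (simp add: P_def quad_poly_def)
        obtain e1 where e1: "e1 > 0" "ball x0 e1 \<subseteq> X" using X x0 open_contains_ball by blast
        \<comment> \<open>Half of the room below \<open>W\<close> at \<open>x0\<close>; by
          continuity the quadratic \<open>P\<close> stays this far below \<open>W\<close>
          nearby.\<close>
        define \<sigma>0 where "\<sigma>0 = (W x0 + g x0) / 2"
        have \<sigma>0: "\<sigma>0 > 0" using lt by (simp add: \<sigma>0_def)
        have "continuous_on X (\<lambda>y. P y - W y)" unfolding P_def
          by (intro continuous_intros continuous_quad_poly W)
        moreover have "P x0 - W x0 < - \<sigma>0" using \<sigma>0 by (simp add: P_def \<sigma>0_def field_simps)
        ultimately obtain d where d: "d > 0" "\<And>y. y \<in> X \<Longrightarrow> dist y x0 < d \<Longrightarrow> P y - W y < - \<sigma>0"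
          by (rule usc_realD[OF usc_real_continuous x0]) (rule that)
        define \<rho> where "\<rho> = min r (min e1 d)"
        have \<rho>: "\<rho> > 0" "\<rho> \<le> r" "\<rho> \<le> d" "ball x0 \<rho> \<subseteq> X" using r e1 d by (auto simp: \<rho>_def)
        \<comment> \<open>The amount by which the bump is raised: small enough to stay below
          \<open>W\<close>, and to fall below \<open>h\<close> at distance
          \<open>\<rho> / 2\<close>, so that the gluing preserves semicontinuity.\<close>
        define \<sigma> where "\<sigma> = min \<sigma>0 (\<epsilon> * (\<rho> / 2)\<^sup>2)"
        have \<sigma>: "\<sigma> > 0" "\<sigma> \<le> \<sigma>0" "\<sigma> \<le> \<epsilon> * (\<rho> / 2)\<^sup>2" using \<sigma>0 \<epsilon> \<rho> by (auto simp: \<sigma>_def)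
        define \<psi> where "\<psi> = quad_poly (- g x0 + \<sigma>) (- q) B x0"
        have \<psi>: "\<psi> y = P y + \<sigma> - \<epsilon> * (norm (y - x0))\<^sup>2" for y
          unfolding \<psi>_def B_def quad_poly_add_sq by (simp add: P_def quad_poly_def)
        have Ph: "P y \<le> h y" if "y \<in> ball x0 \<rho>" for y
        proof -
          have "y \<in> X" "dist x0 y < r" using that \<rho> by auto
          then show ?thesis using r(2)[of y] gh[of y] P[of y] by simp
        qed
        have \<psi>W: "\<psi> y \<le> W y" if "y \<in> ball x0 \<rho>" for y
        proof -
          have "y \<in> X" "dist y x0 < d" using that \<rho> by (auto simp: dist_commute)
          from d(2)[OF this] show ?thesis using \<sigma> \<epsilon> unfolding \<psi> by (smt (verit) mult_nonneg_nonneg zero_le_power2)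
        qed
        have \<psi>h: "\<psi> y \<le> h y" if "y \<in> ball x0 \<rho>" "dist x0 y \<ge> \<rho> / 2" for y
        proof -
          have "(\<rho> / 2)\<^sup>2 \<le> (norm (y - x0))\<^sup>2"
            using that(2) \<rho>(1) by (intro power_mono) (auto simp: dist_norm norm_minus_commute)
          then have "\<epsilon> * (\<rho> / 2)\<^sup>2 \<le> \<epsilon> * (norm (y - x0))\<^sup>2" using \<epsilon> by (intro mult_left_mono) auto
          then show ?thesis using Ph[OF that(1)] \<sigma> unfolding \<psi> by linarith
        qed
        define k where "k y = (if y \<in> ball x0 \<rho> then max (h y) (\<psi> y) else h y)" for y
        have kusc: "usc_real X k"
          unfolding usc_real_def
        proof (intro ballI allI impI)
          fix y c assume y: "y \<in> X" "k y < c"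
          have "h y < c" using y(2) by (auto simp: k_def split: if_splits)
          then obtain d1 where d1: "d1 > 0" "\<And>z. z \<in> X \<Longrightarrow> dist z y < d1 \<Longrightarrow> h z < c"
            using husc y(1) unfolding usc_real_def by blast
          show "\<exists>d>0. \<forall>z\<in>X. dist z y < d \<longrightarrow> k z < c"
          proof (cases "y \<in> ball x0 \<rho>")
            case True
            then have "\<psi> y < c" using y(2) by (simp add: k_def)
            moreover have "usc_real X \<psi>" unfolding \<psi>_def by (intro usc_real_continuous continuous_quad_poly)
            ultimately obtain d2 where d2: "d2 > 0" "\<And>z. z \<in> X \<Longrightarrow> dist z y < d2 \<Longrightarrow> \<psi> z < c"
              using y(1) unfolding usc_real_def by blast
            show ?thesis
              using d1 d2 by (intro exI[of _ "min d1 d2"]) (auto simp: k_def)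
          next
            case False
            have "k z < c" if z: "z \<in> X" "dist z y < min d1 (\<rho> / 2)" for z
            proof (cases "z \<in> ball x0 \<rho>")
              case True
              have "dist x0 y \<ge> \<rho>" using False by simp
              then have "dist x0 z \<ge> \<rho> / 2" using dist_triangle[of x0 y z] z(2) by simp
              from \<psi>h[OF True this] show ?thesis using d1(2)[of z] z by (simp add: k_def)
            qed (use d1(2)[of z] z in \<open>simp add: k_def\<close>)
            then show ?thesis using d1(1) \<rho>(1) by (intro exI[of _ "min d1 (\<rho> / 2)"]) auto
          qed
        qed
        have "quad_sub F (X \<inter> ball x0 \<rho>) \<psi>"
          unfolding \<psi>_def by (intro quad_sub_quad_poly F BF open_Int X open_ball)
        then have ksub: "quad_sub F X k"
          by (rule quad_sub_glue[OF hsub open_ball]) (auto simp: k_def max_def)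
        have "k \<in> \<U>"
          unfolding \<U>_def using kusc ksub wh hW \<psi>W by (fastforce simp: k_def)
        then have \<psi>h': "\<psi> y \<le> h y" if "y \<in> ball x0 \<rho>" for y
          using max[of k y] that \<rho>(4) by (auto simp: k_def)
        \<comment> \<open>Maximality puts \<open>h\<close> above the bump on the whole ball, so the
          hull of \<open>- h\<close> at \<open>x0\<close> is at most \<open>- \<psi> x0\<close>,
          which is \<open>g x0 - \<sigma>\<close>.\<close>
        have "usc_hull X (\<lambda>x. - h x) x0 \<le> - \<psi> x0"
        proof (rule usc_hull_le[OF mhw contmw x0 \<rho>(1)])
          show "continuous_on X (\<lambda>x. - \<psi> x)"
            unfolding \<psi>_def by (intro continuous_intros continuous_quad_poly)
        qed (use \<psi>h' in auto)
        then have "g x0 \<le> g x0 - \<sigma>" by (simp add: g_def[symmetric] \<psi>_def)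
        then show False using \<sigma>(1) by simp
      qed
    qed
  qed
  show thesis by (rule that[OF husc hsub gusc gsub]) (use wh hW gh gw in auto)
qed

section \<open>Densities and the Riesz kernel\<close>

lemma cone_subequation_imp_subequation: "cone_subequation F \<Longrightarrow> subequation F"
  by (simp add: cone_subequation_def subequation_def)

lemma cone_subequation_scale: "cone_subequation F \<Longrightarrow> t > 0 \<Longrightarrow> A \<in> F \<Longrightarrow> t *\<^sub>R A \<in> F"
  unfolding cone_subequation_def by blast

text \<open>Closedness reflects the openness of the interior of \<open>F\<close>. For positivity, a
  neighbourhood of \<open>- (A + P)\<close> inside \<open>F\<close> is translated by
  \<open>P\<close> to one of \<open>- A\<close>.\<close>

lemma subequation_dual:
  fixes F :: "(real^'n^'n) set"
  assumes F: "subequation F" shows "subequation (dual_subeq F)"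
  unfolding subequation_def
proof (intro conjI ballI allI impI)
  show "dual_subeq F \<subseteq> {A. sym_mat A}" by (auto simp: dual_subeq_def)
  show "closed (dual_subeq F)"
    unfolding closed_sequential_limits
  proof (intro allI impI)
    fix X A assume "(\<forall>n. X n \<in> dual_subeq F) \<and> X \<longlonglongrightarrow> A"
    then have X: "\<And>n. sym_mat (X n)" "\<And>n. - X n \<notin> sym_interior F" "X \<longlonglongrightarrow> A"
      by (auto simp: dual_subeq_def)
    have "transpose A $ i $ j = A $ i $ j" for i j
    proof -
      have "X n $ j $ i = X n $ i $ j" for n
      proof -
        have "X n $ j $ i = transpose (X n) $ i $ j" by (simp add: transpose_def)
        also have "\<dots> = X n $ i $ j" using X(1)[of n] by (simp add: sym_mat_def)
        finally show ?thesis .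
      qed
      moreover have "(\<lambda>n. X n $ j $ i) \<longlonglongrightarrow> A $ j $ i" "(\<lambda>n. X n $ i $ j) \<longlonglongrightarrow> A $ i $ j"
        by (intro tendsto_intros X)+
      ultimately show ?thesis using LIMSEQ_unique by (simp add: transpose_def)
    qed
    then have sA: "sym_mat A" by (simp add: sym_mat_def vec_eq_iff)
    moreover have "- A \<notin> sym_interior F"
    proof
      assume "- A \<in> sym_interior F"
      then obtain e where e: "e > 0" "\<And>B. sym_mat B \<Longrightarrow> dist B (- A) < e \<Longrightarrow> B \<in> F"
        by (auto simp: sym_interior_def)
      have "e / 2 > 0" using e by simp
      then obtain n where n: "dist (X n) A < e / 2"
        using X(3) by (meson lim_sequentially order_refl)
      have "B \<in> F" if "sym_mat B" "dist B (- X n) < e / 2" for B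
      proof (rule e(2)[OF that(1)])
        have "dist (- X n) (- A) < e / 2" using n by (simp add: dist_minus)
        then show "dist B (- A) < e" using that(2) dist_triangle[of B "- A" "- X n"] by linarith
      qed
      then have "- X n \<in> sym_interior F" using X(1)[of n] e(1) by (auto simp: sym_interior_def intro!: exI[of _ "e / 2"])
      with X(2) show False by blast
    qed
    ultimately show "A \<in> dual_subeq F" by (simp add: dual_subeq_def)
  qed
  fix A P :: "real^'n^'n" assume A: "A \<in> dual_subeq F" and P: "psd P"
  have sP: "sym_mat P" using P by (simp add: psd_def)
  show "A + P \<in> dual_subeq F"
  proof (rule ccontr)
    assume "A + P \<notin> dual_subeq F"
    then have "- (A + P) \<in> sym_interior F" using A sP by (auto simp: dual_subeq_def sym_mat_add)
    then obtain e where e: "e > 0" "\<And>B. sym_mat B \<Longrightarrow> dist B (- (A + P)) < e \<Longrightarrow> B \<in> F"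
      by (auto simp: sym_interior_def)
    have "B \<in> F" if "sym_mat B" "dist B (- A) < e" for B
    proof -
      have "B - P \<in> F"
        using that sP by (intro e(2) sym_mat_diff) (simp_all add: dist_norm)
      then have "(B - P) + P \<in> F" using F P unfolding subequation_def by blast
      then show ?thesis by simp
    qed
    then have "- A \<in> sym_interior F" using A e(1) by (auto simp: sym_interior_def dual_subeq_def)
    then show False using A by (simp add: dual_subeq_def)
  qed
qed

lemma dual_subeq_scale:
  assumes F: "cone_subequation F" and t: "t > 0" and A: "A \<in> dual_subeq F"
  shows "t *\<^sub>R A \<in> dual_subeq F"
proof (rule ccontr)
  assume "t *\<^sub>R A \<notin> dual_subeq F"
  then have "- (t *\<^sub>R A) \<in> sym_interior F" using A by (auto simp: dual_subeq_def sym_mat_scaleR)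
  then obtain e where e: "e > 0" "\<And>B. sym_mat B \<Longrightarrow> dist B (- (t *\<^sub>R A)) < e \<Longrightarrow> B \<in> F"
    by (auto simp: sym_interior_def)
  have "B \<in> F" if B: "sym_mat B" "dist B (- A) < e / t" for B
  proof -
    have "dist (t *\<^sub>R B) (- (t *\<^sub>R A)) = t * dist B (- A)"
      using t by (simp add: dist_norm flip: scaleR_add_right)
    also have "\<dots> < e" using B t by (simp add: field_simps)
    finally have "t *\<^sub>R B \<in> F" using B by (intro e(2) sym_mat_scaleR)
    from cone_subequation_scale[OF F _ this, of "1 / t"] show ?thesis using t by simp
  qed
  then have "- A \<in> sym_interior F"
    using A e(1) t unfolding sym_interior_def dual_subeq_def by (auto intro!: exI[of _ "e / t"])
  then show False using A by (simp add: dual_subeq_def)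
qed

lemma quad_sub_scale:
  assumes sc: "\<And>A. A \<in> F \<Longrightarrow> t *\<^sub>R A \<in> F" and t: "t > 0" and u: "quad_sub F X u"
  shows "quad_sub F X (\<lambda>x. t * u x)"
  unfolding quad_sub_def
proof (intro ballI allI impI)
  fix x q A assume x: "x \<in> X" and A: "sym_mat A" and
    "\<exists>r>0. \<forall>y\<in>X \<inter> ball x r. t * u y \<le> t * u x + q \<bullet> (y - x) + ((y - x) \<bullet> (A *v (y - x))) / 2"
  then obtain r where r: "r > 0"
    "\<And>y. y \<in> X \<Longrightarrow> dist x y < r \<Longrightarrow> t * u y \<le> t * u x + q \<bullet> (y - x) + ((y - x) \<bullet> (A *v (y - x))) / 2" by auto
  have "(1 / t) *\<^sub>R A \<in> F"
  proof (rule quad_subD[OF u x sym_mat_scaleR[OF A] r(1)])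
    fix y assume y: "y \<in> X" "dist x y < r"
    have "t * u y \<le> t * (u x + ((1 / t) *\<^sub>R q) \<bullet> (y - x) + ((y - x) \<bullet> (((1 / t) *\<^sub>R A) *v (y - x))) / 2)"
      using r(2)[OF y] t unfolding scaleR_mat_vec inner_scaleR_left inner_scaleR_right
      by (simp add: distrib_left)
    then show "u y \<le> u x + ((1 / t) *\<^sub>R q) \<bullet> (y - x) + ((y - x) \<bullet> (((1 / t) *\<^sub>R A) *v (y - x))) / 2"
      using t by simp
  qed
  then have "t *\<^sub>R (1 / t) *\<^sub>R A \<in> F" by (rule sc)
  then show "A \<in> F" using t by simp
qed

lemma quad_sub_translate:
  assumes u: "quad_sub F X u" and Y: "open Y" "\<And>y. y \<in> Y \<Longrightarrow> a + y \<in> X"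
  shows "quad_sub F Y (\<lambda>y. u (a + y))"
  unfolding quad_sub_def
proof (intro ballI allI impI)
  fix x q A assume x: "x \<in> Y" and A: "sym_mat A" and
    "\<exists>r>0. \<forall>y\<in>Y \<inter> ball x r. u (a + y) \<le> u (a + x) + q \<bullet> (y - x) + ((y - x) \<bullet> (A *v (y - x))) / 2"
  then obtain r where r: "r > 0"
    "\<And>y. y \<in> Y \<Longrightarrow> dist x y < r \<Longrightarrow> u (a + y) \<le> u (a + x) + q \<bullet> (y - x) + ((y - x) \<bullet> (A *v (y - x))) / 2" by auto
  obtain s where s: "s > 0" "ball x s \<subseteq> Y" using Y(1) x open_contains_ball by blast
  show "A \<in> F"
  proof (rule quad_subD[OF u Y(2)[OF x] A, of "min r s" q])
    show "min r s > 0" using r s by simp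
    fix z assume "dist (a + x) z < min r s"
    then have d: "dist x (z - a) < min r s" by (simp add: dist_norm algebra_simps)
    then have "z - a \<in> Y" using s by auto
    from r(2)[OF this] d show "u z \<le> u (a + x) + q \<bullet> (z - (a + x)) + ((z - (a + x)) \<bullet> (A *v (z - (a + x)))) / 2"
      by (simp add: diff_diff_eq)
  qed
qed

lemma quad_sub_add_square:
  assumes F: "subequation F" and u: "quad_sub F X u" and a: "a \<ge> 0"
  shows "quad_sub F X (\<lambda>x. u x + a * (norm x)\<^sup>2 + b)"
  unfolding quad_sub_def
proof (intro ballI allI impI)
  fix x q A assume x: "x \<in> X" and A: "sym_mat A" and
    "\<exists>r>0. \<forall>y\<in>X \<inter> ball x r. u y + a * (norm y)\<^sup>2 + b \<le> u x + a * (norm x)\<^sup>2 + b + q \<bullet> (y - x) + ((y - x) \<bullet> (A *v (y - x))) / 2"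
  then obtain r where r0: "r > 0" and r1: "\<And>y. y \<in> X \<inter> ball x r \<Longrightarrow>
      u y + a * (norm y)\<^sup>2 + b \<le> u x + a * (norm x)\<^sup>2 + b + q \<bullet> (y - x) + ((y - x) \<bullet> (A *v (y - x))) / 2"
    by blast
  have r: "u y + a * (norm y)\<^sup>2 \<le> u x + a * (norm x)\<^sup>2 + q \<bullet> (y - x) + ((y - x) \<bullet> (A *v (y - x))) / 2"
    if "y \<in> X" "dist x y < r" for y
    using r1[of y] that by simp
  have "A + (2 * (- a)) *\<^sub>R mat 1 \<in> F"
  proof (rule quad_subD[OF u x _ r0])
    show "sym_mat (A + (2 * (- a)) *\<^sub>R mat 1)" using A by (intro sym_mat_add) simp_all
    fix y assume y: "y \<in> X" "dist x y < r"
    have "(norm y)\<^sup>2 = (norm x)\<^sup>2 + 2 * (x \<bullet> (y - x)) + (norm (y - x))\<^sup>2"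
      by (simp add: power2_norm_eq_inner inner_diff inner_commute algebra_simps)
    then have eq: "a * (norm y)\<^sup>2 = a * (norm x)\<^sup>2 + (2 * a) * (x \<bullet> (y - x)) + a * (norm (y - x))\<^sup>2"
      by (simp add: distrib_left)
    show "u y \<le> u x + (q - (2 * a) *\<^sub>R x) \<bullet> (y - x) + ((y - x) \<bullet> ((A + (2 * (- a)) *\<^sub>R mat 1) *v (y - x))) / 2"
      using r[OF y] unfolding eq quad_poly_def[symmetric] quad_poly_add_sq
      by (simp add: quad_poly_def inner_diff_left)
  qed
  moreover have "psd ((2 * a) *\<^sub>R (mat 1 :: real^'n^'n))"
    using a by (simp add: psd_def)
  ultimately have "(A + (2 * (- a)) *\<^sub>R mat 1) + (2 * a) *\<^sub>R mat 1 \<in> F"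
    using F unfolding subequation_def by blast
  then show "A \<in> F" by simp
qed

section \<open>The Riesz kernel and densities\<close>

lemma riesz_K_at_bot:
  assumes "p \<ge> 2" shows "filterlim (riesz_K p) at_bot (at_right 0)"
proof (cases "p = 2")
  case True
  then have "riesz_K p = ln" by (auto simp: riesz_K_def)
  then show ?thesis using ln_at_0 by simp
next
  case False
  then have p: "p > 2" using assms by simp
  have "filterlim (\<lambda>r. r powr (p - 2)) (at_right 0) (at_right 0)"
  proof (rule tendsto_imp_filterlim_at_right)
    have "((\<lambda>r::real. r powr (p - 2)) \<longlongrightarrow> 0 powr (p - 2)) (at_right 0)"
      using p by (intro tendsto_powr' tendsto_intros) (auto simp: eventually_at_filter)
    then show "((\<lambda>r::real. r powr (p - 2)) \<longlongrightarrow> 0) (at_right 0)" using p by simp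
    show "\<forall>\<^sub>F r in at_right 0. r powr (p - 2) > 0"
      by (auto simp: eventually_at_filter)
  qed
  then have "filterlim (\<lambda>r. inverse (r powr (p - 2))) at_top (at_right 0)"
    by (rule filterlim_compose[OF filterlim_inverse_at_top_right])
  then have "filterlim (\<lambda>r. - (1 / (p - 2)) * inverse (r powr (p - 2))) at_bot (at_right 0)"
    using p by (intro filterlim_tendsto_neg_mult_at_bot[OF tendsto_const]) auto
  moreover have "riesz_K p = (\<lambda>r. - (1 / (p - 2)) * inverse (r powr (p - 2)))"
    using False by (auto simp: riesz_K_def powr_minus[symmetric])
  ultimately show ?thesis by simp
qed

lemma riesz_K_eventually_less:
  assumes "p \<ge> 2" shows "\<forall>\<^sub>F r in at_right 0. riesz_K p r < c"
  using riesz_K_at_bot[OF assms] by (simp add: filterlim_at_bot_dense)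

text \<open>The kernel is negative at small radii, so division by it reverses inequalities: the
  upper bound holds at all points of the punctured ball, the lower one at some point. Passing from
  the weak inequalities back to strict ones costs half of \<open>\<epsilon>\<close>.\<close>

lemma density_iff:
  assumes p: "p \<ge> 2"
  shows "has_density p u x0 \<theta> \<longleftrightarrow> (\<forall>\<epsilon>>0. \<forall>\<^sub>F r in at_right 0.
     (\<forall>y\<in>ball x0 r - {x0}. u y \<le> (\<theta> - \<epsilon>) * riesz_K p r) \<and>
     (\<exists>y\<in>ball x0 r - {x0}. (\<theta> + \<epsilon>) * riesz_K p r \<le> u y))"
proof -
  define S where "S r = (SUP y\<in>ball x0 r - {x0}. ereal (u y))" for r
  have div: "ereal a < s / ereal k \<longleftrightarrow> s < ereal (a * k)" "s / ereal k < ereal a \<longleftrightarrow> ereal (a * k) < s"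
    if "k < 0" for a k s
    using that by (cases s; simp add: field_simps)+
  have "has_density p u x0 \<theta> \<longleftrightarrow> ((\<lambda>r. S r / ereal (riesz_K p r)) \<longlongrightarrow> ereal \<theta>) (at_right 0)"
    by (simp add: has_density_def S_def)
  also have "\<dots> \<longleftrightarrow> (\<forall>\<epsilon>>0. \<forall>\<^sub>F r in at_right 0. ereal (\<theta> - \<epsilon>) < S r / ereal (riesz_K p r) \<and> S r / ereal (riesz_K p r) < ereal (\<theta> + \<epsilon>))"
  proof
    assume L: "((\<lambda>r. S r / ereal (riesz_K p r)) \<longlongrightarrow> ereal \<theta>) (at_right 0)"
    then show "\<forall>\<epsilon>>0. \<forall>\<^sub>F r in at_right 0. ereal (\<theta> - \<epsilon>) < S r / ereal (riesz_K p r) \<and> S r / ereal (riesz_K p r) < ereal (\<theta> + \<epsilon>)"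
      by (auto intro!: eventually_conj order_tendstoD[OF L])
  next
    assume R: "\<forall>\<epsilon>>0. \<forall>\<^sub>F r in at_right 0. ereal (\<theta> - \<epsilon>) < S r / ereal (riesz_K p r) \<and> S r / ereal (riesz_K p r) < ereal (\<theta> + \<epsilon>)"
    show "((\<lambda>r. S r / ereal (riesz_K p r)) \<longlongrightarrow> ereal \<theta>) (at_right 0)"
    proof (rule order_tendstoI)
      fix a assume "a < ereal \<theta>"
      then obtain b where "a < ereal b" "ereal b < ereal \<theta>" using ereal_dense2 by blast
      then have "\<forall>\<^sub>F r in at_right 0. ereal (\<theta> - (\<theta> - b)) < S r / ereal (riesz_K p r)"
        using R by (auto elim!: allE[of _ "\<theta> - b"] elim: eventually_mono)
      then show "\<forall>\<^sub>F r in at_right 0. a < S r / ereal (riesz_K p r)"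
        by eventually_elim (use \<open>a < ereal b\<close> in simp)
    next
      fix a assume "ereal \<theta> < a"
      then obtain b where "ereal \<theta> < ereal b" "ereal b < a" using ereal_dense2 by blast
      then have "\<forall>\<^sub>F r in at_right 0. S r / ereal (riesz_K p r) < ereal (\<theta> + (b - \<theta>))"
        using R by (auto elim!: allE[of _ "b - \<theta>"] elim: eventually_mono)
      then show "\<forall>\<^sub>F r in at_right 0. S r / ereal (riesz_K p r) < a"
        by eventually_elim (use \<open>ereal b < a\<close> in simp)
    qed
  qed
  also have "\<dots> \<longleftrightarrow> (\<forall>\<epsilon>>0. \<forall>\<^sub>F r in at_right 0.
     (\<forall>y\<in>ball x0 r - {x0}. u y \<le> (\<theta> - \<epsilon>) * riesz_K p r) \<and>
     (\<exists>y\<in>ball x0 r - {x0}. (\<theta> + \<epsilon>) * riesz_K p r \<le> u y))" (is "?A \<longleftrightarrow> ?B")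
  proof
    assume A: ?A
    show ?B
    proof (intro allI impI)
      fix \<epsilon> :: real assume \<epsilon>: "\<epsilon> > 0"
      from A[rule_format, OF \<epsilon>] riesz_K_eventually_less[OF p, of 0]
      show "\<forall>\<^sub>F r in at_right 0. (\<forall>y\<in>ball x0 r - {x0}. u y \<le> (\<theta> - \<epsilon>) * riesz_K p r) \<and>
         (\<exists>y\<in>ball x0 r - {x0}. (\<theta> + \<epsilon>) * riesz_K p r \<le> u y)"
      proof eventually_elim
        case (elim r)
        then have S: "S r < ereal ((\<theta> - \<epsilon>) * riesz_K p r)" "ereal ((\<theta> + \<epsilon>) * riesz_K p r) < S r"
          using div[OF elim(2)] by blast+
        have "u y \<le> (\<theta> - \<epsilon>) * riesz_K p r" if "y \<in> ball x0 r - {x0}" for y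
        proof -
          have "ereal (u y) \<le> S r" unfolding S_def using that by (rule SUP_upper)
          then have "ereal (u y) < ereal ((\<theta> - \<epsilon>) * riesz_K p r)" using S(1) by (rule le_less_trans)
          then show ?thesis by simp
        qed
        moreover have "\<exists>y\<in>ball x0 r - {x0}. (\<theta> + \<epsilon>) * riesz_K p r \<le> u y"
          using S(2) unfolding S_def less_SUP_iff by (auto intro: less_imp_le)
        ultimately show ?case by blast
      qed
    qed
  next
    assume B: ?B
    show ?A
    proof (intro allI impI)
      fix \<epsilon> :: real assume \<epsilon>: "\<epsilon> > 0"
      then have e2: "\<epsilon> / 2 > 0" by simp
      from B[rule_format, OF e2] riesz_K_eventually_less[OF p, of 0]
      show "\<forall>\<^sub>F r in at_right 0. ereal (\<theta> - \<epsilon>) < S r / ereal (riesz_K p r) \<and> S r / ereal (riesz_K p r) < ereal (\<theta> + \<epsilon>)"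
      proof eventually_elim
        case (elim r)
        have "S r \<le> ereal ((\<theta> - \<epsilon> / 2) * riesz_K p r)"
          unfolding S_def by (rule SUP_least) (use elim(1) in simp)
        also have "\<dots> < ereal ((\<theta> - \<epsilon>) * riesz_K p r)" using elim(2) \<epsilon> by simp
        finally have 1: "S r < ereal ((\<theta> - \<epsilon>) * riesz_K p r)" .
        obtain y where y: "y \<in> ball x0 r - {x0}" "(\<theta> + \<epsilon> / 2) * riesz_K p r \<le> u y" using elim(1) by blast
        have "ereal ((\<theta> + \<epsilon>) * riesz_K p r) < ereal ((\<theta> + \<epsilon> / 2) * riesz_K p r)" using elim(2) \<epsilon> by simp
        also have "\<dots> \<le> ereal (u y)" using y by simp
        also have "\<dots> \<le> S r" unfolding S_def using y(1) by (rule SUP_upper)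
        finally show ?case using 1 div[OF elim(2)] by blast
      qed
    qed
  qed
  finally show ?thesis .
qed

lemma density_imp_to_minus_infinity:
  assumes p: "p \<ge> 2" and u: "has_density p u x0 \<theta>" and \<theta>: "\<theta> > 0"
  obtains s where "s > 0" "\<And>x. x \<in> ball x0 s - {x0} \<Longrightarrow> u x \<le> B"
proof -
  have "\<forall>\<^sub>F r in at_right 0. \<forall>y\<in>ball x0 r - {x0}. u y \<le> (\<theta> - \<theta> / 2) * riesz_K p r"
    using u[unfolded density_iff[OF p], rule_format, of "\<theta> / 2"] \<theta> by (auto elim: eventually_mono)
  moreover note riesz_K_eventually_less[OF p, of "2 * B / \<theta>"]
  ultimately have "\<forall>\<^sub>F r in at_right 0. \<forall>y\<in>ball x0 r - {x0}. u y \<le> B"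
  proof eventually_elim
    case (elim r)
    have "(\<theta> - \<theta> / 2) * riesz_K p r \<le> B" using elim(2) \<theta> by (simp add: field_simps)
    then show ?case using elim(1) by force
  qed
  then obtain b where b: "b > 0" "\<And>r. 0 < r \<Longrightarrow> r < b \<Longrightarrow> \<forall>y\<in>ball x0 r - {x0}. u y \<le> B"
    unfolding eventually_at_right_field by auto
  show ?thesis by (rule that[of "b / 2"]) (use b(1) b(2)[of "b / 2"] in auto)
qed

text \<open>The kernel tends to minus infinity, so the constant \<open>c\<close> is eventually at
  most \<open>\<epsilon> / 2\<close> times its absolute value.\<close>

lemma density_bounded_difference:
  assumes p: "p \<ge> 2" and u: "has_density p u x0 \<theta>" and s: "s > 0"
    and uv: "\<And>x. x \<in> ball x0 s - {x0} \<Longrightarrow> \<bar>u x - v x\<bar> \<le> c"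
  shows "has_density p v x0 \<theta>"
  unfolding density_iff[OF p]
proof (intro allI impI)
  fix \<epsilon> :: real assume \<epsilon>: "\<epsilon> > 0"
  then have e2: "\<epsilon> / 2 > 0" by simp
  have "\<forall>\<^sub>F r in at_right 0. r < s" using s by (auto simp: eventually_at_right_field)
  with u[unfolded density_iff[OF p], rule_format, OF e2] riesz_K_eventually_less[OF p, of "- 2 * c / \<epsilon>"]
  show "\<forall>\<^sub>F r in at_right 0. (\<forall>y\<in>ball x0 r - {x0}. v y \<le> (\<theta> - \<epsilon>) * riesz_K p r) \<and>
     (\<exists>y\<in>ball x0 r - {x0}. (\<theta> + \<epsilon>) * riesz_K p r \<le> v y)"
  proof eventually_elim
    case (elim r)
    define k where "k = riesz_K p r"
    have cK: "c \<le> - (\<epsilon> / 2) * k" using elim(2) \<epsilon> by (simp add: field_simps k_def)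
    have e: "(\<theta> - \<epsilon> / 2) * k - (\<epsilon> / 2) * k = (\<theta> - \<epsilon>) * k" "(\<theta> + \<epsilon> / 2) * k + (\<epsilon> / 2) * k = (\<theta> + \<epsilon>) * k"
      by (simp_all add: field_simps)
    have sub: "y \<in> ball x0 s - {x0}" if "y \<in> ball x0 r - {x0}" for y using that elim(3) by auto
    have "v y \<le> (\<theta> - \<epsilon>) * k" if "y \<in> ball x0 r - {x0}" for y
    proof -
      have "u y \<le> (\<theta> - \<epsilon> / 2) * k" using elim(1) that by (simp add: k_def)
      then show ?thesis using uv[OF sub[OF that]] cK e(1) by linarith
    qed
    moreover
    obtain y where y: "y \<in> ball x0 r - {x0}" "(\<theta> + \<epsilon> / 2) * k \<le> u y"
      using elim(1) unfolding k_def by blast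
    have "(\<theta> + \<epsilon>) * k \<le> v y" using y(2) uv[OF sub[OF y(1)]] cK e(2) by linarith
    with y(1) have "\<exists>y\<in>ball x0 r - {x0}. (\<theta> + \<epsilon>) * k \<le> v y" by blast
    ultimately show ?case unfolding k_def by blast
  qed
qed

lemma density_normalize:
  assumes p: "p \<ge> 2" and u: "has_density p u a \<theta>" and \<theta>: "\<theta> > 0"
  shows "has_density p (\<lambda>x. u (a + x) / \<theta>) 0 1"
  unfolding density_iff[OF p]
proof (intro allI impI)
  fix \<epsilon> :: real assume "\<epsilon> > 0"
  then have "\<theta> * \<epsilon> > 0" using \<theta> by simp
  from u[unfolded density_iff[OF p], rule_format, OF this]
  show "\<forall>\<^sub>F r in at_right 0. (\<forall>y\<in>ball 0 r - {0}. u (a + y) / \<theta> \<le> (1 - \<epsilon>) * riesz_K p r) \<and>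
     (\<exists>y\<in>ball 0 r - {0}. (1 + \<epsilon>) * riesz_K p r \<le> u (a + y) / \<theta>)"
  proof eventually_elim
    case (elim r)
    define k where "k = riesz_K p r"
    have e: "(\<theta> - \<theta> * \<epsilon>) * k = ((1 - \<epsilon>) * k) * \<theta>" "(\<theta> + \<theta> * \<epsilon>) * k = ((1 + \<epsilon>) * k) * \<theta>"
      by (simp_all add: algebra_simps)
    have "u (a + y) / \<theta> \<le> (1 - \<epsilon>) * k" if "y \<in> ball 0 r - {0}" for y
    proof -
      have "a + y \<in> ball a r - {a}" using that by (auto simp: dist_norm)
      then have "u (a + y) \<le> ((1 - \<epsilon>) * k) * \<theta>" using elim unfolding k_def[symmetric] e by blast
      then show ?thesis using \<theta> by (simp add: divide_le_eq)
    qed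
    then have upper: "\<forall>y\<in>ball 0 r - {0}. u (a + y) / \<theta> \<le> (1 - \<epsilon>) * k" by blast
    obtain y where y: "y \<in> ball a r - {a}" "((1 + \<epsilon>) * k) * \<theta> \<le> u y"
      using elim unfolding k_def[symmetric] e by blast
    have "y - a \<in> ball 0 r - {0}" using y(1) by (auto simp: dist_norm norm_minus_commute)
    moreover have "(1 + \<epsilon>) * k \<le> u (a + (y - a)) / \<theta>" using y(2) \<theta> by (simp add: le_divide_eq)
    ultimately have "\<exists>y\<in>ball 0 r - {0}. (1 + \<epsilon>) * k \<le> u (a + y) / \<theta>" by blast
    with upper show ?case unfolding k_def by blast
  qed
qed

text \<open>Points with \<open>\<bar>D x\<bar> \<ge> c\<close> or \<open>norm x = R / 2\<close> form
  a compact subset of the open ball, because \<open>\<bar>D x\<bar> < c\<close> on the sphere. There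
  \<open>R\<^sup>2 - (norm x)\<^sup>2\<close> has a positive lower bound \<open>\<beta>\<close>, and
  a large multiple of it dominates.\<close>

lemma barrier_constant:
  fixes D :: "'a::euclidean_space \<Rightarrow> real"
  assumes R: "R > 0" and c: "c > 0" and D: "continuous_on (cball 0 R - {0}) D"
    and sph: "\<And>x. norm x = R \<Longrightarrow> \<bar>D x\<bar> < c"
  obtains A where "A > 0"
    "\<And>x. R / 2 \<le> norm x \<Longrightarrow> norm x \<le> R \<Longrightarrow> \<bar>D x\<bar> \<le> c + A * (R\<^sup>2 - (norm x)\<^sup>2)"
    "\<And>x. norm x = R / 2 \<Longrightarrow> \<bar>D x\<bar> + c \<le> A * (R\<^sup>2 - (norm x)\<^sup>2)"
proof -
  define N where "N = cball 0 R - ball (0::'a) (R / 2)"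
  have compN: "compact N" unfolding N_def by (intro compact_diff) auto
  have N: "x \<in> N \<longleftrightarrow> R / 2 \<le> norm x \<and> norm x \<le> R" for x by (auto simp: N_def)
  have contN: "continuous_on N (\<lambda>x. \<bar>D x\<bar>)"
    by (intro continuous_intros continuous_on_subset[OF D]) (use R in \<open>auto simp: N_def\<close>)
  obtain D0 where D0: "D0 \<ge> 0" "\<And>x. x \<in> N \<Longrightarrow> \<bar>D x\<bar> \<le> D0"
  proof -
    have "bounded ((\<lambda>x. \<bar>D x\<bar>) ` N)" by (intro compact_imp_bounded compact_continuous_image contN compN)
    then obtain B where "\<And>x. x \<in> N \<Longrightarrow> \<bar>D x\<bar> \<le> B" unfolding bounded_iff by auto
    then show ?thesis by (intro that[of "\<bar>B\<bar>"]) force+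
  qed
  define Z where "Z = {x \<in> N. c \<le> \<bar>D x\<bar> \<or> norm x = R / 2}"
  have "Z = (N \<inter> (\<lambda>x. \<bar>D x\<bar>) -` {c..}) \<union> (N \<inter> sphere 0 (R / 2))" by (auto simp: Z_def)
  moreover have "compact (N \<inter> (\<lambda>x. \<bar>D x\<bar>) -` {c..})"
    using closedin_compact[OF compN continuous_closedin_preimage[OF contN]] by blast
  ultimately have compZ: "compact Z" 
    by (simp only:) (rule compact_Un[OF _ compact_Int[OF compN compact_sphere]])
  have Zlt: "norm x < R" if "x \<in> Z" for x
    using that sph[of x] R by (force simp: Z_def N)
  obtain \<beta> where \<beta>: "\<beta> > 0" "\<And>x. x \<in> Z \<Longrightarrow> \<beta> \<le> R\<^sup>2 - (norm x)\<^sup>2"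
  proof (cases "Z = {}")
    case False
    have "continuous_on Z (\<lambda>x. R\<^sup>2 - (norm x)\<^sup>2)" by (intro continuous_intros)
    from continuous_attains_inf[OF compZ False this] obtain z where
      z: "z \<in> Z" "\<And>x. x \<in> Z \<Longrightarrow> R\<^sup>2 - (norm z)\<^sup>2 \<le> R\<^sup>2 - (norm x)\<^sup>2" by blast
    have "(norm z)\<^sup>2 < R\<^sup>2" using Zlt[OF z(1)] by (intro power_strict_mono) auto
    with z show ?thesis by (intro that[of "R\<^sup>2 - (norm z)\<^sup>2"]) auto
  qed (use that[of 1] in auto)
  define A where "A = (D0 + c) / \<beta>"
  have A: "A > 0" using D0 c \<beta> by (simp add: A_def)
  have AZ: "D0 + c \<le> A * (R\<^sup>2 - (norm x)\<^sup>2)" if "x \<in> Z" for x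
  proof -
    have "D0 + c = A * \<beta>" using \<beta> by (simp add: A_def)
    also have "\<dots> \<le> A * (R\<^sup>2 - (norm x)\<^sup>2)" using \<beta>(2)[OF that] A by (intro mult_left_mono) auto
    finally show ?thesis .
  qed
  show ?thesis
  proof (rule that[OF A])
    fix x :: 'a assume x: "R / 2 \<le> norm x" "norm x \<le> R"
    show "\<bar>D x\<bar> \<le> c + A * (R\<^sup>2 - (norm x)\<^sup>2)"
    proof (cases "x \<in> Z")
      case True
      then show ?thesis using AZ[OF True] D0(2)[of x] x c by (simp add: N)
    next
      case False
      then have "\<bar>D x\<bar> < c" using x by (auto simp: Z_def N)
      moreover have "(norm x)\<^sup>2 \<le> R\<^sup>2" using x by (intro power_mono) auto
      then have "0 \<le> A * (R\<^sup>2 - (norm x)\<^sup>2)" using A by simp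
      ultimately show ?thesis by simp
    qed
  next
    fix x :: 'a assume x: "norm x = R / 2"
    then have "x \<in> Z" "x \<in> N" using R by (auto simp: Z_def N)
    then show "\<bar>D x\<bar> + c \<le> A * (R\<^sup>2 - (norm x)\<^sup>2)" using AZ D0(2) by fastforce
  qed
qed

text \<open>A copy of \<open>H\<close> near the pole that is bent to the boundary values
  \<open>k\<close> near the sphere. Applied to \<open>- H\<close> and \<open>- k\<close> it gives
  the negative of the upper barrier.\<close>

definition lower_barrier :: "real \<Rightarrow> real \<Rightarrow> real \<Rightarrow> (real^'n \<Rightarrow> real) \<Rightarrow> (real^'n \<Rightarrow> real) \<Rightarrow> real^'n \<Rightarrow> real" where
  "lower_barrier R c A H k x =
     (if norm x \<le> R / 2 then H x - c else max (H x - c) (k x + A * (norm x)\<^sup>2 + (- A * R\<^sup>2)))"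

text \<open>On the sphere of radius \<open>R / 2\<close> the second function lies below
  \<open>H - c\<close> by \<open>A2\<close>, so the change of formula is continuous. By
  \<open>A1\<close> it stays below \<open>H + c\<close>, and the two barriers are ordered. The
  general \<open>F\<close> allows a second use for the dual.\<close>

lemma lower_barrier_properties:
  fixes H k :: "real^'n \<Rightarrow> real"
  assumes F: "subequation F" and R: "R > 0" and A: "A > 0" and c: "c > 0"
    and H: "continuous_on (cball 0 R - {0}) H" "quad_sub F (ball 0 R - {0}) H"
    and k: "continuous_on (cball 0 R - {0}) k" "quad_sub F (ball 0 R - {0}) k"
    and A1: "\<forall>x. R / 2 \<le> norm x \<longrightarrow> norm x \<le> R \<longrightarrow> \<bar>H x - k x\<bar> \<le> c + A * (R\<^sup>2 - (norm x)\<^sup>2)"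
    and A2: "\<forall>x. norm x = R / 2 \<longrightarrow> \<bar>H x - k x\<bar> + c \<le> A * (R\<^sup>2 - (norm x)\<^sup>2)"
  shows "continuous_on (cball 0 R - {0}) (lower_barrier R c A H k)"
    "quad_sub F (ball 0 R - {0}) (lower_barrier R c A H k)"
    "norm x \<le> R \<Longrightarrow> H x - c \<le> lower_barrier R c A H k x \<and> lower_barrier R c A H k x \<le> H x + c"
    "norm x \<le> R \<Longrightarrow> lower_barrier R c A H k x \<le> - lower_barrier R c A (\<lambda>x. - H x) (\<lambda>x. - k x) x"
    "norm x = R \<Longrightarrow> lower_barrier R c A H k x = k x"
proof -
  show "continuous_on (cball 0 R - {0}) (lower_barrier R c A H k)"
    unfolding lower_barrier_def
  proof (rule continuous_on_cases_le)
    fix x :: "real^'n" assume "norm x = R / 2"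
    then have "\<bar>H x - k x\<bar> + c \<le> A * (R\<^sup>2 - (norm x)\<^sup>2)" using A2 by blast
    then show "H x - c = max (H x - c) (k x + A * (norm x)\<^sup>2 + (- A * R\<^sup>2))"
      by (simp add: right_diff_distrib)
  qed (auto intro!: continuous_intros continuous_on_subset[OF H(1)] continuous_on_subset[OF k(1)])
  show "quad_sub F (ball 0 R - {0}) (lower_barrier R c A H k)"
  proof (rule quad_sub_glue)
    show "quad_sub F (ball 0 R - {0}) (\<lambda>x. H x + 0 * (norm x)\<^sup>2 + (- c))"
      by (rule quad_sub_add_square[OF F H(2)]) simp
    have op: "open {x :: real^'n. R / 2 < norm x}" by (intro open_Collect_less continuous_intros)
    then show "open {x :: real^'n. R / 2 < norm x}" .
    have "quad_sub F (ball 0 R - {0}) (\<lambda>x. k x + A * (norm x)\<^sup>2 + (- A * R\<^sup>2))"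
      by (rule quad_sub_add_square[OF F k(2)]) (use A in simp)
    then show "quad_sub F ((ball 0 R - {0}) \<inter> {x. R / 2 < norm x}) (\<lambda>x. k x + A * (norm x)\<^sup>2 + (- A * R\<^sup>2))"
      by (rule quad_sub_mono) (intro open_Int op open_delete open_ball, blast)
  qed (auto simp: lower_barrier_def max_def)
  have le: "A * (norm x)\<^sup>2 \<le> A * R\<^sup>2" if "norm x \<le> R" for x :: "real^'n"
    using A that by (intro mult_left_mono power_mono) auto
  have A1': "\<bar>H x - k x\<bar> \<le> c + (A * R\<^sup>2 - A * (norm x)\<^sup>2)" if "R / 2 \<le> norm x" "norm x \<le> R" for x
    using A1 that by (simp add: right_diff_distrib)
  show "norm x \<le> R \<Longrightarrow> H x - c \<le> lower_barrier R c A H k x \<and> lower_barrier R c A H k x \<le> H x + c"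
    using A1'[of x] c by (auto simp: lower_barrier_def)
  show "lower_barrier R c A H k x = k x" if "norm x = R"
    using A1'[of x] R that by (auto simp: lower_barrier_def)
  show "lower_barrier R c A H k x \<le> - lower_barrier R c A (\<lambda>x. - H x) (\<lambda>x. - k x) x" if "norm x \<le> R"
    using A1'[of x] le[OF that] c that by (auto simp: lower_barrier_def)
qed

text \<open>Perron's method between the two barriers produces a harmonic function with the boundary values
  and the density of the kernel that stays within bounded distance of \<open>H\<close>; by uniqueness it is the
  kernel.\<close>

lemma kernel_bound:
  fixes H :: "real^'n \<Rightarrow> real" and p :: real
  defines "K \<equiv> \<lambda>x :: real^'n. riesz_K p (norm x)"
  assumes cone: "cone_subequation F" and p: "p \<ge> 2" and R: "R > 0"
    and K1: "continuous_on (cball 0 R - {0}) K" "F_harmonic F (ball 0 R - {0}) K"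
    and K2: "\<And>h. continuous_on (cball 0 R - {0}) h \<Longrightarrow> F_harmonic F (ball 0 R - {0}) h \<Longrightarrow>
        (\<And>x. norm x = R \<Longrightarrow> h x = riesz_K p R) \<Longrightarrow> has_density p h 0 1 \<Longrightarrow>
        (\<forall>x\<in>cball 0 R - {0}. h x = K x)"
    and H: "continuous_on (cball 0 R - {0}) H" "quad_sub F (ball 0 R - {0}) H"
      "quad_sub (dual_subeq F) (ball 0 R - {0}) (\<lambda>x. - H x)" "has_density p H 0 1"
  shows "\<exists>C. \<forall>x\<in>ball 0 R - {0}. \<bar>H x - K x\<bar> \<le> C"
proof -
  define B where "B = ball (0::real^'n) R - {0}"
  define B' where "B' = cball (0::real^'n) R - {0}"
  have F: "subequation F" by (rule cone_subequation_imp_subequation[OF cone])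
  have dF: "subequation (dual_subeq F)" by (rule subequation_dual[OF F])
  have opB: "open B" unfolding B_def by (intro open_delete open_ball)
  have BB': "B \<subseteq> B'" by (auto simp: B_def B'_def)
  have KS: "quad_sub F B K" "quad_sub (dual_subeq F) B (\<lambda>x. - K x)"
    using K1(2) unfolding F_harmonic_def B_def by (auto intro: F_subharmonic_imp_quad_sub)
  note H' = H[folded B_def B'_def] and K1' = K1(1)[folded B'_def]
  have mH: "continuous_on B' (\<lambda>x. - H x)" and mK: "continuous_on B' (\<lambda>x. - K x)"
    by (intro continuous_intros H' K1')+
  \<comment> \<open>Strictly larger than the discrepancy on the sphere, so that the barriers take
    exactly the values of \<open>K\<close> there.\<close>
  obtain c where c: "c > 0" "\<And>x. norm x = R \<Longrightarrow> \<bar>H x - K x\<bar> < c"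
  proof -
    have "continuous_on (sphere 0 R) (\<lambda>x. H x - K x)"
      by (rule continuous_on_subset[of B']) (intro continuous_intros H' K1', use R in \<open>auto simp: B'_def\<close>)
    then have "bounded ((\<lambda>x. H x - K x) ` sphere 0 R)"
      by (intro compact_imp_bounded compact_continuous_image compact_sphere)
    then obtain b where "\<forall>v\<in>(\<lambda>x. H x - K x) ` sphere 0 R. norm v \<le> b" unfolding bounded_iff by blast
    then have b: "\<bar>H x - K x\<bar> \<le> b" if "norm x = R" for x using that by simp
    show ?thesis by (rule that[of "\<bar>b\<bar> + 1"]) (use b in force)+
  qed
  have "continuous_on (cball 0 R - {0}) (\<lambda>x. H x - K x)" by (intro continuous_intros H K1)
  from barrier_constant[OF R c(1) this c(2)] obtain A where A: "A > 0"
    "\<forall>x. R / 2 \<le> norm x \<longrightarrow> norm x \<le> R \<longrightarrow> \<bar>H x - K x\<bar> \<le> c + A * (R\<^sup>2 - (norm x)\<^sup>2)"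
    "\<forall>x. norm x = R / 2 \<longrightarrow> \<bar>H x - K x\<bar> + c \<le> A * (R\<^sup>2 - (norm x)\<^sup>2)" by blast
  have "\<bar>- H x - - K x\<bar> = \<bar>H x - K x\<bar>" for x by simp
  then have A': "\<forall>x. R / 2 \<le> norm x \<longrightarrow> norm x \<le> R \<longrightarrow> \<bar>- H x - - K x\<bar> \<le> c + A * (R\<^sup>2 - (norm x)\<^sup>2)"
    "\<forall>x. norm x = R / 2 \<longrightarrow> \<bar>- H x - - K x\<bar> + c \<le> A * (R\<^sup>2 - (norm x)\<^sup>2)"
    using A(2,3) by presburger+
  define w where "w = lower_barrier R c A H K"
  define w' where "w' = lower_barrier R c A (\<lambda>x. - H x) (\<lambda>x. - K x)"
  note lw = lower_barrier_properties[OF F R A(1) c(1) H(1) H'(2)[unfolded B_def] K1(1) KS(1)[unfolded B_def] A(2,3),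
      folded w_def B_def B'_def]
  note lw' = lower_barrier_properties[OF dF R A(1) c(1) mH[unfolded B'_def] H'(3)[unfolded B_def] mK[unfolded B'_def]
      KS(2)[unfolded B_def] A', folded w'_def B_def B'_def]
  define W where "W x = - w' x" for x
  have contW: "continuous_on B' W" unfolding W_def by (intro continuous_intros lw'(1))
  have Wsub: "quad_sub (dual_subeq F) B (\<lambda>x. - W x)" using lw'(2) by (simp add: W_def)
  have wW: "w x \<le> W x" if "x \<in> B" for x
    using lw(4)[of x] that by (simp add: W_def w_def w'_def B_def)
  have WH: "W x \<le> H x + c" "H x - c \<le> w x" if "x \<in> B" for x
    using lw(3)[of x] lw'(3)[of x] that by (auto simp: W_def B_def)
  have sph: "w x = riesz_K p R" "W x = riesz_K p R" if "norm x = R" for x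
    using lw(5)[of x] lw'(5)[of x] that by (auto simp: W_def K_def)
  obtain h g where h: "usc_real B h" "quad_sub F B h" and g: "usc_real B g" "quad_sub (dual_subeq F) B g"
    and hb: "\<And>x. x \<in> B \<Longrightarrow> w x \<le> h x \<and> h x \<le> W x" and gb: "\<And>x. x \<in> B \<Longrightarrow> - h x \<le> g x \<and> g x \<le> - w x"
    by (rule perron[OF F opB continuous_on_subset[OF lw(1) BB'] lw(2) continuous_on_subset[OF contW BB'] Wsub wW])
      (assumption, rule that)
  \<comment> \<open>Comparing \<open>h\<close> itself would leave a bounded positive majorant at the
    pole. With the factor \<open>1 + \<eta>\<close> the majorant \<open>(1 + \<eta>) W - w\<close>
    tends to minus infinity there, and on the sphere it equals \<open>\<eta>\<close> times the
    kernel.\<close>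
  have est: "(1 + \<eta>) * h x + g x \<le> \<eta> * \<bar>riesz_K p R\<bar>" if \<eta>: "\<eta> > 0" and x: "x \<in> B" for \<eta> x
  proof (rule comparison_punctured[OF F open_ball bounded_ball, of "{0}" 0 R, folded B_def])
    show "{0} \<subseteq> ball (0::real^'n) R" using R by simp
    show "quad_sub F B (\<lambda>x. (1 + \<eta>) * h x)"
      by (rule quad_sub_scale[OF _ _ h(2)]) (use \<eta> in \<open>auto intro: cone_subequation_scale[OF cone]\<close>)
    show "usc_real B (\<lambda>x. (1 + \<eta>) * h x)"
      unfolding usc_real_def
    proof (intro ballI allI impI)
      fix x b assume x: "x \<in> B" "(1 + \<eta>) * h x < b"
      then have "h x < b / (1 + \<eta>)" using \<eta> by (simp add: field_simps)
      then obtain d where "d > 0" "\<And>y. y \<in> B \<Longrightarrow> dist y x < d \<Longrightarrow> h y < b / (1 + \<eta>)"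
        using h(1) x(1) unfolding usc_real_def by blast
      then show "\<exists>d>0. \<forall>y\<in>B. dist y x < d \<longrightarrow> (1 + \<eta>) * h y < b"
        using \<eta> by (intro exI[of _ d]) (auto simp: field_simps)
    qed
    have "closure (ball (0::real^'n) R) - {0} = B'" using R by (simp add: B'_def)
    then show "continuous_on (closure (ball 0 R) - {0}) (\<lambda>x. (1 + \<eta>) * W x - w x)"
      by (simp only:) (intro continuous_intros contW lw(1))
    show "(1 + \<eta>) * h y + g y \<le> (1 + \<eta>) * W y - w y" if "y \<in> B" for y
    proof -
      have "(1 + \<eta>) * h y \<le> (1 + \<eta>) * W y" using hb[OF that] \<eta> by (intro mult_left_mono) auto
      then show ?thesis using gb[OF that] by linarith
    qed
    show "(1 + \<eta>) * W y - w y \<le> \<eta> * \<bar>riesz_K p R\<bar>" if "y \<in> frontier (ball 0 R)" for y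
    proof -
      have "norm y = R" using that R by simp
      from sph[OF this] \<eta> show ?thesis by (simp add: algebra_simps abs_le_iff mult_left_mono)
    qed
    show "\<exists>s>0. \<forall>x\<in>ball q s \<inter> ball 0 R - {0}. (1 + \<eta>) * W x - w x \<le> \<eta> * \<bar>riesz_K p R\<bar>" if q: "q \<in> {0}" for q
    proof -
      \<comment> \<open>The threshold is where \<open>\<eta> H + (2 + \<eta>) c\<close>, which
        dominates \<open>(1 + \<eta>) W - w\<close>, becomes nonpositive.\<close>
      obtain s where s: "s > 0" "\<And>x. x \<in> ball 0 s - {0} \<Longrightarrow> H x \<le> - ((2 + \<eta>) * c / \<eta>)"
        by (rule density_imp_to_minus_infinity[OF p H(4), of "- ((2 + \<eta>) * c / \<eta>)"]) (simp, rule that)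
      have "(1 + \<eta>) * W x - w x \<le> \<eta> * \<bar>riesz_K p R\<bar>" if x: "x \<in> ball 0 s \<inter> ball 0 R - {0}" for x
      proof -
        have xB: "x \<in> B" using x by (simp add: B_def)
        have "(1 + \<eta>) * W x \<le> (1 + \<eta>) * (H x + c)" using WH(1)[OF xB] \<eta> by (intro mult_left_mono) auto
        then have "(1 + \<eta>) * W x - w x \<le> (1 + \<eta>) * (H x + c) - (H x - c)" using WH(2)[OF xB] by linarith
        also have "\<dots> = \<eta> * H x + (2 + \<eta>) * c" by (simp add: algebra_simps)
        also have "\<eta> * H x \<le> \<eta> * (- ((2 + \<eta>) * c / \<eta>))" using s(2)[of x] x \<eta> by (intro mult_left_mono) auto
        also have "\<eta> * (- ((2 + \<eta>) * c / \<eta>)) + (2 + \<eta>) * c = 0" using \<eta> by simp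
        also have "0 \<le> \<eta> * \<bar>riesz_K p R\<bar>" using \<eta> by simp
        finally show ?thesis by simp
      qed
      then show ?thesis using s(1) q by (intro exI[of _ s]) auto
    qed
  qed (use g x in auto)
  have gh: "g x = - h x" if x: "x \<in> B" for x
  proof -
    have "h x + g x \<le> e" if e: "e > 0" for e
    proof -
      \<comment> \<open>The choice \<open>\<eta> = e / M\<close> replaces the limit
        \<open>\<eta> \<rightarrow> 0\<close> by one explicit estimate.\<close>
      define M where "M = \<bar>riesz_K p R\<bar> + \<bar>h x\<bar> + 1"
      have M: "M > 0" unfolding M_def by simp
      have "(1 + e / M) * h x + g x \<le> e / M * \<bar>riesz_K p R\<bar>" by (rule est) (use e M x in auto)
      then have "h x + g x \<le> e / M * (\<bar>riesz_K p R\<bar> - h x)" by (simp add: algebra_simps)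
      also have "\<dots> \<le> e / M * M" using e M by (intro mult_left_mono) (auto simp: M_def)
      also have "\<dots> = e" using M by simp
      finally show ?thesis .
    qed
    then have "h x + g x \<le> 0" by (rule field_le_epsilon[of "h x + g x" 0, simplified])
    then show ?thesis using gb[OF x] by simp
  qed
  \<comment> \<open>The \<open>else\<close> branch supplies the boundary value on the sphere; the
    value that it also gives at 0 lies outside \<open>B'\<close>.\<close>
  define k where "k x = (if x \<in> B then h x else riesz_K p R)" for x
  have cover: "x \<in> B \<or> norm x = R" if "x \<in> B'" for x using that by (auto simp: B_def B'_def)
  have kb: "w x \<le> k x" "k x \<le> W x" if "x \<in> B'" for x
    using cover[OF that] hb sph by (auto simp: k_def)
  \<comment> \<open>At the sphere semicontinuity comes from a continuous majorant with the same
    boundary value; this is used for \<open>k\<close> with \<open>W\<close> and for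
    \<open>- k\<close> with \<open>- w\<close>.\<close>
  have usc: "usc_real B' f" if f: "usc_real B f" and bd: "\<And>x. x \<in> B' \<Longrightarrow> f x \<le> \<psi> x"
    and \<psi>: "continuous_on B' \<psi>" and eq: "\<And>x. norm x = R \<Longrightarrow> f x = \<psi> x" for f \<psi>
    unfolding usc_real_def
  proof (intro ballI allI impI)
    fix x b assume x: "x \<in> B'" "f x < b"
    show "\<exists>d>0. \<forall>y\<in>B'. dist y x < d \<longrightarrow> f y < b"
    proof (cases "x \<in> B")
      case True
      then obtain d where d: "d > 0" "\<And>y. y \<in> B \<Longrightarrow> dist y x < d \<Longrightarrow> f y < b"
        using f x unfolding usc_real_def by blast
      obtain e where e: "e > 0" "ball x e \<subseteq> B" using opB True open_contains_ball by blast
      show ?thesis using d e by (intro exI[of _ "min d e"]) (auto simp: dist_commute subset_iff)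
    next
      case False
      then have "\<psi> x < b" using cover[OF x(1)] eq x(2) by auto
      then obtain d where d: "d > 0" "\<And>y. y \<in> B' \<Longrightarrow> dist y x < d \<Longrightarrow> \<psi> y < b"
        using usc_real_continuous[OF \<psi>] x(1) unfolding usc_real_def by blast
      show ?thesis using d bd by (intro exI[of _ d]) (auto intro: le_less_trans)
    qed
  qed
  have uk: "usc_real B' k"
  proof (rule usc[OF _ _ contW])
    show "usc_real B k" using h(1) unfolding usc_real_def k_def by simp
  qed (use kb sph in \<open>auto simp: k_def B_def\<close>)
  have umk: "usc_real B' (\<lambda>x. - k x)"
  proof (rule usc)
    show "usc_real B (\<lambda>x. - k x)" using g(1) gh unfolding usc_real_def k_def by simp
    show "continuous_on B' (\<lambda>x. - w x)" by (intro continuous_intros lw(1))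
  qed (use kb sph in \<open>auto simp: k_def B_def\<close>)
  have contk: "continuous_on B' k"
    unfolding continuous_on_iff
  proof (intro ballI allI impI)
    fix x and e :: real assume x: "x \<in> B'" and e: "e > 0"
    obtain d1 where d1: "d1 > 0" "\<And>y. y \<in> B' \<Longrightarrow> dist y x < d1 \<Longrightarrow> k y < k x + e"
      using uk x e unfolding usc_real_def by (metis less_add_same_cancel1)
    obtain d2 where d2: "d2 > 0" "\<And>y. y \<in> B' \<Longrightarrow> dist y x < d2 \<Longrightarrow> - k y < - k x + e"
      using umk x e unfolding usc_real_def by (metis less_add_same_cancel1)
    show "\<exists>d>0. \<forall>y\<in>B'. dist y x < d \<longrightarrow> dist (k y) (k x) < e"
      using d1 d2 by (intro exI[of _ "min d1 d2"]) (fastforce simp: dist_real_def abs_less_iff)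
  qed
  have "F_harmonic F B k"
    unfolding F_harmonic_def
  proof (intro conjI)
    show "continuous_on B k" using contk BB' by (rule continuous_on_subset)
    show "F_subharmonic F B (\<lambda>x. ereal (k x))"
      by (rule quad_sub_imp_F_subharmonic[OF F usc_real_subset[OF uk BB'] quad_sub_local[OF h(2)]]) (simp add: k_def)
    show "F_subharmonic (dual_subeq F) B (\<lambda>x. ereal (- k x))"
      by (rule quad_sub_imp_F_subharmonic[OF dF usc_real_subset[OF umk BB'] quad_sub_local[OF g(2)]]) (simp add: k_def gh)
  qed
  moreover have kH: "\<bar>H x - k x\<bar> \<le> c" if "x \<in> B" for x
    using WH[OF that] kb[of x] that BB' by (auto simp: abs_le_iff)
  then have "has_density p k 0 1"
    by (intro density_bounded_difference[OF p H(4) R, of k c]) (simp add: B_def)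
  ultimately have "\<forall>x\<in>B'. k x = K x"
    using K2[of k] contk unfolding B'_def B_def by (simp add: k_def B_def)
  then have "\<forall>x\<in>B. \<bar>H x - K x\<bar> \<le> c" using kH BB' by fastforce
  then show ?thesis unfolding B_def by blast
qed

text \<open>The pole is moved to the origin and \<open>H\<close> divided by \<open>\<theta>\<close>,
  which is allowed since \<open>F\<close> and its dual are cones. On a closed ball that contains no
  other pole, \<open>kernel_bound\<close> applies.\<close>

lemma kernel_asymptotics:
  fixes H :: "real^'n \<Rightarrow> real" and p :: real
  assumes cone: "cone_subequation F" and p: "p \<ge> 2"
    and Kp_unique: "\<forall>R>0.
        (continuous_on (cball (0::real^'n) R - {0}) (\<lambda>x::real^'n. riesz_K p (norm x))
         \<and> F_harmonic F (ball 0 R - {0}) (\<lambda>x::real^'n. riesz_K p (norm x))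
         \<and> has_density p (\<lambda>x::real^'n. riesz_K p (norm x)) 0 1)
      \<and> (\<forall>h. continuous_on (cball 0 R - {0}) h
            \<and> F_harmonic F (ball 0 R - {0}) h
            \<and> (\<forall>x. norm x = R \<longrightarrow> h x = riesz_K p R)
            \<and> has_density p h 0 1
          \<longrightarrow> (\<forall>x\<in>cball 0 R - {0}. h x = riesz_K p (norm x)))"
    and \<Omega>: "open \<Omega>" and P: "finite P" "a \<in> \<Omega>"
    and H: "F_harmonic F (\<Omega> - P) H" "has_density p H a \<theta>" and \<theta>: "\<theta> > 0"
  obtains C s where "s > 0" "\<And>x. x \<in> ball a s - {a} \<Longrightarrow> \<bar>H x - \<theta> * riesz_K p (norm (x - a))\<bar> \<le> C"
proof -
  have "open (\<Omega> - (P - {a}))" using \<Omega> P by (intro open_Diff finite_imp_closed) auto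
  moreover have "a \<in> \<Omega> - (P - {a})" using P by simp
  ultimately obtain R where R: "R > 0" "cball a R \<subseteq> \<Omega> - (P - {a})"
    using open_contains_cball by blast
  have in\<Omega>: "a + y \<in> \<Omega> - P" if "y \<in> cball 0 R - {0}" for y
  proof -
    have "a + y \<in> cball a R" using that by (simp add: dist_norm)
    then have "a + y \<in> \<Omega> - (P - {a})" using R by blast
    then show ?thesis using that by auto
  qed
  have in\<Omega>': "a + y \<in> \<Omega> - P" if "y \<in> ball 0 R - {0}" for y using in\<Omega>[of y] that by simp
  have HS: "quad_sub F (\<Omega> - P) H" "quad_sub (dual_subeq F) (\<Omega> - P) (\<lambda>x. - H x)" "continuous_on (\<Omega> - P) H"
    using H(1) unfolding F_harmonic_def by (auto intro: F_subharmonic_imp_quad_sub)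
  define h where "h y = H (a + y) / \<theta>" for y
  have opB: "open (ball (0::real^'n) R - {0})" by (intro open_delete open_ball)
  have it: "1 / \<theta> > 0" using \<theta> by simp
  have "\<exists>C. \<forall>x\<in>ball 0 R - {0}. \<bar>h x - riesz_K p (norm x)\<bar> \<le> C"
  proof (rule kernel_bound[OF cone p R(1)])
    show "continuous_on (cball 0 R - {0}) (\<lambda>x::real^'n. riesz_K p (norm x))"
      "F_harmonic F (ball 0 R - {0}) (\<lambda>x::real^'n. riesz_K p (norm x))"
      using Kp_unique R(1) by blast+
    show "\<forall>x\<in>cball 0 R - {0}. h x = riesz_K p (norm x)"
      if "continuous_on (cball 0 R - {0}) h" "F_harmonic F (ball 0 R - {0}) h"
        "\<And>x. norm x = R \<Longrightarrow> h x = riesz_K p R" "has_density p h 0 1" for h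
      using Kp_unique R(1) that by blast
    show "continuous_on (cball 0 R - {0}) h"
      unfolding h_def using \<theta> by (intro continuous_intros continuous_on_compose2[OF HS(3)]) (use in\<Omega> in auto)
    have "quad_sub F (ball 0 R - {0}) (\<lambda>y. (1 / \<theta>) * H (a + y))"
      by (rule quad_sub_scale[OF cone_subequation_scale[OF cone it] it quad_sub_translate[OF HS(1) opB in\<Omega>']])
    then show "quad_sub F (ball 0 R - {0}) h" by (simp add: h_def[abs_def])
    have "quad_sub (dual_subeq F) (ball 0 R - {0}) (\<lambda>y. (1 / \<theta>) * - H (a + y))"
      by (rule quad_sub_scale[OF dual_subeq_scale[OF cone it] it quad_sub_translate[OF HS(2) opB in\<Omega>']])
    then show "quad_sub (dual_subeq F) (ball 0 R - {0}) (\<lambda>y. - h y)" by (simp add: h_def[abs_def])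
    show "has_density p h 0 1" unfolding h_def[abs_def] by (rule density_normalize[OF p H(2) \<theta>])
  qed
  then obtain C where C: "\<And>y. y \<in> ball 0 R - {0} \<Longrightarrow> \<bar>h y - riesz_K p (norm y)\<bar> \<le> C" by blast
  show ?thesis
  proof (rule that[OF R(1)])
    fix x assume x: "x \<in> ball a R - {a}"
    then have "x - a \<in> ball 0 R - {0}" by (auto simp: dist_norm norm_minus_commute)
    from C[OF this] have "\<theta> * \<bar>H x / \<theta> - riesz_K p (norm (x - a))\<bar> \<le> \<theta> * C"
      using \<theta> by (intro mult_left_mono) (auto simp: h_def)
    moreover have "\<theta> * \<bar>H x / \<theta> - riesz_K p (norm (x - a))\<bar> = \<bar>H x - \<theta> * riesz_K p (norm (x - a))\<bar>"
    proof -
      have "\<theta> * \<bar>H x / \<theta> - riesz_K p (norm (x - a))\<bar> = \<bar>\<theta> * (H x / \<theta> - riesz_K p (norm (x - a)))\<bar>"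
        using \<theta> by (simp add: abs_mult)
      also have "\<dots> = \<bar>H x - \<theta> * riesz_K p (norm (x - a))\<bar>" using \<theta> by (simp add: right_diff_distrib)
      finally show ?thesis .
    qed
    ultimately show "\<bar>H x - \<theta> * riesz_K p (norm (x - a))\<bar> \<le> \<theta> * C" by simp
  qed
qed

text \<open>Since \<open>H1\<close> tends to minus infinity at the poles, \<open>(1 + \<eta>) H1 - H2\<close> does so as well
  whenever \<open>H1 - H2\<close> stays bounded there.\<close>

lemma harmonic_le_of_bounded_difference:
  fixes H1 H2 :: "real^'n \<Rightarrow> real"
  assumes cone: "cone_subequation F" and \<Omega>: "open \<Omega>" "bounded \<Omega>" and P: "finite P" "P \<subseteq> \<Omega>"
    and H1: "continuous_on (closure \<Omega> - P) H1" "F_harmonic F (\<Omega> - P) H1"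
    and H2: "continuous_on (closure \<Omega> - P) H2" "F_harmonic F (\<Omega> - P) H2"
    and bd: "\<And>x. x \<in> frontier \<Omega> \<Longrightarrow> H1 x = H2 x"
    and pole: "\<And>a B. a \<in> P \<Longrightarrow> \<exists>s>0. \<forall>x\<in>ball a s - {a}. H1 x \<le> B"
    and diff: "\<And>a. a \<in> P \<Longrightarrow> \<exists>s>0. \<exists>C. \<forall>x\<in>ball a s - {a}. H1 x - H2 x \<le> C"
    and x: "x \<in> \<Omega> - P"
  shows "H1 x \<le> H2 x"
proof -
  have frP: "frontier \<Omega> \<subseteq> closure \<Omega> - P"
    using P(2) \<Omega>(1) by (auto simp: frontier_def interior_open)
  obtain M where M: "\<And>y. y \<in> frontier \<Omega> \<Longrightarrow> \<bar>H1 y\<bar> \<le> M"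
  proof -
    have "compact (H1 ` frontier \<Omega>)"
      by (intro compact_continuous_image continuous_on_subset[OF H1(1) frP] compact_frontier_bounded \<Omega>(2))
    from compact_imp_bounded[OF this] obtain b where "\<forall>v\<in>H1 ` frontier \<Omega>. norm v \<le> b"
      unfolding bounded_iff by blast
    then show ?thesis by (intro that[of b]) simp
  qed
  define N where "N = \<bar>M\<bar>"
  have open\<Omega>P: "\<Omega> - P \<subseteq> closure \<Omega> - P" using closure_subset by blast
  have est: "(1 + \<eta>) * H1 x + - H2 x \<le> \<eta> * N" if \<eta>: "\<eta> > 0" for \<eta>
  proof (rule comparison_punctured[OF cone_subequation_imp_subequation[OF cone] \<Omega> P])
    show "usc_real (\<Omega> - P) (\<lambda>x. (1 + \<eta>) * H1 x)" "usc_real (\<Omega> - P) (\<lambda>x. - H2 x)"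
      by (intro usc_real_continuous continuous_intros continuous_on_subset[OF H1(1) open\<Omega>P]
          continuous_on_subset[OF H2(1) open\<Omega>P])+
    have "quad_sub F (\<Omega> - P) H1"
      using H1(2) unfolding F_harmonic_def by (auto intro: F_subharmonic_imp_quad_sub)
    then show "quad_sub F (\<Omega> - P) (\<lambda>x. (1 + \<eta>) * H1 x)"
      by (rule quad_sub_scale[rotated 2]) (use \<eta> in \<open>auto intro: cone_subequation_scale[OF cone]\<close>)
    show "quad_sub (dual_subeq F) (\<Omega> - P) (\<lambda>x. - H2 x)"
      using H2(2) unfolding F_harmonic_def by (auto intro: F_subharmonic_imp_quad_sub)
    show "continuous_on (closure \<Omega> - P) (\<lambda>x. (1 + \<eta>) * H1 x - H2 x)"
      by (intro continuous_intros H1 H2)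
    show "(1 + \<eta>) * H1 y - H2 y \<le> \<eta> * N" if "y \<in> frontier \<Omega>" for y
    proof -
      have "(1 + \<eta>) * H1 y - H2 y = \<eta> * H1 y" using bd[OF that] by (simp add: algebra_simps)
      also have "\<dots> \<le> \<eta> * N" using M[OF that] \<eta> by (intro mult_left_mono) (auto simp: N_def)
      finally show ?thesis .
    qed
    show "\<exists>s>0. \<forall>x\<in>ball a s \<inter> \<Omega> - P. (1 + \<eta>) * H1 x - H2 x \<le> \<eta> * N" if a: "a \<in> P" for a
    proof -
      obtain s C where s: "s > 0" "\<And>x. x \<in> ball a s - {a} \<Longrightarrow> H1 x - H2 x \<le> C" using diff[OF a] by blast
      \<comment> \<open>Below this level \<open>\<eta> * H1\<close> is at most \<open>- C\<close>
        and cancels the bound on \<open>H1 - H2\<close>.\<close>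
      obtain r where r: "r > 0" "\<And>x. x \<in> ball a r - {a} \<Longrightarrow> H1 x \<le> - (C / \<eta>)" using pole[OF a] by blast
      have "(1 + \<eta>) * H1 x - H2 x \<le> \<eta> * N" if x: "x \<in> ball a (min s r) \<inter> \<Omega> - P" for x
      proof -
        have "x \<in> ball a s - {a}" "x \<in> ball a r - {a}" using x a by auto
        from s(2)[OF this(1)] r(2)[OF this(2)] have 1: "H1 x - H2 x \<le> C" and 2: "H1 x \<le> - (C / \<eta>)" .
        have "\<eta> * H1 x \<le> \<eta> * - (C / \<eta>)" using 2 \<eta> by (intro mult_left_mono) auto
        then have "\<eta> * H1 x \<le> - C" using \<eta> by simp
        moreover have "0 \<le> \<eta> * N" using \<eta> by (simp add: N_def)
        ultimately show ?thesis using 1 by (simp add: distrib_right)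
      qed
      then show ?thesis using s(1) r(1) by (intro exI[of _ "min s r"]) auto
    qed
  qed (use x in auto)
  have "H1 x \<le> H2 x + e" if e: "e > 0" for e
  proof -
    \<comment> \<open>With \<open>\<eta> = e / L\<close> the error
      \<open>\<eta> * (N - H1 x)\<close> is at most \<open>e\<close>.\<close>
    define L where "L = N + \<bar>H1 x\<bar> + 1"
    have L: "L > 0" unfolding L_def N_def by simp
    have "(1 + e / L) * H1 x + - H2 x \<le> e / L * N" by (rule est) (use e L in simp)
    then have "H1 x - H2 x \<le> e / L * (N - H1 x)" by (simp add: algebra_simps)
    also have "\<dots> \<le> e / L * L" using e L by (intro mult_left_mono) (auto simp: L_def)
    also have "\<dots> = e" using L by simp
    finally show ?thesis by simp
  qed
  then show ?thesis by (rule field_le_epsilon)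
qed

theorem theorem4p4:
  fixes F :: "(real^'n^'n) set" and p :: real
    and \<Omega> :: "(real^'n) set" and \<phi> :: "real^'n \<Rightarrow> real"
    and xs :: "(real^'n) list" and \<Theta>s :: "real list"
  assumes cone: "cone_subequation F"
    and riesz: "riesz_characteristic F p" and p2: "p \<ge> 2"
    and negPe: "\<forall>e::real^'n. norm e = 1 \<longrightarrow> - proj_line e \<notin> F"
    and Kp_unique: "\<forall>R>0.
        (continuous_on (cball (0::real^'n) R - {0}) (\<lambda>x::real^'n. riesz_K p (norm x))
         \<and> F_harmonic F (ball 0 R - {0}) (\<lambda>x::real^'n. riesz_K p (norm x))
         \<and> has_density p (\<lambda>x::real^'n. riesz_K p (norm x)) 0 1)
      \<and> (\<forall>h. continuous_on (cball (0::real^'n) R - {0}) h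
            \<and> F_harmonic F (ball 0 R - {0}) h
            \<and> (\<forall>x. norm x = R \<longrightarrow> h x = riesz_K p R)
            \<and> has_density p h 0 1
          \<longrightarrow> (\<forall>x\<in>cball 0 R - {0}. h x = riesz_K p (norm x)))"
    and dom: "open \<Omega>" "connected \<Omega>" "bounded \<Omega>" "\<Omega> \<noteq> {}"
    and bdry: "strictly_F_convex_boundary F \<Omega>"
    and phi: "continuous_on (frontier \<Omega>) \<phi>"
    and pts: "distinct xs" "set xs \<subseteq> \<Omega>"
    and thetas: "length \<Theta>s = length xs" "\<forall>\<theta>\<in>set \<Theta>s. \<theta> > 0"
  shows "\<forall>H1 H2.
      (continuous_on (closure \<Omega> - set xs) H1 \<and> F_harmonic F (\<Omega> - set xs) H1
        \<and> (\<forall>x\<in>frontier \<Omega>. H1 x = \<phi> x)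
        \<and> (\<forall>j<length xs. has_density p H1 (xs!j) (\<Theta>s!j)))
    \<and> (continuous_on (closure \<Omega> - set xs) H2 \<and> F_harmonic F (\<Omega> - set xs) H2
        \<and> (\<forall>x\<in>frontier \<Omega>. H2 x = \<phi> x)
        \<and> (\<forall>j<length xs. has_density p H2 (xs!j) (\<Theta>s!j)))
    \<longrightarrow> (\<forall>x\<in>closure \<Omega> - set xs. H1 x = H2 x)"
proof (intro allI impI)
  fix H1 H2 :: "real^'n \<Rightarrow> real"
  let ?sol = "\<lambda>H. continuous_on (closure \<Omega> - set xs) H \<and> F_harmonic F (\<Omega> - set xs) H
        \<and> (\<forall>x\<in>frontier \<Omega>. H x = \<phi> x) \<and> (\<forall>j<length xs. has_density p H (xs!j) (\<Theta>s!j))"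
  assume sol: "?sol H1 \<and> ?sol H2"
  \<comment> \<open>The assumptions are symmetric in the two solutions, so one inequality inside the
    domain suffices.\<close>
  have le: "H x \<le> H' x" if H: "?sol H" and H': "?sol H'" and x: "x \<in> \<Omega> - set xs" for H H' x
  proof (rule harmonic_le_of_bounded_difference[OF cone dom(1,3) finite_set pts(2)])
    fix a assume "a \<in> set xs"
    then obtain j where j: "j < length xs" "a = xs ! j" by (auto simp: in_set_conv_nth)
    then have a\<Omega>: "a \<in> \<Omega>" using pts(2) by auto
    have \<theta>: "\<Theta>s ! j > 0" using thetas j(1) by simp
    have dens: "has_density p H a (\<Theta>s ! j)" "has_density p H' a (\<Theta>s ! j)" using H H' j by auto
    show "\<exists>s>0. \<forall>x\<in>ball a s - {a}. H x \<le> B" for B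
      using density_imp_to_minus_infinity[OF p2 dens(1) \<theta>] by metis
    have harm: "F_harmonic F (\<Omega> - set xs) H" "F_harmonic F (\<Omega> - set xs) H'" using H H' by auto
    obtain C s where C: "s > 0" "\<And>x. x \<in> ball a s - {a} \<Longrightarrow> \<bar>H x - \<Theta>s ! j * riesz_K p (norm (x - a))\<bar> \<le> C"
      by (rule kernel_asymptotics[OF cone p2 Kp_unique dom(1) finite_set a\<Omega> harm(1) dens(1) \<theta>]) (rule that)
    obtain C' s' where C': "s' > 0" "\<And>x. x \<in> ball a s' - {a} \<Longrightarrow> \<bar>H' x - \<Theta>s ! j * riesz_K p (norm (x - a))\<bar> \<le> C'"
      by (rule kernel_asymptotics[OF cone p2 Kp_unique dom(1) finite_set a\<Omega> harm(2) dens(2) \<theta>]) (rule that)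
    \<comment> \<open>Both solutions have the same density at \<open>a\<close>, so the same multiple
      of the kernel cancels.\<close>
    have "H x - H' x \<le> C + C'" if "x \<in> ball a (min s s') - {a}" for x
      using C(2)[of x] C'(2)[of x] that by (auto simp: abs_le_iff)
    then show "\<exists>s>0. \<exists>C. \<forall>x\<in>ball a s - {a}. H x - H' x \<le> C"
      using C(1) C'(1) by (intro exI[of _ "min s s'"] conjI exI[of _ "C + C'"] ballI) simp_all
  qed (use H H' x in auto)
  show "\<forall>x\<in>closure \<Omega> - set xs. H1 x = H2 x"
  proof
    fix x assume x: "x \<in> closure \<Omega> - set xs"
    show "H1 x = H2 x"
    proof (cases "x \<in> \<Omega>")
      case True
      then show ?thesis using le[of H1 H2 x] le[of H2 H1 x] sol x by fastforce
    next
      case False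
      then have "x \<in> frontier \<Omega>" using x dom(1) by (simp add: frontier_def interior_open)
      then show ?thesis using sol by simp
    qed
  qed
qed

end
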